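(* If a bihamiltonian structure on $M$ is strictly Lenard-integrable at $m_0\in M$, then there is an open subset $U$ of $M$, with $m_0$ in the closure of $U$, on which the bihamiltonian structure is homogeneous.
   Context: A bihamiltonian structure is a ($C^\infty$ or analytic) manifold $M$ with two Poisson brackets $\{,\}_1,\{,\}_2$ which are compatible, i.e. $\lambda_1\{,\}_1+\lambda_2\{,\}_2$ is Poisson for all $\lambda_1,\lambda_2$. A function $F$ is Casimir for $\{,\}$ if $\{F,f\}=0$ for every function $f$. Each bracket induces on each cotangent space a skew-symmetric pairing $(df|_m,dg|_m)=\{f,g\}|_m$, so one gets a pair of skew-symmetric pairings on $T_m^*M\otimes\mathbb C$ (on $T_m^*M$ if $M$ is complex). Any pair of skew-symmetric pairings on a finite-dimensional complex vector space is a direct sum of indecomposable pairs, with types uniquely determined: Jordan blocks (even-dimensional), and Kronecker blocks $\mathcal K_{2k-1}$ (odd-dimensional): basis $\mathbf w_0,\dots,\mathbf w_{2k-2}$, the only nonzero pairings (up to skew-symmetry) being $(\mathbf w_{2l},\mathbf w_{2l+1})_1=1$, $(\mathbf w_{2l+1},\mathbf w_{2l+2})_2=1$, $0\le l\le k-2$. A bihamiltonian structure is homogeneous (of type $(2k_1-1,\dots,2k_s-1)$) if for every $m$ the pair of pairings on $T_m^*M\otimes\mathbb C$ is isomorphic to $\bigoplus_i\mathcal K_{2k_i-1}$, with $k_1,\dots,k_s$ independent of $m$. The action dimension of a complex vector space $V$ with two skew-symmetric pairings is $\frac{\dim V+s}{2}$, where $s$ is the number of Kronecker blocks of $V$. The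 action dimension of a bihamiltonian structure on $M$ at $m_0$ is the lower limit, as $m\to m_0$, of the action dimensions of $T_m^*M\otimes\mathbb C$. Functions on an open set $V$ are called (functionally) independent if their differentials are linearly independent at generic points (points of an open dense subset of $V$); a function depends functionally on a collection if at generic points its differential lies in the span of the differentials of the collection. Anchored Lenard scheme near $m_0$: on a neighbourhood $V$ of $m_0$ take a maximal independent collection $H_0^{(1)},\dots,H_0^{(r)}$ of Casimir functions for $\{,\}_1$, and for each $t$ solve the recurrence relations $\{H_i^{(t)},f\}_2=-\{H_{i+1}^{(t)},f\}_1$ for all functions $f$, until the new functions depend on the old ones; thus one obtains numbers $k_1,\dots,k_r$ and an independent collection $\{H_i^{(t)}\}$, $1\le t\le r$, $0\le i\le k_t$, on which all further functions $H_i^{(t)}$ depend functionally. The structure is Lenard-integrable at $m_0$ if the number $\sum_{t=1}^r(k_t+1)$ of independent functions provided by the anchored Lenard scheme in an appropriate neighbourhood of $m_0$ equals the action dimension of $M$ at $m_0$. It is strictly Lenard-integrable at $m_0$ if it is Lenard-integrable at $m_0$ and the sequences $H_i^{(t)}$ can be continued (satisfying the recurrence relations) for all $i>k_t$ as well. *)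

theory Defs
  imports "HOL-Analysis.Analysis"
begin

section \<open>Ground fields and regularity classes\<close>

text \<open>
  Manifolds are modelled on \<open>'k^'n\<close>, where \<open>'k\<close> is the real or the complex field.  By the
  Gelfand--Mazur theorem these are, up to isometric isomorphism, the only instances of the class
  below.  The embedding \<open>to_complex\<close> serves to form \<open>T\<^sub>m\<^sup>*M \<otimes> \<complex>\<close> for real \<open>M\<close>; for complex \<open>M\<close>
  it is the identity, and the cotangent space itself is used.
\<close>

class ground_field = real_normed_field + euclidean_space +
  fixes to_complex :: "'a \<Rightarrow> complex"
  assumes to_complex_add: "to_complex (x + y) = to_complex x + to_complex y"
    and to_complex_mult: "to_complex (x * y) = to_complex x * to_complex y"
    and to_complex_scaleR: "to_complex (r *\<^sub>R x) = r *\<^sub>R to_complex x"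
    and norm_to_complex: "norm (to_complex x) = norm x"

instantiation real :: ground_field
begin
definition to_complex_real :: "real \<Rightarrow> complex" where "to_complex_real = complex_of_real"
instance proof
  fix x y r :: real
  show "to_complex (x + y) = to_complex x + to_complex y"
    unfolding to_complex_real_def by (rule of_real_add)
  show "to_complex (x * y) = to_complex x * to_complex y"
    unfolding to_complex_real_def by (rule of_real_mult)
  show "to_complex (r *\<^sub>R x) = r *\<^sub>R to_complex x"
    unfolding to_complex_real_def by (simp only: real_scaleR_def of_real_mult scaleR_conv_of_real)
  show "norm (to_complex x) = norm x"
    unfolding to_complex_real_def by (simp only: norm_of_real real_norm_def)
qed
end

instantiation complex :: ground_field
begin
definition to_complex_complex :: "complex \<Rightarrow> complex" where "to_complex_complex = (\<lambda>z. z)"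
instance by standard (simp_all only: to_complex_complex_def)
end

text \<open>
  Derivatives are taken over \<open>'k\<close>.  So for \<open>'k = complex\<close> both classes \<open>C_infinity\<close> and \<open>C_omega\<close>
  consist of the holomorphic functions, while for \<open>'k = real\<close> they consist of the smooth and of
  the real-analytic functions, respectively.
\<close>

datatype regularity = C_infinity | C_omega

fun Ck_on :: "nat \<Rightarrow> ('k::ground_field ^ 'n::finite) set \<Rightarrow> ('k ^ 'n \<Rightarrow> 'k) \<Rightarrow> bool" where
  "Ck_on 0 S f \<longleftrightarrow> continuous_on S f"
| "Ck_on (Suc j) S f \<longleftrightarrow>
     (\<exists>g. (\<forall>x\<in>S. (f has_derivative (\<lambda>h. \<Sum>i\<in>UNIV. g i x * h $ i)) (at x)) \<and>
          (\<forall>i. Ck_on j S (g i)))"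

definition power_series_at :: "('k::ground_field ^ 'n::finite \<Rightarrow> 'k) \<Rightarrow> 'k ^ 'n \<Rightarrow> bool" where
  "power_series_at f a \<longleftrightarrow>
     (\<exists>(c :: ('n \<Rightarrow> nat) \<Rightarrow> 'k) r. r > 0 \<and>
        (\<forall>x\<in>ball a r. ((\<lambda>\<alpha>. c \<alpha> * (\<Prod>i\<in>UNIV. (x $ i - a $ i) ^ \<alpha> i)) has_sum f x) UNIV))"

text \<open>The set \<open>S\<close> is meant to be open.\<close>

fun regular_on :: "regularity \<Rightarrow> ('k::ground_field ^ 'n::finite) set \<Rightarrow> ('k ^ 'n \<Rightarrow> 'k) \<Rightarrow> bool" where
  "regular_on C_infinity S f \<longleftrightarrow> (\<forall>j. Ck_on j S f)"
| "regular_on C_omega S f \<longleftrightarrow> (\<forall>a\<in>S. power_series_at f a)"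

section \<open>Manifolds\<close>

text \<open>
  The points of the manifold are the elements of a Hausdorff second countable type.  A chart is an
  open set together with a coordinate map, whose values outside of that set are irrelevant.
\<close>

type_synonym ('a, 'k, 'n) chart = "'a set \<times> ('a \<Rightarrow> 'k ^ 'n)"

definition chart_inv :: "('a, 'k, 'n::finite) chart \<Rightarrow> 'k ^ 'n \<Rightarrow> 'a" where
  "chart_inv c = inv_into (fst c) (snd c)"

definition is_chart :: "('a::topological_space, 'k::ground_field, 'n::finite) chart \<Rightarrow> bool" where
  "is_chart c \<longleftrightarrow> open (fst c) \<and> open (snd c ` fst c) \<and>
     homeomorphism (fst c) (snd c ` fst c) (snd c) (chart_inv c)"

definition is_manifold ::
    "regularity \<Rightarrow> ('a::{t2_space,second_countable_topology}, 'k::ground_field, 'n::finite) chart set \<Rightarrow> bool"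
  where
  "is_manifold \<rho> \<A> \<longleftrightarrow> (\<forall>c\<in>\<A>. is_chart c) \<and> (\<Union>c\<in>\<A>. fst c) = UNIV \<and>
     (\<forall>c\<in>\<A>. \<forall>d\<in>\<A>. \<forall>i.
        regular_on \<rho> (snd c ` (fst c \<inter> fst d)) (\<lambda>x. snd d (chart_inv c x) $ i))"

text \<open>
  Functions on an open subset \<open>V\<close> are represented by total functions, whose values outside of
  \<open>V\<close> are irrelevant.
\<close>

definition functions_on ::
    "regularity \<Rightarrow> ('a::topological_space, 'k::ground_field, 'n::finite) chart set \<Rightarrow> 'a set \<Rightarrow> ('a \<Rightarrow> 'k) set"
  where
  "functions_on \<rho> \<A> V =
     {f. \<forall>c\<in>\<A>. regular_on \<rho> (snd c ` (fst c \<inter> V)) (\<lambda>x. f (chart_inv c x))}"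

text \<open>
  The cotangent space at \<open>m\<close> is identified with \<open>'k^'n\<close> by means of the basis \<open>dx\<^sub>1, \<dots>, dx\<^sub>n\<close> given
  by the coordinates of one chosen chart around \<open>m\<close>.  All the notions below are invariant under
  linear isomorphisms of the cotangent space at each point, so they do not depend on the choice.
\<close>

definition chart_at :: "('a, 'k, 'n::finite) chart set \<Rightarrow> 'a \<Rightarrow> ('a, 'k, 'n) chart" where
  "chart_at \<A> m = (SOME c. c \<in> \<A> \<and> m \<in> fst c)"

definition differential ::
    "('a, 'k::ground_field, 'n::finite) chart set \<Rightarrow> ('a \<Rightarrow> 'k) \<Rightarrow> 'a \<Rightarrow> 'k ^ 'n" where
  "differential \<A> f m =
     (let c = chart_at \<A> m
      in \<chi> i. frechet_derivative (\<lambda>x. f (chart_inv c x)) (at (snd c m)) (axis i 1))"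

section \<open>Poisson brackets and bihamiltonian structures\<close>

text \<open>
  A bracket is an operation on the sheaf of functions: it is defined on functions on an arbitrary
  open set and commutes with restriction.  (For smooth real manifolds such brackets correspond to
  brackets on global functions; analytic manifolds may have too few of the latter.)  As a sheaf
  operation is determined by its effect on germs, a single map on total functions is enough to
  encode it.
\<close>

type_synonym ('a, 'k) bracket = "('a \<Rightarrow> 'k) \<Rightarrow> ('a \<Rightarrow> 'k) \<Rightarrow> 'a \<Rightarrow> 'k"

definition is_poisson ::
    "regularity \<Rightarrow> ('a::topological_space, 'k::ground_field, 'n::finite) chart set \<Rightarrow> ('a, 'k) bracket \<Rightarrow> bool"
  where
  "is_poisson \<rho> \<A> B \<longleftrightarrow>
     (\<forall>V. open V \<longrightarrow>
       (\<forall>f\<in>functions_on \<rho> \<A> V. \<forall>g\<in>functions_on \<rho> \<A> V.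
          B f g \<in> functions_on \<rho> \<A> V \<and>
          (\<forall>x\<in>V. B f g x = - B g f x) \<and>
          (\<forall>a. \<forall>x\<in>V. B (\<lambda>y. a * f y) g x = a * B f g x)) \<and>
       (\<forall>f\<in>functions_on \<rho> \<A> V. \<forall>f'\<in>functions_on \<rho> \<A> V. \<forall>g\<in>functions_on \<rho> \<A> V.
          (\<forall>x\<in>V. f x = f' x) \<longrightarrow> (\<forall>x\<in>V. B f g x = B f' g x)) \<and>
       (\<forall>f\<in>functions_on \<rho> \<A> V. \<forall>g\<in>functions_on \<rho> \<A> V. \<forall>h\<in>functions_on \<rho> \<A> V. \<forall>x\<in>V.
          B (\<lambda>y. f y + g y) h x = B f h x + B g h x \<and>
          B (\<lambda>y. f y * g y) h x = f x * B g h x + g x * B f h x \<and>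
          B f (B g h) x + B g (B h f) x + B h (B f g) x = 0))"

definition bihamiltonian ::
    "regularity \<Rightarrow> ('a::{t2_space,second_countable_topology}, 'k::ground_field, 'n::finite) chart set
      \<Rightarrow> ('a, 'k) bracket \<Rightarrow> ('a, 'k) bracket \<Rightarrow> bool"
  where
  "bihamiltonian \<rho> \<A> B\<^sub>1 B\<^sub>2 \<longleftrightarrow> is_manifold \<rho> \<A> \<and> is_poisson \<rho> \<A> B\<^sub>1 \<and> is_poisson \<rho> \<A> B\<^sub>2 \<and>
     (\<forall>l\<^sub>1 l\<^sub>2. is_poisson \<rho> \<A> (\<lambda>f g x. l\<^sub>1 * B\<^sub>1 f g x + l\<^sub>2 * B\<^sub>2 f g x))"

text \<open>
  The matrix \<open>({x\<^sub>i, x\<^sub>j}(m))\<close> of the pairing induced by the bracket on \<open>T\<^sub>m\<^sup>*M \<otimes> \<complex>\<close> (on \<open>T\<^sub>m\<^sup>*M\<close> in the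
  complex case), in the basis \<open>dx\<^sub>1, \<dots>, dx\<^sub>n\<close>.
\<close>

definition cotangent_pairing ::
    "('a, 'k::ground_field, 'n::finite) chart set \<Rightarrow> ('a, 'k) bracket \<Rightarrow> 'a \<Rightarrow> complex ^ 'n ^ 'n"
  where
  "cotangent_pairing \<A> B m =
     (let c = chart_at \<A> m
      in \<chi> i j. to_complex (B (\<lambda>p. snd c p $ i) (\<lambda>p. snd c p $ j) m))"

section \<open>Pairs of skew-symmetric pairings on a complex vector space\<close>

text \<open>
  A pairing on \<open>complex^'n\<close> is given by its Gram matrix.  Subspaces are complex subspaces,
  i.e. those of the interpretation \<open>vec\<close>.
\<close>

definition pairing :: "complex ^ 'n ^ 'n \<Rightarrow> complex ^ 'n::finite \<Rightarrow> complex ^ 'n \<Rightarrow> complex" where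
  "pairing A u v = (\<Sum>i\<in>UNIV. \<Sum>j\<in>UNIV. A $ i $ j * u $ i * v $ j)"

definition orthogonal_spaces ::
    "complex ^ 'n ^ 'n \<Rightarrow> complex ^ 'n ^ 'n \<Rightarrow> (complex ^ 'n::finite) set \<Rightarrow> (complex ^ 'n) set \<Rightarrow> bool"
  where
  "orthogonal_spaces A B X Y \<longleftrightarrow>
     (\<forall>u\<in>X. \<forall>v\<in>Y. pairing A u v = 0 \<and> pairing A v u = 0 \<and> pairing B u v = 0 \<and> pairing B v u = 0)"

text \<open>The whole space, with its two pairings, is the direct sum of the subspaces in the list.\<close>

definition is_direct_sum ::
    "complex ^ 'n ^ 'n \<Rightarrow> complex ^ 'n ^ 'n \<Rightarrow> (complex ^ 'n::finite) set list \<Rightarrow> bool" where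
  "is_direct_sum A B Ws \<longleftrightarrow>
     (\<forall>W\<in>set Ws. vec.subspace W) \<and>
     (\<forall>v. \<exists>!us. length us = length Ws \<and> (\<forall>j<length Ws. us ! j \<in> Ws ! j) \<and> v = sum_list us) \<and>
     (\<forall>i<length Ws. \<forall>j<length Ws. i \<noteq> j \<longrightarrow> orthogonal_spaces A B (Ws ! i) (Ws ! j))"

definition indecomposable ::
    "complex ^ 'n ^ 'n \<Rightarrow> complex ^ 'n ^ 'n \<Rightarrow> (complex ^ 'n::finite) set \<Rightarrow> bool" where
  "indecomposable A B W \<longleftrightarrow> vec.subspace W \<and> W \<noteq> {0} \<and>
     \<not> (\<exists>X Y. vec.subspace X \<and> vec.subspace Y \<and> X \<noteq> {0} \<and> Y \<noteq> {0} \<and> X \<inter> Y = {0} \<and>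
          W = {x + y |x y. x \<in> X \<and> y \<in> Y} \<and> orthogonal_spaces A B X Y)"

text \<open>The pairings of the basis vectors \<open>w\<^sub>0, \<dots>, w\<^sub>2\<^sub>k\<^sub>-\<^sub>2\<close> of the block of dimension \<open>2k-1\<close>.\<close>

definition kronecker_pairing1 :: "nat \<Rightarrow> nat \<Rightarrow> complex" where
  "kronecker_pairing1 i j =
     (if even i \<and> j = i + 1 then 1 else if even j \<and> i = j + 1 then - 1 else 0)"

definition kronecker_pairing2 :: "nat \<Rightarrow> nat \<Rightarrow> complex" where
  "kronecker_pairing2 i j =
     (if odd i \<and> j = i + 1 then 1 else if odd j \<and> i = j + 1 then - 1 else 0)"

definition kronecker_block ::
    "complex ^ 'n ^ 'n \<Rightarrow> complex ^ 'n ^ 'n \<Rightarrow> nat \<Rightarrow> (complex ^ 'n::finite) set \<Rightarrow> bool" where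
  "kronecker_block A B k W \<longleftrightarrow> k \<ge> 1 \<and>
     (\<exists>w :: nat \<Rightarrow> complex ^ 'n.
        inj_on w {..<2*k-1} \<and> vec.independent (w ` {..<2*k-1}) \<and> vec.span (w ` {..<2*k-1}) = W \<and>
        (\<forall>i<2*k-1. \<forall>j<2*k-1. pairing A (w i) (w j) = kronecker_pairing1 i j \<and>
                                 pairing B (w i) (w j) = kronecker_pairing2 i j))"

text \<open>
  The number of Kronecker blocks in a decomposition into indecomposable pairs, whose types are
  uniquely determined; the remaining indecomposable summands are the Jordan blocks.
\<close>

definition number_of_kronecker_blocks :: "complex ^ 'n ^ 'n::finite \<Rightarrow> complex ^ 'n ^ 'n \<Rightarrow> nat" where
  "number_of_kronecker_blocks A B =
     (THE s. \<exists>Ws. is_direct_sum A B Ws \<and> (\<forall>W\<in>set Ws. indecomposable A B W) \<and>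
                  s = length (filter (\<lambda>W. \<exists>k. kronecker_block A B k W) Ws))"

text \<open>The pair is isomorphic to the direct sum of the Kronecker blocks of dimensions \<open>2k\<^sub>i-1\<close>.\<close>

definition kronecker_type ::
    "complex ^ 'n ^ 'n::finite \<Rightarrow> complex ^ 'n ^ 'n \<Rightarrow> nat list \<Rightarrow> bool" where
  "kronecker_type A B ks \<longleftrightarrow>
     (\<exists>Ws. length Ws = length ks \<and> is_direct_sum A B Ws \<and>
           (\<forall>i<length ks. kronecker_block A B (ks ! i) (Ws ! i)))"

definition homogeneous_on ::
    "('a, 'k::ground_field, 'n::finite) chart set \<Rightarrow> ('a, 'k) bracket \<Rightarrow> ('a, 'k) bracket \<Rightarrow> 'a set \<Rightarrow> bool"
  where
  "homogeneous_on \<A> B\<^sub>1 B\<^sub>2 U \<longleftrightarrow>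
     (\<exists>ks. \<forall>m\<in>U. kronecker_type (cotangent_pairing \<A> B\<^sub>1 m) (cotangent_pairing \<A> B\<^sub>2 m) ks)"

definition pair_action_dim :: "complex ^ 'n ^ 'n::finite \<Rightarrow> complex ^ 'n ^ 'n \<Rightarrow> real" where
  "pair_action_dim A B = (real CARD('n) + real (number_of_kronecker_blocks A B)) / 2"

definition action_dim ::
    "('a::topological_space, 'k::ground_field, 'n::finite) chart set
      \<Rightarrow> ('a, 'k) bracket \<Rightarrow> ('a, 'k) bracket \<Rightarrow> 'a \<Rightarrow> ereal"
  where
  "action_dim \<A> B\<^sub>1 B\<^sub>2 m\<^sub>0 =
     Liminf (at m\<^sub>0)
       (\<lambda>m. ereal (pair_action_dim (cotangent_pairing \<A> B\<^sub>1 m) (cotangent_pairing \<A> B\<^sub>2 m)))"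

section \<open>Functional independence and the anchored Lenard scheme\<close>

definition generically_on :: "'a::topological_space set \<Rightarrow> ('a \<Rightarrow> bool) \<Rightarrow> bool" where
  "generically_on V P \<longleftrightarrow> (\<exists>G. open G \<and> G \<subseteq> V \<and> V \<subseteq> closure G \<and> (\<forall>m\<in>G. P m))"

definition independent_on ::
    "('a::topological_space, 'k::ground_field, 'n::finite) chart set \<Rightarrow> 'a set \<Rightarrow> 'i set \<Rightarrow> ('i \<Rightarrow> 'a \<Rightarrow> 'k) \<Rightarrow> bool"
  where
  "independent_on \<A> V I F \<longleftrightarrow>
     generically_on V (\<lambda>m. inj_on (\<lambda>i. differential \<A> (F i) m) I \<and>
                           vec.independent ((\<lambda>i. differential \<A> (F i) m) ` I))"

definition depends_on ::
    "('a::topological_space, 'k::ground_field, 'n::finite) chart set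
      \<Rightarrow> 'a set \<Rightarrow> ('a \<Rightarrow> 'k) \<Rightarrow> 'i set \<Rightarrow> ('i \<Rightarrow> 'a \<Rightarrow> 'k) \<Rightarrow> bool"
  where
  "depends_on \<A> V f I F \<longleftrightarrow>
     generically_on V (\<lambda>m. differential \<A> f m \<in> vec.span ((\<lambda>i. differential \<A> (F i) m) ` I))"

text \<open>
  In the next two definitions ``all functions'' means functions on arbitrary open subsets of \<open>V\<close>,
  as there need not be enough analytic functions on the whole of \<open>V\<close>.
\<close>

definition casimir_on ::
    "regularity \<Rightarrow> ('a::topological_space, 'k::ground_field, 'n::finite) chart set
      \<Rightarrow> ('a, 'k) bracket \<Rightarrow> 'a set \<Rightarrow> ('a \<Rightarrow> 'k) \<Rightarrow> bool"
  where
  "casimir_on \<rho> \<A> B V F \<longleftrightarrow> F \<in> functions_on \<rho> \<A> V \<and>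
     (\<forall>W. open W \<longrightarrow> W \<subseteq> V \<longrightarrow> (\<forall>f\<in>functions_on \<rho> \<A> W. \<forall>x\<in>W. B F f x = 0))"

definition recurrence_on ::
    "regularity \<Rightarrow> ('a::topological_space, 'k::ground_field, 'n::finite) chart set
      \<Rightarrow> ('a, 'k) bracket \<Rightarrow> ('a, 'k) bracket \<Rightarrow> 'a set \<Rightarrow> ('a \<Rightarrow> 'k) \<Rightarrow> ('a \<Rightarrow> 'k) \<Rightarrow> bool"
  where
  "recurrence_on \<rho> \<A> B\<^sub>1 B\<^sub>2 V F F' \<longleftrightarrow>
     (\<forall>W. open W \<longrightarrow> W \<subseteq> V \<longrightarrow> (\<forall>f\<in>functions_on \<rho> \<A> W. \<forall>x\<in>W. B\<^sub>2 F f x = - B\<^sub>1 F' f x))"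

text \<open>Superscripts \<open>t = 1, \<dots>, r\<close> are shifted to \<open>t < r\<close>.\<close>

definition maximal_casimirs ::
    "regularity \<Rightarrow> ('a::topological_space, 'k::ground_field, 'n::finite) chart set
      \<Rightarrow> ('a, 'k) bracket \<Rightarrow> 'a set \<Rightarrow> nat \<Rightarrow> (nat \<Rightarrow> 'a \<Rightarrow> 'k) \<Rightarrow> bool"
  where
  "maximal_casimirs \<rho> \<A> B V r C \<longleftrightarrow>
     (\<forall>t<r. casimir_on \<rho> \<A> B V (C t)) \<and> independent_on \<A> V {..<r} C \<and>
     \<not> (\<exists>F. casimir_on \<rho> \<A> B V F \<and> independent_on \<A> V {..<Suc r} (C(r := F)))"

definition lenard_indices :: "nat \<Rightarrow> (nat \<Rightarrow> nat) \<Rightarrow> (nat \<times> nat) set" where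
  "lenard_indices r k = {(t, i). t < r \<and> i \<le> k t}"

text \<open>
  The functions \<open>H t i\<close> are the ones which the scheme has produced for \<open>i \<le> l t\<close>; the scheme has
  been carried at least up to the first functions (\<open>i = k t + 1\<close>) which depend on the old ones.
  Values \<open>H t i\<close> for \<open>i > l t\<close> are irrelevant.
\<close>

definition anchored_lenard_scheme ::
    "regularity \<Rightarrow> ('a::topological_space, 'k::ground_field, 'n::finite) chart set
      \<Rightarrow> ('a, 'k) bracket \<Rightarrow> ('a, 'k) bracket \<Rightarrow> 'a set
      \<Rightarrow> nat \<Rightarrow> (nat \<Rightarrow> nat) \<Rightarrow> (nat \<Rightarrow> nat) \<Rightarrow> (nat \<Rightarrow> nat \<Rightarrow> 'a \<Rightarrow> 'k) \<Rightarrow> bool"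
  where
  "anchored_lenard_scheme \<rho> \<A> B\<^sub>1 B\<^sub>2 V r k l H \<longleftrightarrow>
     maximal_casimirs \<rho> \<A> B\<^sub>1 V r (\<lambda>t. H t 0) \<and>
     (\<forall>t<r. k t < l t \<and>
        (\<forall>i\<le>l t. H t i \<in> functions_on \<rho> \<A> V) \<and>
        (\<forall>i<l t. recurrence_on \<rho> \<A> B\<^sub>1 B\<^sub>2 V (H t i) (H t (Suc i)))) \<and>
     independent_on \<A> V (lenard_indices r k) (\<lambda>(t, i). H t i) \<and>
     (\<forall>t<r. \<forall>i. k t < i \<and> i \<le> l t \<longrightarrow>
        depends_on \<A> V (H t i) (lenard_indices r k) (\<lambda>(t, i). H t i))"

definition lenard_integrability_data ::
    "regularity \<Rightarrow> ('a::topological_space, 'k::ground_field, 'n::finite) chart set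
      \<Rightarrow> ('a, 'k) bracket \<Rightarrow> ('a, 'k) bracket \<Rightarrow> 'a \<Rightarrow> 'a set
      \<Rightarrow> nat \<Rightarrow> (nat \<Rightarrow> nat) \<Rightarrow> (nat \<Rightarrow> nat) \<Rightarrow> (nat \<Rightarrow> nat \<Rightarrow> 'a \<Rightarrow> 'k) \<Rightarrow> bool"
  where
  "lenard_integrability_data \<rho> \<A> B\<^sub>1 B\<^sub>2 m\<^sub>0 V r k l H \<longleftrightarrow>
     open V \<and> m\<^sub>0 \<in> V \<and> anchored_lenard_scheme \<rho> \<A> B\<^sub>1 B\<^sub>2 V r k l H \<and>
     ereal (real (\<Sum>t<r. k t + 1)) = action_dim \<A> B\<^sub>1 B\<^sub>2 m\<^sub>0"

definition lenard_integrable_at ::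
    "regularity \<Rightarrow> ('a::topological_space, 'k::ground_field, 'n::finite) chart set
      \<Rightarrow> ('a, 'k) bracket \<Rightarrow> ('a, 'k) bracket \<Rightarrow> 'a \<Rightarrow> bool"
  where
  "lenard_integrable_at \<rho> \<A> B\<^sub>1 B\<^sub>2 m\<^sub>0 \<longleftrightarrow>
     (\<exists>V r k l H. lenard_integrability_data \<rho> \<A> B\<^sub>1 B\<^sub>2 m\<^sub>0 V r k l H)"

text \<open>Here \<open>H'\<close> is an infinite continuation of the sequences produced by the scheme.\<close>

definition strictly_lenard_integrable_at ::
    "regularity \<Rightarrow> ('a::topological_space, 'k::ground_field, 'n::finite) chart set
      \<Rightarrow> ('a, 'k) bracket \<Rightarrow> ('a, 'k) bracket \<Rightarrow> 'a \<Rightarrow> bool"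
  where
  "strictly_lenard_integrable_at \<rho> \<A> B\<^sub>1 B\<^sub>2 m\<^sub>0 \<longleftrightarrow>
     (\<exists>V r k l H H'. lenard_integrability_data \<rho> \<A> B\<^sub>1 B\<^sub>2 m\<^sub>0 V r k l H \<and>
        (\<forall>t<r. (\<forall>i\<le>l t. H' t i = H t i) \<and>
               (\<forall>i. H' t i \<in> functions_on \<rho> \<A> V \<and>
                    recurrence_on \<rho> \<A> B\<^sub>1 B\<^sub>2 V (H' t i) (H' t (Suc i)))))"

end

theory Submission
  imports Defs
begin

text \<open>
  Everything happens at a single point.  There the differentials of \<open>H\<^sub>0, H\<^sub>1, \<dots>\<close> are the coefficients
  of a formal solution \<open>h(\<lambda>)\<close> of \<open>(A + \<lambda> B) h(\<lambda>) = 0\<close>, where \<open>A\<close> and \<open>B\<close> are the two pairings.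
  An indecomposable pair with a nonzero formal solution has a nonzero polynomial solution; one of
  minimal degree spans, together with a dual chain, a Kronecker block which splits off.  So a formal
  solution lives in the Kronecker blocks, and its coefficients lie in a subspace of
  dimension \<open>\<Sum>k\<^sub>i\<close>, which is at most the action dimension \<open>(dim V + s) / 2\<close> with equality only if there
  are no Jordan blocks.  Near \<open>m\<^sub>0\<close> the number of independent differentials equals the
  action dimension at the points of an open set \<open>D\<close> with \<open>m\<^sub>0\<close> in its closure, so the pairs at these
  points are of Kronecker type.  The type is determined by the dimensions of the spaces of
  polynomial solutions of bounded degree.  These are upper semicontinuous, hence constant on an open
  subset of \<open>D\<close> which still has \<open>m\<^sub>0\<close> in its closure.
\<close>

text \<open>Strictness supplies coefficients of all orders: a finite piece of a Lenard sequence need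
  not be a formal solution. The splitting of a Kronecker block needs vectors dual to the minimal
  solution, and the obstruction to their existence would be a solution of smaller degree. Jordan
  blocks enter only as indecomposable summands whose only solution is zero, so no normal form for
  them is involved.

  Two obstacles come from the definitions. The number of Kronecker blocks is a definite description,
  so it has to be shown independent of the decomposition; it is recovered from the dimension of the
  space of solutions of degree below \<open>CARD('n)\<close>. The pairings on a cotangent space are
  written in a chart chosen separately at each point and may jump with it; semicontinuity is
  therefore proved in a fixed chart and transferred through the invariance of dimensions under
  congruence.

  A bracket is given as an operation on functions, not as a tensor. That it acts at a point through
  differentials rests on Hadamard's lemma inside the regularity class: an integral formula in the
  smooth case, division of power series in the analytic case.\<close>

section \<open>Finite linear systems\<close>

text \<open>Gaussian elimination, one unknown at a time: an equation with a nonzero coefficient of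
  \<open>k0\<close> removes \<open>k0\<close> from the others, and a relation between the reduced
  rows lifts to one between the original rows. Arbitrary finite index sets are allowed because the
  dual chain below is described by two kinds of equations, indexed by a sum type.\<close>

lemma fredholm_alternative:
  fixes a :: "'e \<Rightarrow> 'k \<Rightarrow> 'f::field"
  assumes "finite K" "finite E"
    and "\<And>y. (\<forall>k\<in>K. (\<Sum>e\<in>E. y e * a e k) = 0) \<Longrightarrow> (\<Sum>e\<in>E. y e * r e) = 0"
  shows "\<exists>x. \<forall>e\<in>E. (\<Sum>k\<in>K. a e k * x k) = r e"
  using assms
proof (induction K arbitrary: E a r rule: finite_induct)
  case empty
  have "r e = 0" if "e \<in> E" for e
    using empty(2)[of "\<lambda>e'. if e' = e then 1 else 0"] that empty(1)
    by (simp add: if_distrib[of "\<lambda>x. x * _"] sum.delta cong: if_cong)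
  then show ?case by simp
next
  case (insert k0 K)
  show ?case
  proof (cases "\<forall>e\<in>E. a e k0 = 0")
    case True
    have "\<exists>x. \<forall>e\<in>E. (\<Sum>k\<in>K. a e k * x k) = r e"
    proof (rule insert.IH[OF insert.prems(1)])
      fix y assume "\<forall>k\<in>K. (\<Sum>e\<in>E. y e * a e k) = 0"
      then show "(\<Sum>e\<in>E. y e * r e) = 0"
        by (intro insert.prems(2)) (simp add: True)
    qed
    then show ?thesis using True insert.hyps by auto
  next
    case False
    then obtain e0 where e0: "e0 \<in> E" "a e0 k0 \<noteq> 0" by blast
    define E' where "E' = E - {e0}"
    have E: "finite E'" "E = insert e0 E'" "e0 \<notin> E'" using e0 insert.prems(1) by (auto simp: E'_def)
    define a' where "a' e k = a e k - a e k0 / a e0 k0 * a e0 k" for e k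
    define r' where "r' e = r e - a e k0 / a e0 k0 * r e0" for e
    have "\<exists>x. \<forall>e\<in>E'. (\<Sum>k\<in>K. a' e k * x k) = r' e"
    proof (rule insert.IH[OF E(1)])
      fix y assume y: "\<forall>k\<in>K. (\<Sum>e\<in>E'. y e * a' e k) = 0"
      \<comment> \<open>The weight of \<open>e0\<close> is the one for which column
        \<open>k0\<close> of the lifted relation cancels.\<close>
      define y' where "y' = y(e0 := - (\<Sum>e\<in>E'. y e * a e k0) / a e0 k0)"
      have y'E: "(\<Sum>e\<in>E. y' e * z e) = (\<Sum>e\<in>E'. y e * (z e - a e k0 / a e0 k0 * z e0))" for z
      proof -
        have "(\<Sum>e\<in>E'. y' e * z e) = (\<Sum>e\<in>E'. y e * z e)"
          using E(3) by (intro sum.cong) (auto simp: y'_def)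
        then have "(\<Sum>e\<in>E. y' e * z e) = - (\<Sum>e\<in>E'. y e * a e k0) / a e0 k0 * z e0 + (\<Sum>e\<in>E'. y e * z e)"
          using E by (simp add: y'_def)
        also have "\<dots> = (\<Sum>e\<in>E'. y e * (z e - a e k0 / a e0 k0 * z e0))"
          by (simp add: algebra_simps sum_subtractf sum_distrib_left sum_divide_distrib)
        finally show ?thesis .
      qed
      have "(\<Sum>e\<in>E. y' e * r e) = 0"
      proof (rule insert.prems(2), intro ballI)
        fix k assume "k \<in> insert k0 K"
        then show "(\<Sum>e\<in>E. y' e * a e k) = 0"
          using y e0(2) unfolding y'E a'_def by auto
      qed
      then show "(\<Sum>e\<in>E'. y e * r' e) = 0" unfolding y'E r'_def .
    qed
    then obtain x where x: "\<And>e. e \<in> E' \<Longrightarrow> (\<Sum>k\<in>K. a' e k * x k) = r' e" by blast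
    define S where "S e = (\<Sum>k\<in>K. a e k * x k)" for e
    define x' where "x' = x(k0 := (r e0 - S e0) / a e0 k0)"
    have sum_x': "(\<Sum>k\<in>insert k0 K. a e k * x' k) = a e k0 * ((r e0 - S e0) / a e0 k0) + S e" for e
    proof -
      have "(\<Sum>k\<in>K. a e k * x' k) = S e"
        unfolding S_def using insert.hyps(2) by (intro sum.cong) (auto simp: x'_def)
      then show ?thesis using insert.hyps by (simp add: x'_def)
    qed
    have "S e - a e k0 / a e0 k0 * S e0 = r' e" if "e \<in> E'" for e
      using x[OF that] unfolding a'_def S_def by (simp add: algebra_simps sum_subtractf sum_distrib_left)
    then have "(\<Sum>k\<in>insert k0 K. a e k * x' k) = r e" if "e \<in> E'" for e
      unfolding sum_x' using that e0(2) by (simp add: r'_def field_simps)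
    moreover have "(\<Sum>k\<in>insert k0 K. a e0 k * x' k) = r e0"
      unfolding sum_x' using e0(2) by simp
    ultimately show ?thesis unfolding E(2) by auto
  qed
qed

text \<open>\<open>vec.independent\<close> speaks of sets, so independence of a family is set
  independence together with injectivity. This form tests both by coefficients.\<close>

lemma independent_family_iff:
  fixes w :: "'i \<Rightarrow> 'f::field^'m::finite"
  assumes "finite I"
  shows "inj_on w I \<and> vec.independent (w ` I) \<longleftrightarrow>
         (\<forall>c. (\<Sum>i\<in>I. c i *s w i) = 0 \<longrightarrow> (\<forall>i\<in>I. c i = 0))"
proof (intro iffI allI impI conjI)
  fix c assume w: "inj_on w I \<and> vec.independent (w ` I)" and c: "(\<Sum>i\<in>I. c i *s w i) = 0"
  define u where "u = c \<circ> inv_into I w"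
  have u: "u (w i) = c i" if "i \<in> I" for i using w that by (simp add: u_def)
  have "(\<Sum>v\<in>w ` I. u v *s v) = (\<Sum>i\<in>I. c i *s w i)"
    using w u by (subst sum.reindex) (auto intro!: sum.cong)
  then have "u v = 0" if "v \<in> w ` I" for v
    using vec.independentD[of "w ` I" "w ` I" u v] w assms c that by auto
  then show "\<forall>i\<in>I. c i = 0" using u by auto
next
  assume H: "\<forall>c. (\<Sum>i\<in>I. c i *s w i) = 0 \<longrightarrow> (\<forall>i\<in>I. c i = 0)"
  show inj: "inj_on w I"
  proof (rule inj_onI, rule ccontr)
    fix i j assume ij: "i \<in> I" "j \<in> I" "w i = w j" "i \<noteq> j"
    define c :: "'i \<Rightarrow> 'f" where "c k = (if k = i then 1 else if k = j then -1 else 0)" for k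
    have "(\<Sum>k\<in>I. c k *s w k) = (\<Sum>k\<in>{i,j}. c k *s w k)"
      using ij assms by (intro sum.mono_neutral_right) (auto simp: c_def)
    also have "\<dots> = 0" using ij by (simp add: c_def)
    finally have "c i = 0" using H ij by blast
    then show False by (simp add: c_def)
  qed
  show "vec.independent (w ` I)"
  proof (rule vec.independent_if_scalars_zero)
    show "finite (w ` I)" using assms by simp
    fix f v assume f: "(\<Sum>x\<in>w ` I. f x *s x) = 0" and v: "v \<in> w ` I"
    have "(\<Sum>i\<in>I. f (w i) *s w i) = 0" using f inj by (simp add: sum.reindex)
    then have "\<forall>i\<in>I. f (w i) = 0" using H[rule_format, of "\<lambda>i. f (w i)"] by blast
    then show "f v = 0" using v by blast
  qed
qed

lemma vec_dim_le_card: "vec.dim (S :: ('f::field^'m::finite) set) \<le> CARD('m)"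
  using vec.dim_subset_UNIV[of S] by (simp add: vec.dimension_def card_cart_basis)

lemma too_many_dependent:
  fixes h :: "nat \<Rightarrow> 'f::field^'m::finite"
  shows "\<exists>c. (\<Sum>i\<le>CARD('m). c i *s h i) = 0 \<and> (\<exists>i\<le>CARD('m). c i \<noteq> 0)"
proof (rule ccontr)
  assume "\<not> ?thesis"
  then have ind: "inj_on h {..CARD('m)} \<and> vec.independent (h ` {..CARD('m)})"
    by (subst independent_family_iff) auto
  then have "card (h ` {..CARD('m)}) = Suc CARD('m)" by (simp add: card_image)
  moreover have "card (h ` {..CARD('m)}) \<le> vec.dim (UNIV :: ('f^'m) set)"
    using ind by (intro vec.independent_card_le_dim) auto
  ultimately show False using vec_dim_le_card[of "UNIV :: ('f^'m) set"] by linarith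
qed

lemma span_family:
  fixes w :: "'i \<Rightarrow> 'f::field^'m::finite"
  assumes "finite I"
  shows "vec.span (w ` I) = range (\<lambda>c. \<Sum>i\<in>I. c i *s w i)"
proof
  show "range (\<lambda>c. \<Sum>i\<in>I. c i *s w i) \<subseteq> vec.span (w ` I)"
    by (intro image_subsetI vec.span_sum vec.span_scale vec.span_base) blast
  have "vec.subspace (range (\<lambda>c. \<Sum>i\<in>I. c i *s w i))"
    unfolding vec.subspace_def
  proof (safe)
    show "0 \<in> range (\<lambda>c. \<Sum>i\<in>I. c i *s w i)"
      by (rule range_eqI[of _ _ "\<lambda>_. 0"]) simp
  next
    fix c d :: "'i \<Rightarrow> 'f"
    show "(\<Sum>i\<in>I. c i *s w i) + (\<Sum>i\<in>I. d i *s w i) \<in> range (\<lambda>c. \<Sum>i\<in>I. c i *s w i)"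
      by (rule range_eqI[of _ _ "\<lambda>i. c i + d i"]) (simp add: vec.scale_left_distrib sum.distrib)
  next
    fix x and c :: "'i \<Rightarrow> 'f"
    show "x *s (\<Sum>i\<in>I. c i *s w i) \<in> range (\<lambda>c. \<Sum>i\<in>I. c i *s w i)"
      by (rule range_eqI[of _ _ "\<lambda>i. x * c i"]) (simp add: vec.scale_sum_right)
  qed
  moreover have "w ` I \<subseteq> range (\<lambda>c. \<Sum>i\<in>I. c i *s w i)"
  proof
    fix v assume "v \<in> w ` I"
    then obtain i where i: "i \<in> I" "v = w i" by blast
    have "(\<Sum>j\<in>I. (if j = i then 1 else 0) *s w j) = (\<Sum>j\<in>{i}. (if j = i then 1 else 0) *s w j)"
      using i assms by (intro sum.mono_neutral_right) auto
    then show "v \<in> range (\<lambda>c. \<Sum>i\<in>I. c i *s w i)"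
      using i by (intro range_eqI[of _ _ "\<lambda>j. if j = i then 1 else 0"]) simp
  qed
  ultimately show "vec.span (w ` I) \<subseteq> range (\<lambda>c. \<Sum>i\<in>I. c i *s w i)"
    by (rule vec.span_minimal[rotated])
qed

section \<open>Skew-symmetric pencils\<close>

lemma pairing_add_left: "pairing A (u + u') v = pairing A u v + pairing A u' v"
  by (simp add: pairing_def algebra_simps sum.distrib)

lemma pairing_add_right: "pairing A u (v + v') = pairing A u v + pairing A u v'"
  by (simp add: pairing_def algebra_simps sum.distrib)

lemma pairing_scale_left: "pairing A (c *s u) v = c * pairing A u v"
  by (simp add: pairing_def algebra_simps sum_distrib_left)

lemma pairing_scale_right: "pairing A u (c *s v) = c * pairing A u v"
  by (simp add: pairing_def algebra_simps sum_distrib_left)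

lemma pairing_zero_left [simp]: "pairing A 0 v = 0"
  by (simp add: pairing_def)

lemma pairing_zero_right [simp]: "pairing A u 0 = 0"
  by (simp add: pairing_def)

lemma pairing_diff_left: "pairing A (u - u') v = pairing A u v - pairing A u' v"
  by (simp add: pairing_def algebra_simps sum_subtractf)

lemma pairing_diff_right: "pairing A u (v - v') = pairing A u v - pairing A u v'"
  by (simp add: pairing_def algebra_simps sum_subtractf)

lemma pairing_sum_left: "pairing A (\<Sum>i\<in>I. f i) v = (\<Sum>i\<in>I. pairing A (f i) v)"
  by (induction I rule: infinite_finite_induct) (simp_all add: pairing_add_left)

lemma pairing_sum_right: "pairing A u (\<Sum>i\<in>I. f i) = (\<Sum>i\<in>I. pairing A u (f i))"
  by (induction I rule: infinite_finite_induct) (simp_all add: pairing_add_right)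

lemmas pairing_linear = pairing_add_left pairing_add_right pairing_scale_left pairing_scale_right
  pairing_diff_left pairing_diff_right pairing_sum_left pairing_sum_right

text \<open>Coefficient sequences of the solutions \<open>u(\<lambda>) = \<Sum>u\<^sub>i \<lambda>\<^sup>i\<close> of \<open>(A + \<lambda> B) u(\<lambda>) = 0\<close> on \<open>W\<close>.\<close>
definition chain :: "complex^'n^'n \<Rightarrow> complex^'n^'n \<Rightarrow> (complex^'n::finite) set \<Rightarrow> (nat \<Rightarrow> complex^'n) \<Rightarrow> bool"
  where "chain A B W u \<longleftrightarrow> (\<forall>i. u i \<in> W) \<and> (\<forall>v\<in>W. pairing A (u 0) v = 0) \<and>
           (\<forall>i. \<forall>v\<in>W. pairing A (u (Suc i)) v + pairing B (u i) v = 0)"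

locale skew_pencil =
  fixes A B :: "complex^'n::finite^'n"
  assumes skewA: "pairing A u v = - pairing A v u" and skewB: "pairing B u v = - pairing B v u"
begin

lemma skew_self [simp]: "pairing A u u = 0" "pairing B u u = 0"
  using skewA[of u u] skewB[of u u] by simp_all

lemma orthogonal_spacesI:
  assumes "\<And>u v. u \<in> X \<Longrightarrow> v \<in> Y \<Longrightarrow> pairing A u v = 0" "\<And>u v. u \<in> X \<Longrightarrow> v \<in> Y \<Longrightarrow> pairing B u v = 0"
  shows "orthogonal_spaces A B X Y"
  unfolding orthogonal_spaces_def
  by (metis assms skewA skewB neg_0_equal_iff_equal)

text \<open>The recurrence and the skewness of both pairings give
  \<open>pairing A (u (Suc i)) (u j) = pairing A (u i) (u (Suc j))\<close>. Moving index from left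
  to right ends at \<open>u 0\<close>, which lies in the kernel of \<open>A\<close> on
  \<open>W\<close>.\<close>

lemma chain_isotropic:
  assumes "chain A B W u"
  shows "pairing A (u i) (u j) = 0" "pairing B (u i) (u j) = 0"
proof -
  have W: "u i \<in> W" for i using assms by (simp add: chain_def)
  have rec: "pairing A (u (Suc i)) (u j) = - pairing B (u i) (u j)" for i j
    using assms W by (simp add: chain_def eq_neg_iff_add_eq_0)
  have A: "pairing A (u i) (u j) = 0" for i j
  proof (induction i arbitrary: j)
    case 0
    then show ?case using assms W by (simp add: chain_def)
  next
    case (Suc i)
    have "pairing A (u (Suc i)) (u j) = pairing B (u j) (u i)"
      using rec[of i j] skewB[of "u j" "u i"] by simp
    also have "\<dots> = - pairing A (u (Suc j)) (u i)" using rec[of j i] by simp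
    also have "\<dots> = pairing A (u i) (u (Suc j))" using skewA[of "u i" "u (Suc j)"] by simp
    finally show ?case using Suc by simp
  qed
  show "pairing A (u i) (u j) = 0" by (rule A)
  show "pairing B (u i) (u j) = 0" using rec[of i j] A by simp
qed

lemma chain_tail:
  assumes "chain A B W u" "u 0 = 0"
  shows "chain A B W (\<lambda>i. u (Suc i))"
  using assms unfolding chain_def by (metis add.right_neutral pairing_zero_left)

text \<open>Only the equation joining the last kept term to the first dropped one is affected, and
  there \<open>x n = 0\<close> already forces \<open>pairing B (x (n - 1))\<close> to vanish on
  \<open>W\<close>.\<close>

lemma chain_truncate:
  assumes "chain A B W x" "x n = 0" "0 \<in> W"
  shows "chain A B W (\<lambda>i. if i < n then x i else 0)"
proof -
  have "pairing A (if Suc i < n then x (Suc i) else 0) v + pairing B (if i < n then x i else 0) v = 0"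
    if "v \<in> W" for i v
  proof (cases "Suc i = n")
    case True
    have "pairing A (x (Suc i)) v + pairing B (x i) v = 0"
      using assms that unfolding chain_def by blast
    moreover have "x (Suc i) = 0" using assms True by simp
    ultimately show ?thesis using True by simp
  qed (use assms that in \<open>auto simp: chain_def\<close>)
  then show ?thesis using assms unfolding chain_def by auto
qed

text \<open>Right shifts of the sequence solve the same equation, and some combination of the first
  \<open>n + 1\<close> of them has vanishing \<open>n\<close>-th term.\<close>
lemma infinite_chain_imp_finite_chain_aux:
  assumes W: "vec.subspace W" and h: "chain A B W h" and nz: "h 0 \<noteq> 0"
  shows "\<exists>u. chain A B W u \<and> (\<exists>i. u i \<noteq> 0) \<and> (\<forall>i\<ge>CARD('n). u i = 0)"
proof -
  let ?n = "CARD('n)"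
  obtain c' where c': "(\<Sum>i\<le>?n. c' i *s h i) = 0" "\<exists>i\<le>?n. c' i \<noteq> 0"
    using too_many_dependent[of h] by blast
  \<comment> \<open>The relation is read backwards, so that it becomes the vanishing
    \<open>CARD('n)\<close>-th term of the convolution \<open>x\<close>.\<close>
  define c where "c i = c' (?n - i)" for i
  define x where "x i = (\<Sum>q\<le>i. c q *s h (i - q))" for i
  have "x ?n = (\<Sum>i\<le>?n. c' i *s h i)"
    unfolding x_def c_def by (rule sum.reindex_bij_witness[of _ "\<lambda>i. ?n - i" "\<lambda>i. ?n - i"]) auto
  then have xn: "x ?n = 0" using c' by simp
  have x: "chain A B W x"
    unfolding chain_def
  proof (intro conjI allI ballI)
    fix i show "x i \<in> W" unfolding x_def using h
      by (auto simp: chain_def intro!: vec.subspace_sum[OF W] vec.subspace_scale[OF W])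
  next
    fix v assume "v \<in> W"
    then show "pairing A (x 0) v = 0" using h by (simp add: x_def chain_def pairing_linear)
  next
    fix i v assume v: "v \<in> W"
    have h0: "pairing A (h 0) v = 0" using h v by (simp add: chain_def)
    have "pairing A (x (Suc i)) v = (\<Sum>q\<le>i. c q * pairing A (h (Suc (i - q))) v)"
      unfolding x_def by (simp add: pairing_linear h0 Suc_diff_le)
    moreover have "pairing B (x i) v = (\<Sum>q\<le>i. c q * pairing B (h (i - q)) v)"
      unfolding x_def by (simp add: pairing_linear)
    ultimately have "pairing A (x (Suc i)) v + pairing B (x i) v =
        (\<Sum>q\<le>i. c q * (pairing A (h (Suc (i - q))) v + pairing B (h (i - q)) v))"
      by (simp add: sum.distrib algebra_simps)
    also have "\<dots> = 0" using h v by (intro sum.neutral) (simp add: chain_def)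
    finally show "pairing A (x (Suc i)) v + pairing B (x i) v = 0" .
  qed
  obtain q where "q \<le> ?n" "c' q \<noteq> 0" using c' by blast
  then have ex: "c (?n - q) \<noteq> 0" "?n - q \<le> ?n" by (auto simp: c_def)
  \<comment> \<open>At the lowest shift with a nonzero coefficient only \<open>h 0\<close>
    contributes to \<open>x\<close>. Hence \<open>x q0\<close> is nonzero and survives the
    truncation at \<open>CARD('n)\<close>.\<close>
  define q0 where "q0 = (LEAST q. c q \<noteq> 0)"
  have q0: "c q0 \<noteq> 0" unfolding q0_def by (rule LeastI[of "\<lambda>q. c q \<noteq> 0"]) (fact ex)
  have q0': "c q = 0" if "q < q0" for q using not_less_Least[of q "\<lambda>q. c q \<noteq> 0"] that by (auto simp: q0_def)
  have q0n: "q0 \<le> ?n" unfolding q0_def by (rule order_trans[OF Least_le]) (use ex in auto)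
  have "x q0 = (\<Sum>q\<in>{q0}. c q *s h (q0 - q))"
    unfolding x_def by (rule sum.mono_neutral_right) (auto simp: q0')
  then have xq0: "x q0 \<noteq> 0" using q0 nz by simp
  then have "q0 < ?n" using q0n xn by (metis le_neq_implies_less)
  then show ?thesis using xq0
    by (intro exI[of _ "\<lambda>i. if i < ?n then x i else 0"]) (auto intro!: chain_truncate x xn vec.subspace_0 W)
qed

lemma infinite_chain_imp_finite_chain:
  assumes W: "vec.subspace W" and h: "chain A B W h" and nz: "h i0 \<noteq> 0"
  shows "\<exists>u. chain A B W u \<and> (\<exists>i. u i \<noteq> 0) \<and> (\<forall>i\<ge>CARD('n). u i = 0)"
  using h nz
proof (induction i0 arbitrary: h)
  case (Suc i0)
  show ?case
  proof (cases "h 0 = 0")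
    case True
    from Suc.IH[OF chain_tail[OF Suc.prems(1) True]] Suc.prems(2) show ?thesis by simp
  next
    case False
    then show ?thesis using infinite_chain_imp_finite_chain_aux[OF W Suc.prems(1)] by blast
  qed
next
  case 0
  then show ?case using infinite_chain_imp_finite_chain_aux[OF W] by blast
qed

end

text \<open>Here \<open>p\<close> is the exact degree of \<open>u\<close>. Minimality is stated as
  the vanishing of every chain of degree below \<open>p\<close>, because it is applied to auxiliary
  chains that are to be shown zero.\<close>

locale minimal_chain = skew_pencil +
  fixes W :: "(complex^'n::finite) set" and p :: nat and u :: "nat \<Rightarrow> complex^'n"
  assumes subspace_W: "vec.subspace W"
    and chain_u: "chain A B W u" and u_support: "p < i \<Longrightarrow> u i = 0"
    and u_p: "u p \<noteq> 0"
    and minimal: "chain A B W x \<Longrightarrow> (\<And>i. p \<le> i \<Longrightarrow> x i = 0) \<Longrightarrow> x i = 0"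

lemma (in skew_pencil) minimal_chain_exists:
  assumes W: "vec.subspace W" and u: "chain A B W u" and nz: "u i0 \<noteq> 0" and supp: "\<And>i. N \<le> i \<Longrightarrow> u i = 0"
  shows "\<exists>p u. minimal_chain A B W p u \<and> p < N"
proof -
  define P where "P k \<longleftrightarrow> (\<exists>u. chain A B W u \<and> (\<exists>i. u i \<noteq> 0) \<and> (\<forall>i\<ge>k. u i = 0))" for k
  define k where "k = (LEAST k. P k)"
  have PN: "P N" unfolding P_def using u nz supp by blast
  then have "P k" unfolding k_def by (rule LeastI)
  then obtain u' where u': "chain A B W u'" "\<exists>i. u' i \<noteq> 0" "\<forall>i\<ge>k. u' i = 0" unfolding P_def by blast
  have kN: "k \<le> N" unfolding k_def using PN by (rule Least_le)
  have "k \<noteq> 0" using u' by auto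
  then obtain p where p: "k = Suc p" using not0_implies_Suc by blast
  have nP: "\<not> P p" using not_less_Least[of p P] p by (simp add: k_def)
  have "u' p \<noteq> 0"
  proof
    assume "u' p = 0"
    then have "\<forall>i\<ge>p. u' i = 0" using u'(3) p by (metis le_neq_implies_less Suc_leI)
    then show False using nP u' unfolding P_def by blast
  qed
  then have "minimal_chain A B W p u'"
    by unfold_locales (use W u' p nP in \<open>auto simp: P_def\<close>)
  then show ?thesis using p kN by auto
qed

section \<open>Chains of minimal degree and their dual vectors\<close>

context minimal_chain
begin

lemma u_W: "u i \<in> W"
  using chain_u by (simp add: chain_def)

lemma A_u_0: "v \<in> W \<Longrightarrow> pairing A (u 0) v = 0"
  using chain_u by (simp add: chain_def)

lemma B_u: "v \<in> W \<Longrightarrow> pairing B (u i) v = - pairing A (u (Suc i)) v"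
  using chain_u by (simp add: chain_def eq_neg_iff_add_eq_0 add.commute)

lemma B_u_p: "v \<in> W \<Longrightarrow> pairing B (u p) v = 0"
  by (simp add: B_u u_support)

text \<open>Since \<open>A\<close> kills \<open>u 0\<close>, \<open>B\<close> kills
  \<open>u p\<close> and \<open>B\<close> on \<open>u j\<close> is minus \<open>A\<close> on
  \<open>u (Suc j)\<close>, everything is expressed by the functionals of
  \<open>u 1, ..., u p\<close>. Their coefficients are differences of \<open>X\<close> along
  diagonals, so they vanish for a matrix constant on its diagonals.\<close>

lemma toeplitz:
  assumes v: "v \<in> W"
  shows "pairing A (\<Sum>j\<le>p. X j (Suc l) *s u j) v + pairing B (\<Sum>j\<le>p. X j l *s u j) v =
         (\<Sum>i<p. (X (Suc i) (Suc l) - X i l) * pairing A (u (Suc i)) v)"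
proof -
  have "pairing A (\<Sum>j\<le>p. X j (Suc l) *s u j) v = (\<Sum>i<p. X (Suc i) (Suc l) * pairing A (u (Suc i)) v)"
    by (simp add: pairing_linear sum.atMost_shift A_u_0[OF v])
  moreover have "pairing B (\<Sum>j\<le>p. X j l *s u j) v = - (\<Sum>i<p. X i l * pairing A (u (Suc i)) v)"
    by (simp add: pairing_linear lessThan_Suc_atMost[symmetric] B_u[OF v] u_support sum_negf)
  ultimately show ?thesis by (simp add: left_diff_distrib sum_subtractf)
qed

lemma comb_W: "(\<Sum>j\<in>J. c j *s u j) \<in> W"
  by (intro vec.subspace_sum[OF subspace_W] vec.subspace_scale[OF subspace_W] u_W)

text \<open>A linear relation between the \<open>u\<^sub>j\<close> would give a shorter chain: the Toeplitz combinations
  \<open>\<Sum>\<^sub>j c\<^sub>j\<^sub>-\<^sub>l u\<^sub>j\<close> also solve the equation.\<close>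
lemma u_independent:
  assumes "(\<Sum>j\<le>p. c j *s u j) = 0" "j \<le> p"
  shows "c j = 0"
proof -
  define x where "x l = (\<Sum>j\<le>p. (if l \<le> j then c (j - l) else 0) *s u j)" for l
  have x0: "x 0 = 0" using assms by (simp add: x_def)
  have xbig: "x l = 0" if "p < l" for l
    unfolding x_def using that by (intro sum.neutral) auto
  have "chain A B W x"
    unfolding chain_def
  proof (intro conjI allI ballI)
    fix i v assume "v \<in> W"
    then show "pairing A (x (Suc i)) v + pairing B (x i) v = 0"
      unfolding x_def by (subst toeplitz) (auto intro!: sum.neutral)
  qed (simp_all add: x0, simp add: x_def comb_W)
  \<comment> \<open>The assumed relation is \<open>x 0 = 0\<close>. After dropping this term the
    support lies below \<open>p\<close>, where minimality applies.\<close>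
  from chain_tail[OF this x0] have "x (Suc l) = 0" for l
    by (rule minimal) (simp add: xbig)
  then have x: "x l = 0" for l using x0 by (cases l) auto
  \<comment> \<open>The system is triangular: once \<open>c\<close> vanishes below \<open>l\<close>,
    the vector \<open>x (p - l)\<close> is \<open>c l *s u p\<close>.\<close>
  have "l \<le> p \<Longrightarrow> c l = 0" for l
  proof (induction l rule: less_induct)
    case (less l)
    have "x (p - l) = (\<Sum>j\<in>{p}. (if p - l \<le> j then c (j - (p - l)) else 0) *s u j)"
      unfolding x_def
    proof (rule sum.mono_neutral_right)
      show "\<forall>j\<in>{..p} - {p}. (if p - l \<le> j then c (j - (p - l)) else 0) *s u j = 0"
      proof
        fix j assume j: "j \<in> {..p} - {p}"
        then have "j - (p - l) < l \<or> \<not> p - l \<le> j" using less.prems by auto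
        then show "(if p - l \<le> j then c (j - (p - l)) else 0) *s u j = 0"
          using less.IH less.prems by auto
      qed
    qed auto
    then show ?case using x u_p less.prems by simp
  qed
  then show ?thesis using assms(2) .
qed

text \<open>The dual vectors exist by the Fredholm alternative.  A relation between the equations is
  a sequence \<open>s\<close> which solves the chain equation modulo the functionals \<open>A u\<^sub>i\<close>; subtracting an
  explicit combination \<open>x\<close> of the \<open>u\<^sub>j\<close> turns it into a chain, which vanishes by minimality.\<close>
lemma dual_chain_exists:
  "\<exists>y. (\<forall>l<p. y l \<in> W) \<and>
       (\<forall>l. Suc l < p \<longrightarrow> (\<forall>v\<in>W. pairing A (y l) v + pairing B (y (Suc l)) v = 0)) \<and>
       (\<forall>i<p. \<forall>l<p. pairing A (u (Suc i)) (y l) = (if i = l then 1 else 0))"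
proof -
  obtain Bs where Bs: "Bs \<subseteq> W" "vec.independent Bs" "W \<subseteq> vec.span Bs" "finite Bs"
    using vec.basis_exists[of W] vec.finiteI_independent by metis
  have span_Bs: "vec.span Bs = W" using Bs subspace_W by (simp add: vec.span_minimal subset_antisym)
  define K where "K = {..<p} \<times> Bs"
  \<comment> \<open>\<open>Inl (l, v)\<close> is the recurrence between \<open>y l\<close> and
    \<open>y (Suc l)\<close> tested on the basis vector \<open>v\<close>; \<open>Inr (i, l)\<close>
    is the duality of \<open>u (Suc i)\<close> and \<open>y l\<close>. A dual chain has
    \<open>p\<close> terms, hence \<open>p - 1\<close> links, and no condition at either
    end.\<close>
  define E where "E = Inl ` ({..<p - 1} \<times> Bs) \<union> Inr ` ({..<p} \<times> {..<p})"
  define a :: "(nat \<times> (complex^'n)) + (nat \<times> nat) \<Rightarrow> nat \<times> (complex^'n) \<Rightarrow> complex" where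
    "a e k = (case e of Inl (l, v) \<Rightarrow> (case k of (m, b) \<Rightarrow>
                  (if m = l then pairing A b v else 0) + (if m = Suc l then pairing B b v else 0))
              | Inr (i, l) \<Rightarrow> (case k of (m, b) \<Rightarrow> if m = l then pairing A (u (Suc i)) b else 0))" for e k
  define r :: "(nat \<times> (complex^'n)) + (nat \<times> nat) \<Rightarrow> complex" where
    "r e = (case e of Inl _ \<Rightarrow> 0 | Inr (i, l) \<Rightarrow> if i = l then 1 else 0)" for e
  have fin: "finite K" "finite E" using Bs(4) by (auto simp: K_def E_def)
  have sum_E: "(\<Sum>e\<in>E. f e) = (\<Sum>l<p - 1. \<Sum>v\<in>Bs. f (Inl (l, v))) + (\<Sum>l<p. \<Sum>i<p. f (Inr (i, l)))"
    for f :: "_ \<Rightarrow> complex"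
  proof -
    have "(\<Sum>e\<in>E. f e) = (\<Sum>e\<in>Inl ` ({..<p - 1} \<times> Bs). f e) + (\<Sum>e\<in>Inr ` ({..<p} \<times> {..<p}). f e)"
      unfolding E_def using Bs(4) by (intro sum.union_disjoint) auto
    also have "(\<Sum>e\<in>Inl ` ({..<p - 1} \<times> Bs). f e) = (\<Sum>l<p - 1. \<Sum>v\<in>Bs. f (Inl (l, v)))"
      by (simp add: sum.reindex sum.cartesian_product)
    also have "(\<Sum>e\<in>Inr ` ({..<p} \<times> {..<p}). f e) = (\<Sum>l<p. \<Sum>i<p. f (Inr (i, l)))"
      by (subst sum.swap) (simp add: sum.reindex sum.cartesian_product)
    finally show ?thesis .
  qed
  have "\<exists>x. \<forall>e\<in>E. (\<Sum>k\<in>K. a e k * x k) = r e"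
  proof (rule fredholm_alternative[OF fin])
    fix y :: "(nat \<times> (complex^'n)) + (nat \<times> nat) \<Rightarrow> complex"
    assume y: "\<forall>k\<in>K. (\<Sum>e\<in>E. y e * a e k) = 0"
    \<comment> \<open>The weights of the duality equations form a matrix \<open>\<gamma>\<close>,
      those of the recurrence equations a sequence \<open>s\<close> of vectors. Shifted by one,
      \<open>s\<close> has \<open>s 0 = 0\<close> and the relation becomes a chain equation with
      inhomogeneous term given by \<open>\<gamma>\<close>.\<close>
    define \<gamma> where "\<gamma> i l = (if l < p then y (Inr (i, l)) else 0)" for i l
    define s where "s l = (case l of 0 \<Rightarrow> 0 | Suc m \<Rightarrow> if m < p - 1 then (\<Sum>v\<in>Bs. y (Inl (m, v)) *s v) else 0)" for l
    have s_W: "s l \<in> W" for l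
      using Bs(1) by (auto simp: s_def vec.subspace_0[OF subspace_W] split: nat.splits
          intro!: vec.subspace_sum[OF subspace_W] vec.subspace_scale[OF subspace_W])
    have s0: "s 0 = 0" and sbig: "p \<le> l \<Longrightarrow> s l = 0" for l by (auto simp: s_def split: nat.splits)
    have step_b: "pairing A (s (Suc l)) b + pairing B (s l) b = (\<Sum>i<p. \<gamma> i l * pairing A (u (Suc i)) b)"
      if b: "b \<in> Bs" for l b
    proof (cases "l < p")
      case False
      then show ?thesis by (simp add: sbig \<gamma>_def)
    next
      case l: True
      have "0 = (\<Sum>e\<in>E. y e * a e (l, b))" using y l b by (auto simp: K_def)
      also have "\<dots> = (\<Sum>m<p - 1. \<Sum>v\<in>Bs. y (Inl (m, v)) * ((if l = m then pairing A b v else 0) + (if l = Suc m then pairing B b v else 0)))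
          + (\<Sum>m<p. \<Sum>i<p. y (Inr (i, m)) * (if l = m then pairing A (u (Suc i)) b else 0))"
        by (simp add: sum_E a_def)
      also have "(\<Sum>m<p. \<Sum>i<p. y (Inr (i, m)) * (if l = m then pairing A (u (Suc i)) b else 0))
          = (\<Sum>m<p. if l = m then \<Sum>i<p. y (Inr (i, m)) * pairing A (u (Suc i)) b else 0)"
        by (intro sum.cong) auto
      also have "\<dots> = (\<Sum>i<p. \<gamma> i l * pairing A (u (Suc i)) b)"
        using l by (simp add: sum.delta' \<gamma>_def)
      also have "(\<Sum>m<p - 1. \<Sum>v\<in>Bs. y (Inl (m, v)) * ((if l = m then pairing A b v else 0) + (if l = Suc m then pairing B b v else 0)))
          = (\<Sum>m<p - 1. if l = m then \<Sum>v\<in>Bs. y (Inl (m, v)) * pairing A b v else 0)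
            + (\<Sum>m<p - 1. if l = Suc m then \<Sum>v\<in>Bs. y (Inl (m, v)) * pairing B b v else 0)"
        unfolding sum.distrib[symmetric] by (intro sum.cong) (auto simp: sum.distrib)
      also have "(\<Sum>m<p - 1. if l = m then \<Sum>v\<in>Bs. y (Inl (m, v)) * pairing A b v else 0) = pairing A b (s (Suc l))"
        by (simp add: sum.delta' s_def pairing_linear)
      also have "(\<Sum>m<p - 1. if l = Suc m then \<Sum>v\<in>Bs. y (Inl (m, v)) * pairing B b v else 0) = pairing B b (s l)"
        using l by (cases l) (simp_all add: sum.delta' s_def pairing_linear)
      finally show ?thesis using skewA[of b "s (Suc l)"] skewB[of b "s l"] by (simp add: algebra_simps)
    qed
    have step: "pairing A (s (Suc l)) v + pairing B (s l) v = (\<Sum>i<p. \<gamma> i l * pairing A (u (Suc i)) v)"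
      if "v \<in> W" for l v
    proof -
      have "v \<in> vec.span Bs" using that span_Bs by simp
      then show ?thesis
      proof (induction rule: vec.span_induct_alt)
        case base
        then show ?case by simp
      next
        case (step c b w)
        have "pairing A (s (Suc l)) (c *s b + w) + pairing B (s l) (c *s b + w)
            = c * (pairing A (s (Suc l)) b + pairing B (s l) b) + (pairing A (s (Suc l)) w + pairing B (s l) w)"
          by (simp add: pairing_linear algebra_simps)
        moreover have "(\<Sum>i<p. \<gamma> i l * pairing A (u (Suc i)) (c *s b + w))
            = c * (\<Sum>i<p. \<gamma> i l * pairing A (u (Suc i)) b) + (\<Sum>i<p. \<gamma> i l * pairing A (u (Suc i)) w)"
          by (simp add: pairing_linear sum_distrib_left distrib_left sum.distrib mult.left_commute)
        ultimately show ?case using step step_b[OF step(1), of l] by simp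
      qed
    qed
    \<comment> \<open>\<open>X\<close> is a discrete primitive of \<open>\<gamma>\<close> along each
      diagonal. Diagonals with \<open>l \<le> j\<close> are summed from the value 0 at
      \<open>l = 0\<close>, the others back from the value 0 at \<open>l = p\<close>. This choice
      makes \<open>x\<close> vanish at 0 and beyond \<open>p\<close>, so that minimality can be
      applied to \<open>s - x\<close>.\<close>
    define X where "X j l = (if l \<le> j then \<Sum>t<l. \<gamma> (j - l + t) t else - (\<Sum>t=l..<p. \<gamma> (j + t - l) t))" for j l
    have X_rec: "X (Suc i) (Suc l) - X i l = \<gamma> i l" for i l
    proof (cases "l \<le> i")
      case True
      then show ?thesis by (simp add: X_def)
    next
      case False
      then show ?thesis
        by (cases "l < p") (simp_all add: X_def sum.atLeast_Suc_lessThan \<gamma>_def)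
    qed
    define x where "x l = (\<Sum>j\<le>p. X j l *s u j)" for l
    have x0: "x 0 = 0" by (simp add: x_def X_def)
    have xbig: "x l = 0" if "p < l" for l
      unfolding x_def X_def using that by (intro sum.neutral) auto
    define d where "d l = s l - x l" for l
    have d0: "d 0 = 0" by (simp add: d_def s0 x0)
    have "chain A B W d"
      unfolding chain_def
    proof (intro conjI allI ballI)
      fix l show "d l \<in> W" unfolding d_def x_def by (intro vec.subspace_diff subspace_W s_W comb_W)
    next
      fix l v assume v: "v \<in> W"
      have "pairing A (x (Suc l)) v + pairing B (x l) v = (\<Sum>i<p. \<gamma> i l * pairing A (u (Suc i)) v)"
        unfolding x_def by (simp add: toeplitz[OF v] X_rec)
      then show "pairing A (d (Suc l)) v + pairing B (d l) v = 0"
        using step[OF v, of l] by (simp add: d_def pairing_linear algebra_simps)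
    qed (simp add: d0)
    from chain_tail[OF this d0] have dS: "d (Suc l) = 0" for l
      by (rule minimal) (simp add: d_def sbig xbig)
    \<comment> \<open>The entry \<open>X p p\<close> is the trace of \<open>\<gamma>\<close>, which
      is exactly the value of the relation on the right-hand side \<open>r\<close>. Since both
      \<open>d p\<close> and \<open>s p\<close> vanish, so does \<open>x p\<close>, and independence
      of the \<open>u j\<close> isolates this entry.\<close>
    have "d p = 0" using dS d0 by (cases p) auto
    then have "x p = 0" by (simp add: d_def sbig)
    then have "X p p = 0" unfolding x_def by (rule u_independent) simp
    then have "(\<Sum>t<p. \<gamma> t t) = 0" by (simp add: X_def)
    moreover have "(\<Sum>e\<in>E. y e * r e) = (\<Sum>l<p. \<Sum>i<p. y (Inr (i, l)) * (if i = l then 1 else 0))"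
      by (simp add: sum_E r_def)
    moreover have "\<dots> = (\<Sum>l<p. \<Sum>i<p. if i = l then y (Inr (l, l)) else 0)"
      by (intro sum.cong) auto
    ultimately show "(\<Sum>e\<in>E. y e * r e) = 0" by (simp add: sum.delta \<gamma>_def)
  qed
  then obtain x where x: "\<And>e. e \<in> E \<Longrightarrow> (\<Sum>k\<in>K. a e k * x k) = r e" by blast
  define y where "y l = (\<Sum>b\<in>Bs. x (l, b) *s b)" for l
  have y_W: "y l \<in> W" for l
    using Bs(1) by (auto simp: y_def intro!: vec.subspace_sum[OF subspace_W] vec.subspace_scale[OF subspace_W])
  have sum_K: "(\<Sum>k\<in>K. f k) = (\<Sum>m<p. \<Sum>b\<in>Bs. f (m, b))" for f :: "_ \<Rightarrow> complex"
    by (simp add: K_def sum.cartesian_product)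
  have chain_b: "pairing A (y l) b + pairing B (y (Suc l)) b = 0" if l: "Suc l < p" and b: "b \<in> Bs" for l b
  proof -
    have "0 = (\<Sum>k\<in>K. a (Inl (l, b)) k * x k)"
      using x[of "Inl (l, b)"] l b by (auto simp: E_def r_def)
    also have "\<dots> = (\<Sum>m<p. if m = l then \<Sum>c\<in>Bs. pairing A c b * x (m, c) else 0)
        + (\<Sum>m<p. if m = Suc l then \<Sum>c\<in>Bs. pairing B c b * x (m, c) else 0)"
      unfolding sum_K a_def sum.distrib[symmetric]
      by (intro sum.cong) (auto simp: sum.distrib)
    also have "\<dots> = pairing A (y l) b + pairing B (y (Suc l)) b"
      using l by (simp add: sum.delta y_def pairing_linear mult.commute)
    finally show ?thesis by simp
  qed
  have chain_v: "pairing A (y l) v + pairing B (y (Suc l)) v = 0" if l: "Suc l < p" and v: "v \<in> W" for l v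
  proof -
    have "v \<in> vec.span Bs" using v span_Bs by simp
    then show ?thesis
    proof (induction rule: vec.span_induct_alt)
      case base
      then show ?case by simp
    next
      case (step c b w)
      have "pairing A (y l) (c *s b + w) + pairing B (y (Suc l)) (c *s b + w)
            = c * (pairing A (y l) b + pairing B (y (Suc l)) b) + (pairing A (y l) w + pairing B (y (Suc l)) w)"
        by (simp add: pairing_linear algebra_simps)
      then show ?case using step chain_b[OF l step(1)] by simp
    qed
  qed
  have "pairing A (u (Suc i)) (y l) = (if i = l then 1 else 0)" if "i < p" "l < p" for i l
  proof -
    have "(if i = l then 1 else 0) = (\<Sum>k\<in>K. a (Inr (i, l)) k * x k)"
      using x[of "Inr (i, l)"] that by (auto simp: E_def r_def)
    also have "\<dots> = (\<Sum>m<p. if m = l then \<Sum>b\<in>Bs. pairing A (u (Suc i)) b * x (m, b) else 0)"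
      unfolding sum_K a_def by (intro sum.cong) auto
    also have "\<dots> = pairing A (u (Suc i)) (y l)"
      using that by (simp add: sum.delta y_def pairing_linear mult.commute)
    finally show ?thesis by simp
  qed
  then show ?thesis using y_W chain_v by blast
qed

end

subsection \<open>Direct sums\<close>

lemma complement_exists:
  fixes S :: "('f::field^'m::finite) set"
  assumes S: "vec.subspace S" and W: "vec.subspace W" and sub: "S \<subseteq> W"
  shows "\<exists>Y. vec.subspace Y \<and> S \<inter> Y = {0} \<and> W = {x + y |x y. x \<in> S \<and> y \<in> Y}"
proof -
  have "Vector_Spaces.linear (*s) (*s) (id :: 'f^'m \<Rightarrow> 'f^'m)" by (rule vec.linear_id)
  from vec.linear_exists_left_inverse_on[OF this S] obtain g where g: "range g \<subseteq> S"
    "Vector_Spaces.linear (*s) (*s) g" "\<And>v. v \<in> S \<Longrightarrow> g v = v" by auto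
  interpret g: Vector_Spaces.linear "(*s)" "(*s)" g by (fact g)
  define Y where "Y = {v \<in> W. g v = 0}"
  have "vec.subspace Y" unfolding Y_def vec.subspace_def
    using W by (auto simp: g.add g.scale vec.subspace_0 vec.subspace_add vec.subspace_scale)
  moreover have "S \<inter> Y = {0}" using g(3) S W by (auto simp: Y_def g.zero vec.subspace_0)
  moreover have "W = {x + y |x y. x \<in> S \<and> y \<in> Y}"
  proof (intro equalityI subsetI)
    fix v assume v: "v \<in> W"
    have "g v \<in> S" using g(1) by auto
    moreover have "v - g v \<in> Y"
      using v sub g(1,3) by (auto simp: Y_def g.diff image_subset_iff intro!: vec.subspace_diff W)
    ultimately show "v \<in> {x + y |x y. x \<in> S \<and> y \<in> Y}"
      by (intro CollectI exI[of _ "g v"] exI[of _ "v - g v"]) simp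
  next
    fix v assume "v \<in> {x + y |x y. x \<in> S \<and> y \<in> Y}"
    then show "v \<in> W" using sub by (auto simp: Y_def intro!: vec.subspace_add W)
  qed
  ultimately show ?thesis by blast
qed

lemma dim_sum_direct:
  fixes X :: "('f::field^'m::finite) set"
  assumes X: "vec.subspace X" and Y: "vec.subspace Y" and XY: "X \<inter> Y = {0}"
  shows "vec.dim {x + y |x y. x \<in> X \<and> y \<in> Y} = vec.dim X + vec.dim Y"
proof -
  obtain C where C: "C \<subseteq> X" "vec.independent C" "X \<subseteq> vec.span C" "card C = vec.dim X"
    using vec.basis_exists by metis
  obtain D where D: "D \<subseteq> Y" "vec.independent D" "Y \<subseteq> vec.span D" "card D = vec.dim Y"
    using vec.basis_exists by metis
  have fin: "finite C" "finite D" using C D vec.finiteI_independent by blast+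
  have sC: "vec.span C = X" using C X by (simp add: vec.span_minimal subset_antisym)
  have sD: "vec.span D = Y" using D Y by (simp add: vec.span_minimal subset_antisym)
  have "0 \<notin> C" using C(2) vec.dependent_zero by blast
  then have disj: "C \<inter> D = {}" using Int_mono[OF C(1) D(1)] XY by auto
  have "vec.independent (C \<union> D)"
  proof (rule vec.independent_if_scalars_zero)
    fix f v assume f: "(\<Sum>x\<in>C \<union> D. f x *s x) = 0" and v: "v \<in> C \<union> D"
    have s: "(\<Sum>x\<in>C. f x *s x) + (\<Sum>x\<in>D. f x *s x) = 0"
      using f fin disj by (simp add: sum.union_disjoint)
    have cX: "(\<Sum>x\<in>C. f x *s x) \<in> X"
      using C(1) by (intro vec.subspace_sum[OF X] vec.subspace_scale[OF X]) auto
    have dY: "(\<Sum>x\<in>D. f x *s x) \<in> Y"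
      using D(1) by (intro vec.subspace_sum[OF Y] vec.subspace_scale[OF Y]) auto
    have "(\<Sum>x\<in>C. f x *s x) = - (\<Sum>x\<in>D. f x *s x)" using s by (simp add: eq_neg_iff_add_eq_0)
    then have "(\<Sum>x\<in>C. f x *s x) \<in> X \<inter> Y" using cX dY vec.subspace_neg[OF Y] by auto
    then have z: "(\<Sum>x\<in>C. f x *s x) = 0" using XY by simp
    then have z': "(\<Sum>x\<in>D. f x *s x) = 0" using s by simp
    show "f v = 0"
      using v vec.independentD[OF C(2) fin(1) subset_refl z] vec.independentD[OF D(2) fin(2) subset_refl z']
      by blast
  qed (use fin in simp)
  moreover have "vec.span (C \<union> D) = {x + y |x y. x \<in> X \<and> y \<in> Y}"
    by (simp add: vec.span_Un sC sD)
  ultimately have "vec.dim {x + y |x y. x \<in> X \<and> y \<in> Y} = card (C \<union> D)"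
    by (metis vec.dim_span_eq_card_independent)
  then show ?thesis using fin disj C D by (simp add: card_Un_disjoint)
qed

lemma orthogonal_spaces_sym: "orthogonal_spaces A B X Y \<longleftrightarrow> orthogonal_spaces A B Y X"
  unfolding orthogonal_spaces_def by blast

lemma orthogonal_spaces_mono:
  "orthogonal_spaces A B X Y \<Longrightarrow> X' \<subseteq> X \<Longrightarrow> Y' \<subseteq> Y \<Longrightarrow> orthogonal_spaces A B X' Y'"
  unfolding orthogonal_spaces_def by blast

definition orthogonal_sum ::
    "complex^'n^'n \<Rightarrow> complex^'n^'n \<Rightarrow> (complex^'n::finite) set \<Rightarrow> (complex^'n) set \<Rightarrow> (complex^'n) set \<Rightarrow> bool"
  where "orthogonal_sum A B X Y W \<longleftrightarrow> vec.subspace X \<and> vec.subspace Y \<and> X \<inter> Y = {0} \<and>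
           W = {x + y |x y. x \<in> X \<and> y \<in> Y} \<and> orthogonal_spaces A B X Y"

text \<open>A recursive form of \<open>is_direct_sum\<close>: the sum of the remaining summands is
  named at each step, so inductions deal with two summands at a time.\<close>

fun orthogonal_sum_list ::
    "complex^'n^'n \<Rightarrow> complex^'n^'n \<Rightarrow> (complex^'n::finite) set \<Rightarrow> (complex^'n) set list \<Rightarrow> bool" where
  "orthogonal_sum_list A B W [] \<longleftrightarrow> W = {0}"
| "orthogonal_sum_list A B W (X # Ws) \<longleftrightarrow> (\<exists>Y. orthogonal_sum A B X Y W \<and> orthogonal_sum_list A B Y Ws)"

lemma orthogonal_sum_subset:
  assumes "orthogonal_sum A B X Y W" shows "X \<subseteq> W" "Y \<subseteq> W" "vec.subspace W"
proof -
  have "0 \<in> X" "0 \<in> Y" using assms by (auto simp: orthogonal_sum_def vec.subspace_0)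
  then show "X \<subseteq> W" "Y \<subseteq> W" using assms unfolding orthogonal_sum_def by force+
  show "vec.subspace W" using assms vec.subspace_sums[of X Y] unfolding orthogonal_sum_def by blast
qed

lemma orthogonal_sum_list_subset:
  "orthogonal_sum_list A B W Ws \<Longrightarrow> X \<in> set Ws \<Longrightarrow> vec.subspace X \<and> X \<subseteq> W"
proof (induction Ws arbitrary: W)
  case (Cons Z Ws)
  then show ?case using orthogonal_sum_subset unfolding orthogonal_sum_list.simps
    by (metis orthogonal_sum_def set_ConsD subset_trans)
qed simp

text \<open>Associativity: if \<open>X\<close> is the sum of \<open>Z\<close> and \<open>X'\<close>,
  then \<open>W\<close> regroups as \<open>Z\<close> plus the sum of \<open>X'\<close> and
  \<open>Y\<close>, to which the induction applies.\<close>

lemma orthogonal_sum_list_append: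
  assumes "orthogonal_sum A B X Y W" "orthogonal_sum_list A B X Xs" "orthogonal_sum_list A B Y Ys"
  shows "orthogonal_sum_list A B W (Xs @ Ys)"
  using assms
proof (induction Xs arbitrary: X W)
  case Nil
  then have "X = {0}" by simp
  then have "W = Y" using Nil(1) by (auto simp: orthogonal_sum_def)
  then show ?case using Nil by simp
next
  case (Cons Z Xs)
  then obtain X' where X': "orthogonal_sum A B Z X' X" "orthogonal_sum_list A B X' Xs" by auto
  note d = orthogonal_sum_def
  have sub: "vec.subspace Z" "vec.subspace X'" "vec.subspace Y" "X' \<subseteq> X" "Z \<subseteq> X"
    using X' Cons.prems(1) orthogonal_sum_subset[OF X'(1)] by (auto simp: d)
  define V where "V = {x + y |x y. x \<in> X' \<and> y \<in> Y}"
  have "orthogonal_sum A B X' Y V"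
    using Cons.prems(1) sub by (auto simp: d V_def vec.subspace_0 intro: orthogonal_spaces_mono)
  then have V: "orthogonal_sum_list A B V (Xs @ Ys)" by (rule Cons.IH[OF _ X'(2) Cons.prems(3)])
  have "orthogonal_sum A B Z V W"
    unfolding d
  proof (intro conjI)
    show "vec.subspace V" unfolding V_def by (rule vec.subspace_sums[OF sub(2,3)])
    show "Z \<inter> V = {0}"
    proof (intro equalityI subsetI)
      fix v assume "v \<in> Z \<inter> V"
      then obtain x y where v: "v \<in> Z" "v = x + y" "x \<in> X'" "y \<in> Y" by (auto simp: V_def)
      have "v \<in> X" "x \<in> X" using v sub by auto
      then have "v - x \<in> X" using Cons.prems(1) vec.subspace_diff unfolding d by blast
      then have "y \<in> X \<inter> Y" using v by simp
      then have "y = 0" using Cons.prems(1) by (auto simp: d)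
      then have "v \<in> Z \<inter> X'" using v by simp
      then show "v \<in> {0}" using X'(1) by (auto simp: d)
    qed (use sub in \<open>auto simp: V_def vec.subspace_0 intro!: exI[of _ 0]\<close>)
    show "W = {x + y |x y. x \<in> Z \<and> y \<in> V}"
    proof (intro equalityI subsetI)
      fix w assume "w \<in> W"
      then obtain x y where w: "w = x + y" "x \<in> X" "y \<in> Y" using Cons.prems(1) by (auto simp: d)
      obtain z x' where x: "x = z + x'" "z \<in> Z" "x' \<in> X'" using X'(1) w(2) by (auto simp: d)
      have "x' + y \<in> V" using x w by (auto simp: V_def)
      then show "w \<in> {x + y |x y. x \<in> Z \<and> y \<in> V}" using w x by (auto simp: add.assoc)
    next
      fix w assume "w \<in> {x + y |x y. x \<in> Z \<and> y \<in> V}"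
      then obtain z x' y where w: "w = z + (x' + y)" "z \<in> Z" "x' \<in> X'" "y \<in> Y" by (auto simp: V_def)
      have "z + x' \<in> X" using w X'(1) by (auto simp: d)
      moreover have "w = (z + x') + y" using w by (simp add: add.assoc)
      ultimately show "w \<in> W" using w Cons.prems(1) unfolding d by blast
    qed
    show "orthogonal_spaces A B Z V"
    proof -
      have "orthogonal_spaces A B Z X'" "orthogonal_spaces A B X Y"
        using X'(1) Cons.prems(1) unfolding d by blast+
      moreover from this(2) have "orthogonal_spaces A B Z Y"
        by (rule orthogonal_spaces_mono) (use sub in auto)
      ultimately show ?thesis unfolding orthogonal_spaces_def V_def by (auto simp: pairing_linear)
    qed
  qed (use sub in auto)
  then show ?case using V by auto
qed

lemma subspace_list_sums:
  "\<forall>X\<in>set Ws. vec.subspace X \<Longrightarrow> vec.subspace {sum_list us |us. list_all2 (\<in>) us Ws}"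
proof (induction Ws)
  case (Cons X Ws)
  have "{sum_list us |us. list_all2 (\<in>) us (X # Ws)} =
        {x + y |x y. x \<in> X \<and> y \<in> {sum_list us |us. list_all2 (\<in>) us Ws}}"
    by (force simp: list_all2_Cons2)
  moreover have "vec.subspace \<dots>" by (rule vec.subspace_sums) (use Cons in auto)
  ultimately show ?case by simp
qed simp

text \<open>Unique decomposition of vectors corresponds to trivial intersections: the difference of
  two head components lies both in \<open>X\<close> and in the sum of the remaining
  summands.\<close>

lemma orthogonal_sum_list_iff:
  "orthogonal_sum_list A B W Ws \<longleftrightarrow> (\<forall>X\<in>set Ws. vec.subspace X) \<and> sorted_wrt (orthogonal_spaces A B) Ws \<and>
     W = {sum_list us |us. list_all2 (\<in>) us Ws} \<and>
     (\<forall>us us'. list_all2 (\<in>) us Ws \<longrightarrow> list_all2 (\<in>) us' Ws \<longrightarrow> sum_list us = sum_list us' \<longrightarrow> us = us')"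
proof (induction Ws arbitrary: W)
  case (Cons X Ws)
  have img: "{sum_list us |us. list_all2 (\<in>) us (X # Ws)} =
        {x + y |x y. x \<in> X \<and> y \<in> {sum_list us |us. list_all2 (\<in>) us Ws}}"
    by (force simp: list_all2_Cons2)
  show ?case
  proof
    assume "orthogonal_sum_list A B W (X # Ws)"
    then obtain Y where Y: "orthogonal_sum A B X Y W" "orthogonal_sum_list A B Y Ws" by auto
    note IH = Cons.IH[of Y, THEN iffD1, OF Y(2)]
    have uni: "us = us'" if "list_all2 (\<in>) us (X # Ws)" "list_all2 (\<in>) us' (X # Ws)" "sum_list us = sum_list us'" for us us'
    proof -
      note asm = that
      obtain x vs where us: "us = x # vs" "x \<in> X" "list_all2 (\<in>) vs Ws" using asm(1) unfolding list_all2_Cons2 by blast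
      obtain x' vs' where us': "us' = x' # vs'" "x' \<in> X" "list_all2 (\<in>) vs' Ws" using asm(2) unfolding list_all2_Cons2 by blast
      have e: "x + sum_list vs = x' + sum_list vs'" using asm(3) us us' by simp
      have "sum_list vs \<in> Y" "sum_list vs' \<in> Y" using IH us(3) us'(3) by blast+
      then have "sum_list vs' - sum_list vs \<in> Y" using Y(1) by (auto simp: orthogonal_sum_def intro: vec.subspace_diff)
      moreover have "x - x' \<in> X" using us us' Y(1) by (auto simp: orthogonal_sum_def intro: vec.subspace_diff)
      moreover have "x - x' = sum_list vs' - sum_list vs" using e by (simp add: algebra_simps)
      ultimately have "x - x' \<in> X \<inter> Y" by simp
      moreover have "X \<inter> Y = {0}" using Y(1) unfolding orthogonal_sum_def by blast
      ultimately have "x = x'" by simp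
      then have "sum_list vs = sum_list vs'" using e by simp
      then have "vs = vs'" using IH us(3) us'(3) by blast
      then show ?thesis using \<open>x = x'\<close> us(1) us'(1) by simp
    qed
    have "\<forall>Z\<in>set Ws. orthogonal_spaces A B X Z"
      using orthogonal_sum_list_subset[OF Y(2)] Y(1) by (auto simp: orthogonal_sum_def intro: orthogonal_spaces_mono)
    moreover have "W = {sum_list us |us. list_all2 (\<in>) us (X # Ws)}"
    proof -
      have "Y = {sum_list us |us. list_all2 (\<in>) us Ws}" using IH by blast
      then show ?thesis using Y(1) unfolding img orthogonal_sum_def by blast
    qed
    moreover have "\<forall>Z\<in>set (X # Ws). vec.subspace Z"
      using Y(1) orthogonal_sum_list_subset[OF Y(2)] by (simp add: orthogonal_sum_def)
    moreover have "sorted_wrt (orthogonal_spaces A B) Ws" using IH by blast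
    ultimately show "(\<forall>Z\<in>set (X # Ws). vec.subspace Z) \<and> sorted_wrt (orthogonal_spaces A B) (X # Ws) \<and>
        W = {sum_list us |us. list_all2 (\<in>) us (X # Ws)} \<and>
        (\<forall>us us'. list_all2 (\<in>) us (X # Ws) \<longrightarrow> list_all2 (\<in>) us' (X # Ws) \<longrightarrow> sum_list us = sum_list us' \<longrightarrow> us = us')"
      using uni by (simp only: sorted_wrt.simps) blast
  next
    assume H: "(\<forall>Z\<in>set (X # Ws). vec.subspace Z) \<and> sorted_wrt (orthogonal_spaces A B) (X # Ws) \<and>
        W = {sum_list us |us. list_all2 (\<in>) us (X # Ws)} \<and>
        (\<forall>us us'. list_all2 (\<in>) us (X # Ws) \<longrightarrow> list_all2 (\<in>) us' (X # Ws) \<longrightarrow> sum_list us = sum_list us' \<longrightarrow> us = us')"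
    then have uni: "us = us'" if "list_all2 (\<in>) us (X # Ws)" "list_all2 (\<in>) us' (X # Ws)" "sum_list us = sum_list us'" for us us'
      using that by blast
    define Y where "Y = {sum_list us |us. list_all2 (\<in>) us Ws}"
    have X: "vec.subspace X" and Y: "vec.subspace Y"
      using H subspace_list_sums unfolding Y_def by auto
    have "orthogonal_sum_list A B Y Ws"
    proof (subst Cons.IH, intro conjI allI impI)
      fix us us' assume "list_all2 (\<in>) us Ws" "list_all2 (\<in>) us' Ws" "sum_list us = sum_list us'"
      then have "0 # us = 0 # us'" using X by (intro uni) (auto simp: vec.subspace_0)
      then show "us = us'" by simp
    qed (use H in \<open>auto simp: Y_def\<close>)
    moreover have "orthogonal_sum A B X Y W"
      unfolding orthogonal_sum_def
    proof (intro conjI X Y)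
      show "X \<inter> Y = {0}"
      proof (intro equalityI subsetI)
        fix v assume "v \<in> X \<inter> Y"
        then obtain us where us: "v \<in> X" "list_all2 (\<in>) us Ws" "v = sum_list us" by (auto simp: Y_def)
        define zs where "zs = map (\<lambda>_. 0 :: complex^'a) Ws"
        have zs: "list_all2 (\<in>) zs Ws" using H by (auto simp: zs_def list_all2_conv_all_nth vec.subspace_0)
        \<comment> \<open>A vector in both summands has two expansions, one concentrated in the head
          and one in the tail.\<close>
        have "v # zs = 0 # us" using us zs X by (intro uni) (auto simp: vec.subspace_0 zs_def)
        then show "v \<in> {0}" by simp
      qed (use X Y in \<open>auto simp: vec.subspace_0\<close>)
      show "W = {x + y |x y. x \<in> X \<and> y \<in> Y}" using H img unfolding Y_def by simp
      have "orthogonal_spaces A B X {sum_list us}" if "list_all2 (\<in>) us Ws" "\<forall>Z\<in>set Ws. orthogonal_spaces A B X Z" for us Ws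
        using that
      proof (induction us Ws rule: list_all2_induct)
        case Nil
        then show ?case by (simp add: orthogonal_spaces_def)
      next
        case (Cons x xs y ys)
        then show ?case by (auto simp: orthogonal_spaces_def pairing_linear)
      qed
      then show "orthogonal_spaces A B X Y" using H by (fastforce simp: Y_def orthogonal_spaces_def)
    qed
    ultimately show "orthogonal_sum_list A B W (X # Ws)" by auto
  qed
qed auto

lemma is_direct_sum_iff: "is_direct_sum A B Ws \<longleftrightarrow> orthogonal_sum_list A B UNIV Ws"
proof -
  have all2: "(\<exists>!us. length us = length Ws \<and> (\<forall>j<length Ws. us ! j \<in> Ws ! j) \<and> v = sum_list us) \<longleftrightarrow>
      (\<exists>!us. list_all2 (\<in>) us Ws \<and> v = sum_list us)" for v
    by (simp add: list_all2_conv_all_nth cong: conj_cong)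
  have "(\<forall>v. \<exists>!us. list_all2 (\<in>) us Ws \<and> v = sum_list us) \<longleftrightarrow> UNIV = {sum_list us |us. list_all2 (\<in>) us Ws} \<and>
     (\<forall>us us'. list_all2 (\<in>) us Ws \<longrightarrow> list_all2 (\<in>) us' Ws \<longrightarrow> sum_list us = sum_list us' \<longrightarrow> us = us')"
    (is "?l \<longleftrightarrow> ?r")
  proof
    assume ?l
    then show ?r by (smt (verit, best) Collect_cong UNIV_I UNIV_def)
  next
    assume r: ?r
    show ?l
    proof
      fix v
      have "v \<in> {sum_list us |us. list_all2 (\<in>) us Ws}" using r by blast
      then show "\<exists>!us. list_all2 (\<in>) us Ws \<and> v = sum_list us" using r by blast
    qed
  qed
  moreover have "(\<forall>i<length Ws. \<forall>j<length Ws. i \<noteq> j \<longrightarrow> orthogonal_spaces A B (Ws ! i) (Ws ! j)) \<longleftrightarrow>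
      sorted_wrt (orthogonal_spaces A B) Ws"
    unfolding sorted_wrt_iff_nth_less
  proof safe
    fix i j assume "\<forall>i j. i < j \<longrightarrow> j < length Ws \<longrightarrow> orthogonal_spaces A B (Ws ! i) (Ws ! j)"
      "i < length Ws" "j < length Ws" "i \<noteq> j"
    then show "orthogonal_spaces A B (Ws ! i) (Ws ! j)"
      by (cases "i < j") (auto intro: orthogonal_spaces_sym[THEN iffD1])
  qed auto
  ultimately show ?thesis
    unfolding is_direct_sum_def orthogonal_sum_list_iff all2 by (simp only: conj_ac)
qed

subsection \<open>Splitting off a Kronecker block\<close>

lemma sum_even_odd:
  fixes f :: "nat \<Rightarrow> 'b::comm_monoid_add"
  shows "(\<Sum>i<2 * p + 1. f i) = (\<Sum>a\<le>p. f (2 * a)) + (\<Sum>b<p. f (2 * b + 1))"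
proof (induction p)
  case (Suc p)
  have "(\<Sum>i<2 * Suc p + 1. f i) = (\<Sum>i<2 * p + 1. f i) + f (2 * p + 1) + f (2 * Suc p)"
    by (simp add: algebra_simps)
  then show ?case using Suc by (simp add: algebra_simps)
qed simp

context minimal_chain
begin

text \<open>For \<open>p > 0\<close> the coordinates of an element of \<open>X\<close> can be read
  off by pairings: those along \<open>y\<close> by \<open>A\<close> with \<open>u (Suc i)\<close>,
  those along \<open>u\<close> by \<open>A\<close> with \<open>y l\<close> and, for
  \<open>u 0\<close>, by \<open>B\<close> with \<open>y 0\<close>. The same readings define a
  projection of \<open>W\<close> onto \<open>X\<close> with kernel the orthogonal
  complement.\<close>

lemma splits_kronecker_block_aux:
  assumes y_W: "\<And>l. l < p \<Longrightarrow> y l \<in> W"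
    and y_rec: "\<And>l v. Suc l < p \<Longrightarrow> v \<in> W \<Longrightarrow> pairing A (y l) v + pairing B (y (Suc l)) v = 0"
    and dual: "\<And>i l. i < p \<Longrightarrow> l < p \<Longrightarrow> pairing A (u (Suc i)) (y l) = (if i = l then 1 else 0)"
  defines "X \<equiv> vec.span ((\<lambda>i. if even i then u (p - i div 2) else y (p - Suc (i div 2))) ` {..<2 * p + 1})"
  shows "kronecker_block A B (Suc p) X" and "\<exists>Y. orthogonal_sum A B X Y W"
proof -
  \<comment> \<open>The shift argument for chains, but \<open>y\<close> obeys the recurrence only
    between its ends. So the two indices move towards each other until they are equal or adjacent,
    and skewness finishes both cases.\<close>
  have yA: "pairing A (y l) (y m) = 0" if "l \<le> m" "m < p" for l m
    using that
  proof (induction "m - l" arbitrary: l m rule: less_induct)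
    case less
    show ?case
    proof (cases "l = m")
      case False
      then obtain m' where m': "m = Suc m'" "l \<le> m'" using less.prems by (cases m) auto
      have "pairing A (y l) (y m) = - pairing B (y (Suc l)) (y m)"
        using y_rec[of l "y m"] y_W less.prems False by (simp add: eq_neg_iff_add_eq_0)
      also have "\<dots> = pairing B (y m) (y (Suc l))" using skewB[of "y m" "y (Suc l)"] by simp
      also have "\<dots> = - pairing A (y m') (y (Suc l))"
        using y_rec[of m' "y (Suc l)"] y_W less.prems False m' by (simp add: eq_neg_iff_add_eq_0 add.commute)
      also have "\<dots> = pairing A (y (Suc l)) (y m')" using skewA[of "y (Suc l)" "y m'"] by simp
      finally have e: "pairing A (y l) (y m) = pairing A (y (Suc l)) (y m')" .
      show ?thesis
      proof (cases "l = m'")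
        case True
        then show ?thesis using e skewA[of "y l" "y (Suc l)"] m' by simp
      next
        case False
        then show ?thesis using e less.hyps[of m' "Suc l"] less.prems m' by simp
      qed
    qed simp
  qed
  then have yA: "pairing A (y l) (y m) = 0" if "l < p" "m < p" for l m
    using that skewA[of "y l" "y m"] by (cases "l \<le> m") auto
  have y_rec': "pairing B (y (Suc l)) v = - pairing A (y l) v" if "Suc l < p" "v \<in> W" for l v
    using y_rec[OF that] by (simp add: eq_neg_iff_add_eq_0 add.commute)
  have yB: "pairing B (y l) (y m) = 0" if "l < p" "m < p" for l m
  proof (cases l)
    case (Suc l')
    then show ?thesis using y_rec'[of l' "y m"] that y_W yA by simp
  next
    case 0
    show ?thesis
    proof (cases m)
      case (Suc m')
      then show ?thesis using y_rec'[of m' "y l"] that y_W yA skewB[of "y l" "y m"] by simp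
    qed (simp add: 0)
  qed
  \<comment> \<open>The order is reversed because \<open>A\<close> pairs \<open>u (Suc i)\<close>
    with \<open>y i\<close> while \<open>B\<close> pairs \<open>y i\<close> with \<open>u i\<close>.
    Along \<open>w\<close> these become the links from even to odd and from odd to even
    positions.\<close>
  define w where "w i = (if even i then u (p - i div 2) else y (p - Suc (i div 2)))" for i
  have uyA: "pairing A (u (p - a)) (y (p - Suc b)) = (if a = b then 1 else 0)" if "a \<le> p" "b < p" for a b
  proof (cases "a = p")
    case True
    then show ?thesis using that A_u_0 y_W by auto
  next
    case False
    then have "p - a = Suc (p - Suc a)" using that by simp
    then show ?thesis using that False by (auto simp: dual)
  qed
  have uyB: "pairing B (u (p - a)) (y (p - Suc b)) = (if a = Suc b then - 1 else 0)" if "a \<le> p" "b < p" for a b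
  proof (cases a)
    case 0
    then show ?thesis using that B_u_p y_W by simp
  next
    case (Suc a')
    then have "p - a < p" "p - a = p - Suc b \<longleftrightarrow> a = Suc b" using that by auto
    then show ?thesis using that y_W by (simp add: B_u dual)
  qed
  have w_even: "w (2 * a) = u (p - a)" and w_odd: "w (2 * a + 1) = y (p - Suc a)" for a
    by (simp_all add: w_def)
  have gram: "pairing A (w i) (w j) = kronecker_pairing1 i j \<and> pairing B (w i) (w j) = kronecker_pairing2 i j"
    if i: "i < 2 * p + 1" and j: "j < 2 * p + 1" for i j
  proof -
    have ee: "even n \<Longrightarrow> n < 2 * p + 1 \<Longrightarrow> \<exists>a\<le>p. n = 2 * a" for n by presburger
    have oo: "odd n \<Longrightarrow> n < 2 * p + 1 \<Longrightarrow> \<exists>a<p. n = 2 * a + 1" for n by presburger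
    consider "even i" "even j" | "even i" "odd j" | "odd i" "even j" | "odd i" "odd j" by blast
    then show ?thesis
    proof cases
      case 1
      obtain a b where "i = 2 * a" "j = 2 * b" using ee 1 i j by metis
      then show ?thesis
        using chain_isotropic[OF chain_u] by (simp add: w_even kronecker_pairing1_def kronecker_pairing2_def) presburger
    next
      case 2
      obtain a b where ab: "i = 2 * a" "j = 2 * b + 1" "a \<le> p" "b < p" using ee oo 2 i j by metis
      have "pairing A (w i) (w j) = (if a = b then 1 else 0)" "pairing B (w i) (w j) = (if a = Suc b then - 1 else 0)"
        unfolding ab w_even w_odd using ab uyA uyB by auto
      then show ?thesis using ab by (auto simp: kronecker_pairing1_def kronecker_pairing2_def)
    next
      case 3
      obtain a b where ab: "i = 2 * b + 1" "j = 2 * a" "a \<le> p" "b < p" using ee oo 3 i j by metis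
      have "pairing A (w j) (w i) = (if a = b then 1 else 0)" "pairing B (w j) (w i) = (if a = Suc b then - 1 else 0)"
        unfolding ab w_even w_odd using ab uyA uyB by auto
      then show ?thesis using ab skewA[of "w i" "w j"] skewB[of "w i" "w j"]
        by (auto simp: kronecker_pairing1_def kronecker_pairing2_def)
    next
      case 4
      obtain a b where "i = 2 * a + 1" "j = 2 * b + 1" "a < p" "b < p" using oo 4 i j by metis
      then show ?thesis
        unfolding kronecker_pairing1_def kronecker_pairing2_def by (simp only: w_odd) (simp add: yA yB, presburger)
    qed
  qed
  have comb: "(\<Sum>i<2 * p + 1. c i *s w i) =
      (\<Sum>j\<le>p. c (2 * (p - j)) *s u j) + (\<Sum>l<p. c (2 * (p - Suc l) + 1) *s y l)" for c
  proof -
    have "(\<Sum>a\<le>p. c (2 * a) *s u (p - a)) = (\<Sum>j\<le>p. c (2 * (p - j)) *s u j)"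
      by (rule sum.reindex_bij_witness[of _ "\<lambda>j. p - j" "\<lambda>j. p - j"]) auto
    moreover have "(\<Sum>b<p. c (2 * b + 1) *s y (p - Suc b)) = (\<Sum>l<p. c (2 * (p - Suc l) + 1) *s y l)"
      by (rule sum.reindex_bij_witness[of _ "\<lambda>j. p - Suc j" "\<lambda>j. p - Suc j"]) auto
    ultimately show ?thesis unfolding sum_even_odd w_even w_odd by simp
  qed
  have pair_u: "pairing A (u (Suc i)) ((\<Sum>j\<le>p. \<alpha> j *s u j) + (\<Sum>l<p. \<beta> l *s y l)) = \<beta> i" if "i < p" for \<alpha> \<beta> i
    using that by (simp add: pairing_linear chain_isotropic[OF chain_u] dual if_distrib cong: if_cong)
  have u_sum_y: "pairing A (\<Sum>j\<le>p. \<alpha> j *s u j) (y l) = \<alpha> (Suc l)" "pairing B (\<Sum>j\<le>p. \<alpha> j *s u j) (y 0) = - \<alpha> 0"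
    if l: "l < p" for \<alpha> l
  proof -
    have "pairing A (\<Sum>j\<le>p. \<alpha> j *s u j) (y l) = (\<Sum>i<p. \<alpha> (Suc i) * pairing A (u (Suc i)) (y l))"
      by (simp add: pairing_linear sum.atMost_shift A_u_0[OF y_W[OF l]])
    also have "\<dots> = \<alpha> (Suc l)" using l by (simp add: dual if_distrib cong: if_cong)
    finally show "pairing A (\<Sum>j\<le>p. \<alpha> j *s u j) (y l) = \<alpha> (Suc l)" .
    have "0 < p" using l by simp
    have "pairing B (\<Sum>j\<le>p. \<alpha> j *s u j) (y 0) = - (\<Sum>i<p. \<alpha> i * pairing A (u (Suc i)) (y 0))"
      using B_u[OF y_W[OF \<open>0 < p\<close>]] u_support
      by (simp add: pairing_linear lessThan_Suc_atMost[symmetric] sum_negf)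
    also have "\<dots> = - \<alpha> 0" using \<open>0 < p\<close> by (simp add: dual if_distrib cong: if_cong)
    finally show "pairing B (\<Sum>j\<le>p. \<alpha> j *s u j) (y 0) = - \<alpha> 0" .
  qed
  have y_sum_y: "pairing A (\<Sum>m<p. \<beta> m *s y m) (y l) = 0" "pairing B (\<Sum>m<p. \<beta> m *s y m) (y l) = 0" if "l < p" for \<beta> l
    using that by (simp_all add: pairing_linear yA yB)
  have indep: "inj_on w {..<2 * p + 1} \<and> vec.independent (w ` {..<2 * p + 1})"
  proof (subst independent_family_iff, simp, intro allI impI)
    fix c assume c: "(\<Sum>i<2 * p + 1. c i *s w i) = 0"
    have odd: "c (2 * (p - Suc l) + 1) = 0" if "l < p" for l
      using pair_u[OF that, of "\<lambda>j. c (2 * (p - j))" "\<lambda>l. c (2 * (p - Suc l) + 1)"] c comb[of c] by simp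
    then have "(\<Sum>j\<le>p. c (2 * (p - j)) *s u j) = 0" using c comb[of c] by simp
    then have even: "c (2 * (p - j)) = 0" if "j \<le> p" for j using u_independent that by fastforce
    show "\<forall>i\<in>{..<2 * p + 1}. c i = 0"
    proof
      fix i assume "i \<in> {..<2 * p + 1}"
      then have i: "i < 2 * p + 1" by simp
      show "c i = 0"
      proof (cases "even i")
        case True
        then obtain a where "i = 2 * a" "a \<le> p" using i by auto
        then show ?thesis using even[of "p - a"] by simp
      next
        case False
        then obtain a where "i = 2 * a + 1" "a < p" using i by (auto elim!: oddE)
        then show ?thesis using odd[of "p - Suc a"] by (simp add: Suc_diff_Suc)
      qed
    qed
  qed
  have X: "X = vec.span (w ` {..<2 * p + 1})" by (simp add: X_def w_def)
  have "2 * Suc p - 1 = 2 * p + 1" by simp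
  then show "kronecker_block A B (Suc p) X"
    unfolding kronecker_block_def X using indep gram by (intro conjI exI[of _ w]) auto
  have X_sub: "vec.subspace X" by (simp add: X)
  have X_W: "X \<subseteq> W"
    unfolding X
  proof (rule vec.span_minimal[OF _ subspace_W], rule image_subsetI)
    fix i assume "i \<in> {..<2 * p + 1}"
    then have "odd i \<Longrightarrow> p - Suc (i div 2) < p" by (cases p) auto
    then show "w i \<in> W" by (simp add: w_def u_W y_W)
  qed
  show "\<exists>Y. orthogonal_sum A B X Y W"
  \<comment> \<open>For \<open>p = 0\<close> the block is a line in the kernel of both pairings. It
    is orthogonal to all of \<open>W\<close>, so any complement serves, whereas the orthogonal
    complement would be \<open>W\<close> itself.\<close>
  proof (cases "p = 0")
    case True
    obtain Y where Y: "vec.subspace Y" "X \<inter> Y = {0}" "W = {x + y |x y. x \<in> X \<and> y \<in> Y}"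
      using complement_exists[OF X_sub subspace_W X_W] by blast
    have YW: "Y \<subseteq> W" using Y(3) X_sub vec.subspace_0 by force
    have "X = vec.span {u 0}" unfolding X using True by (simp add: w_def lessThan_Suc)
    then have X0: "\<exists>c. x = c *s u 0" if "x \<in> X" for x using that by (auto simp: vec.span_singleton)
    have "orthogonal_spaces A B X Y"
    proof (rule orthogonal_spacesI)
      fix x v assume xv: "x \<in> X" "v \<in> Y"
      obtain c where "x = c *s u 0" using X0 xv by blast
      then show "pairing A x v = 0" "pairing B x v = 0"
        using A_u_0[of v] B_u_p[of v] True xv YW by (auto simp: pairing_linear)
    qed
    then show ?thesis using Y X_sub unfolding orthogonal_sum_def by blast
  next
    case False
    then have p: "0 < p" by simp
    define Y where "Y = {v \<in> W. \<forall>x\<in>X. pairing A x v = 0 \<and> pairing B x v = 0}"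
    have Y: "vec.subspace Y"
      unfolding Y_def vec.subspace_def using subspace_W
      by (auto simp: pairing_linear vec.subspace_0 vec.subspace_add vec.subspace_scale)
    have X_elem: "x \<in> X \<longleftrightarrow> (\<exists>c. x = (\<Sum>i<2 * p + 1. c i *s w i))" for x
      unfolding X by (subst span_family) auto
    have in_X: "(\<Sum>j\<le>p. \<alpha> j *s u j) + (\<Sum>l<p. \<beta> l *s y l) \<in> X" for \<alpha> \<beta>
    proof -
      define c where "c i = (if even i then \<alpha> (p - i div 2) else \<beta> (p - Suc (i div 2)))" for i
      have "(\<Sum>j\<le>p. c (2 * (p - j)) *s u j) = (\<Sum>j\<le>p. \<alpha> j *s u j)"
        by (intro sum.cong) (auto simp: c_def)
      moreover have "(\<Sum>l<p. c (2 * (p - Suc l) + 1) *s y l) = (\<Sum>l<p. \<beta> l *s y l)"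
        by (intro sum.cong) (auto simp: c_def)
      ultimately show ?thesis unfolding X_elem using comb[of c] by (intro exI[of _ c]) simp
    qed
    \<comment> \<open>The two recurrences reduce orthogonality to \<open>X\<close> to
      \<open>p + p + 1\<close> scalar conditions, as many as the dimension of
      \<open>X\<close>.\<close>
    have orthY: "v \<in> Y" if v: "v \<in> W" and vu: "\<And>i. i < p \<Longrightarrow> pairing A (u (Suc i)) v = 0"
      and vy: "\<And>l. l < p \<Longrightarrow> pairing A (y l) v = 0" and vy0: "pairing B (y 0) v = 0" for v
    proof -
      have Au: "pairing A (u i) v = 0" for i
      proof (cases i)
        case 0
        then show ?thesis using A_u_0 v by simp
      next
        case (Suc i')
        then show ?thesis using vu[of i'] u_support[of i] by (cases "i' < p") auto
      qed
      then have Bu: "pairing B (u i) v = 0" for i using B_u[OF v] by simp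
      have By: "pairing B (y l) v = 0" if "l < p" for l
        using that vy0 y_rec'[of "l - 1" v] v vy[of "l - 1"] by (cases l) auto
      have "pairing A x v = 0 \<and> pairing B x v = 0" if "x \<in> X" for x
      proof -
        obtain c where "x = (\<Sum>i<2 * p + 1. c i *s w i)" using \<open>x \<in> X\<close> unfolding X_elem by blast
        then show ?thesis unfolding comb by (simp add: pairing_linear Au Bu vy By)
      qed
      then show ?thesis using v by (simp add: Y_def)
    qed
    have "X \<inter> Y = {0}"
    proof (intro equalityI subsetI)
      fix x assume x: "x \<in> X \<inter> Y"
      obtain c where "x = (\<Sum>i<2 * p + 1. c i *s w i)" using x X_elem by blast
      then obtain \<alpha> \<beta> where xe: "x = (\<Sum>j\<le>p. \<alpha> j *s u j) + (\<Sum>l<p. \<beta> l *s y l)"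
        unfolding comb by (rule that)
      have uX: "u i \<in> X" if "i \<le> p" for i
      proof -
        have "w (2 * (p - i)) \<in> X" unfolding X using that by (intro vec.span_base) auto
        then show ?thesis using that by (simp only: w_even) simp
      qed
      have yX: "y l \<in> X" if "l < p" for l
      proof -
        have "w (2 * (p - Suc l) + 1) \<in> X" unfolding X using that by (intro vec.span_base) auto
        then show ?thesis using that by (simp only: w_odd) simp
      qed
      have "\<beta> i = 0" if "i < p" for i
        using pair_u[OF that, of \<alpha> \<beta>] x uX[of "Suc i"] that unfolding Y_def xe[symmetric] by auto
      then have xe': "x = (\<Sum>j\<le>p. \<alpha> j *s u j)" using xe by simp
      have "pairing A x (y l) = 0" "pairing B x (y l) = 0" if "l < p" for l
        using x yX[OF that] skewA[of x "y l"] skewB[of x "y l"] unfolding Y_def by auto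
      then have "\<alpha> (Suc l) = 0" "\<alpha> 0 = 0" if "l < p" for l using u_sum_y[OF that, of \<alpha>] p that xe' by auto
      then have "\<alpha> j = 0" if "j \<le> p" for j using that p by (cases j) auto
      then show "x \<in> {0}" using xe' by simp
    qed (use X_sub Y in \<open>auto simp: vec.subspace_0\<close>)
    moreover have "W = {x + y |x y. x \<in> X \<and> y \<in> Y}"
    proof (intro equalityI subsetI)
      fix v assume v: "v \<in> W"
      \<comment> \<open>The coordinates of the projection of \<open>v\<close>, read off by the
        pairings of \<open>u_sum_y\<close> and \<open>pair_u\<close>; the sign comes from the value
        of \<open>B\<close> on \<open>u 0\<close> and \<open>y 0\<close>.\<close>
      define \<alpha> where "\<alpha> j = (case j of 0 \<Rightarrow> - pairing B v (y 0) | Suc l \<Rightarrow> pairing A v (y l))" for j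
      define \<beta> where "\<beta> i = pairing A (u (Suc i)) v" for i
      define x where "x = (\<Sum>j\<le>p. \<alpha> j *s u j) + (\<Sum>l<p. \<beta> l *s y l)"
      have xX: "x \<in> X" unfolding x_def by (rule in_X)
      have "v - x \<in> Y"
      proof (rule orthY)
        show "v - x \<in> W" using v xX X_W by (intro vec.subspace_diff subspace_W) auto
        show "pairing A (u (Suc i)) (v - x) = 0" if "i < p" for i
          using pair_u[OF that, of \<alpha> \<beta>, folded x_def] by (simp add: pairing_diff_right \<beta>_def)
        show "pairing A (y l) (v - x) = 0" if "l < p" for l
        proof -
          have "pairing A x (y l) = pairing A v (y l)"
            unfolding x_def pairing_add_left using u_sum_y(1)[OF that] y_sum_y[OF that] by (simp add: \<alpha>_def)
          then show ?thesis using skewA[of "y l" "v - x"] by (simp add: pairing_diff_left)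
        qed
        have "pairing B x (y 0) = pairing B v (y 0)"
          unfolding x_def pairing_add_left using u_sum_y(2)[OF p] y_sum_y[OF p] by (simp add: \<alpha>_def)
        then show "pairing B (y 0) (v - x) = 0" using skewB[of "y 0" "v - x"] by (simp add: pairing_diff_left)
      qed
      then show "v \<in> {x + y |x y. x \<in> X \<and> y \<in> Y}"
        using xX by (intro CollectI exI[of _ x] exI[of _ "v - x"]) simp
    next
      fix v assume "v \<in> {x + y |x y. x \<in> X \<and> y \<in> Y}"
      then show "v \<in> W" using X_W by (auto simp: Y_def intro!: vec.subspace_add[OF subspace_W])
    qed
    moreover have "orthogonal_spaces A B X Y" by (rule orthogonal_spacesI) (auto simp: Y_def)
    ultimately show ?thesis using X_sub Y unfolding orthogonal_sum_def by blast
  qed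
qed

theorem splits_kronecker_block:
  "\<exists>X Y. kronecker_block A B (Suc p) X \<and> orthogonal_sum A B X Y W"
proof -
  obtain y where "\<forall>l<p. y l \<in> W"
    "\<forall>l. Suc l < p \<longrightarrow> (\<forall>v\<in>W. pairing A (y l) v + pairing B (y (Suc l)) v = 0)"
    "\<forall>i<p. \<forall>l<p. pairing A (u (Suc i)) (y l) = (if i = l then 1 else 0)"
    using dual_chain_exists by blast
  then show ?thesis using splits_kronecker_block_aux[of y] by blast
qed

end

section \<open>Decompositions into indecomposables and the chains in each summand\<close>

context skew_pencil
begin

lemma kronecker_block_dim:
  assumes "kronecker_block A B k X"
  shows "vec.subspace X" "vec.dim X = 2 * k - 1" "k \<ge> 1"
proof -
  obtain w where w: "inj_on w {..<2*k-1}" "vec.independent (w ` {..<2*k-1})" "vec.span (w ` {..<2*k-1}) = X"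
    using assms unfolding kronecker_block_def by blast
  show "vec.subspace X" using w(3) vec.subspace_span by metis
  show "vec.dim X = 2 * k - 1"
    unfolding w(3)[symmetric] vec.dim_span_eq_card_independent[OF w(2)] using card_image[OF w(1)] by simp
  show "k \<ge> 1" using assms by (simp add: kronecker_block_def)
qed

text \<open>The block that splits off has a zero complement in an indecomposable space.
  Contrapositively, a summand that is not a Kronecker block carries only the zero chain.\<close>

lemma chain_in_indecomposable:
  assumes W: "indecomposable A B W" and h: "chain A B W h" "h i \<noteq> 0"
  shows "\<exists>k. kronecker_block A B k W"
proof -
  have sub: "vec.subspace W" using W by (simp add: indecomposable_def)
  obtain u where u: "chain A B W u" "\<exists>i. u i \<noteq> 0" "\<forall>i\<ge>CARD('n). u i = 0"
    using infinite_chain_imp_finite_chain[OF sub h] by blast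
  then obtain i0 where "u i0 \<noteq> 0" by blast
  from minimal_chain_exists[OF sub u(1) this] u(3) obtain p v where "minimal_chain A B W p v" by blast
  then interpret minimal_chain A B W p v .
  obtain X Y where XY: "kronecker_block A B (Suc p) X" "orthogonal_sum A B X Y W"
    using splits_kronecker_block by blast
  have "vec.dim X = 2 * p + 1" using kronecker_block_dim[OF XY(1)] by simp
  then have "X \<noteq> {0}" by auto
  then have "Y = {0}"
    using W XY(2) unfolding indecomposable_def orthogonal_sum_def by blast
  then have "W = X" using XY(2) unfolding orthogonal_sum_def by auto
  then show ?thesis using XY by blast
qed

lemma decomposition_exists:
  "vec.subspace W \<Longrightarrow> \<exists>Ws. orthogonal_sum_list A B W Ws \<and> (\<forall>X\<in>set Ws. indecomposable A B X)"
proof (induction "vec.dim W" arbitrary: W rule: less_induct)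
  case less
  consider "W = {0}" | "indecomposable A B W" | X Y where "vec.subspace X" "vec.subspace Y" "X \<noteq> {0}" "Y \<noteq> {0}"
    "X \<inter> Y = {0}" "W = {x + y |x y. x \<in> X \<and> y \<in> Y}" "orthogonal_spaces A B X Y"
    using less.prems unfolding indecomposable_def by blast
  then show ?case
  proof cases
    case 1
    then show ?thesis by (intro exI[of _ "[]"]) simp
  next
    case 2
    have "orthogonal_sum A B W {0} W" using less.prems
      by (auto simp: orthogonal_sum_def orthogonal_spaces_def vec.subspace_0)
    then show ?thesis using 2 by (intro exI[of _ "[W]"]) auto
  next
    case (3 X Y)
    have dim: "vec.dim W = vec.dim X + vec.dim Y" using dim_sum_direct[OF 3(1,2,5)] 3(6) by simp
    have "vec.dim X \<noteq> 0" "vec.dim Y \<noteq> 0"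
      using 3(1-4) vec.subspace_0 by (auto simp: vec.dim_eq_0)
    then have "vec.dim X < vec.dim W" "vec.dim Y < vec.dim W" using dim by auto
    from less.hyps[OF this(1) 3(1)] less.hyps[OF this(2) 3(2)]
    obtain Xs Ys where XY: "orthogonal_sum_list A B X Xs" "\<forall>X\<in>set Xs. indecomposable A B X"
      "orthogonal_sum_list A B Y Ys" "\<forall>X\<in>set Ys. indecomposable A B X" by blast
    have "orthogonal_sum A B X Y W" using 3 unfolding orthogonal_sum_def by blast
    from orthogonal_sum_list_append[OF this XY(1,3)] show ?thesis using XY
      by (intro exI[of _ "Xs @ Ys"]) auto
  qed
qed

lemma chain_add:
  assumes s: "orthogonal_sum A B X Y W" and f: "chain A B X f" and g: "chain A B Y g"
  shows "chain A B W (\<lambda>i. f i + g i)"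
proof -
  have W: "W = {x + y |x y. x \<in> X \<and> y \<in> Y}" and o: "orthogonal_spaces A B X Y"
    using s unfolding orthogonal_sum_def by blast+
  have fg: "f i \<in> X" "g i \<in> Y" for i using f g by (auto simp: chain_def)
  have o': "pairing A (f i) y = 0" "pairing B (f i) y = 0" "pairing A (g i) x = 0" "pairing B (g i) x = 0"
    if "x \<in> X" "y \<in> Y" for i x y
    using o fg that unfolding orthogonal_spaces_def by blast+
  show ?thesis
    unfolding chain_def
  proof (intro conjI allI ballI)
    show "f i + g i \<in> W" for i unfolding W using fg by blast
  next
    fix v assume "v \<in> W"
    then obtain x y where "v = x + y" "x \<in> X" "y \<in> Y" unfolding W by blast
    then show "pairing A (f 0 + g 0) v = 0"
      using f g o' by (simp add: pairing_linear chain_def)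
  next
    fix i v assume "v \<in> W"
    then obtain x y where v: "v = x + y" "x \<in> X" "y \<in> Y" unfolding W by blast
    have "pairing A (f (Suc i)) x + pairing B (f i) x = 0" "pairing A (g (Suc i)) y + pairing B (g i) y = 0"
      using f g v unfolding chain_def by blast+
    then show "pairing A (f (Suc i) + g (Suc i)) v + pairing B (f i + g i) v = 0"
      using o'[OF v(2,3)] unfolding v(1) pairing_add_left pairing_add_right
      by (simp add: eq_neg_iff_add_eq_0[symmetric])
  qed
qed

text \<open>Test vectors in one summand see only the component there, so both components are chains.
  The last clause says that supports do not grow; it makes the splitting compatible with bounds on
  the degree.\<close>

lemma chain_split:
  assumes s: "orthogonal_sum A B X Y W" and h: "chain A B W h"
  obtains f g where "chain A B X f" "chain A B Y g" "\<And>i. h i = f i + g i" "\<And>i. h i = 0 \<Longrightarrow> f i = 0 \<and> g i = 0"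
proof -
  have W: "W = {x + y |x y. x \<in> X \<and> y \<in> Y}" and o: "orthogonal_spaces A B X Y"
    and sub: "vec.subspace X" "vec.subspace Y" and XY: "X \<inter> Y = {0}"
    using s unfolding orthogonal_sum_def by blast+
  note WX = orthogonal_sum_subset[OF s]
  have hW: "h i \<in> W" for i using h by (simp add: chain_def)
  have "\<exists>x y. x \<in> X \<and> y \<in> Y \<and> h i = x + y" for i using hW[of i] unfolding W by blast
  then obtain f g where fg: "\<And>i. f i \<in> X" "\<And>i. g i \<in> Y" "\<And>i. h i = f i + g i" by metis
  have o': "pairing A (f i) y = 0" "pairing B (f i) y = 0" "pairing A (g i) x = 0" "pairing B (g i) x = 0"
    if "x \<in> X" "y \<in> Y" for i x y
    using o fg that unfolding orthogonal_spaces_def by blast+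
  have y0: "0 \<in> X" "0 \<in> Y" using sub vec.subspace_0 by auto
  have hA: "v \<in> W \<Longrightarrow> pairing A (h 0) v = 0" and hB: "v \<in> W \<Longrightarrow> pairing A (h (Suc i)) v + pairing B (h i) v = 0" for v i
    using h unfolding chain_def by blast+
  have "chain A B X f"
    unfolding chain_def
  proof (intro conjI allI ballI fg)
    fix v assume v: "v \<in> X"
    then have vW: "v \<in> W" using WX by blast
    show "pairing A (f 0) v = 0" using hA[OF vW] fg(3)[of 0] o'[OF v y0(2)] by (simp add: pairing_linear)
    show "pairing A (f (Suc i)) v + pairing B (f i) v = 0" for i
      using hB[OF vW, of i] fg(3) o'[OF v y0(2)] by (simp add: pairing_linear)
  qed
  moreover have "chain A B Y g"
    unfolding chain_def
  proof (intro conjI allI ballI fg)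
    fix v assume v: "v \<in> Y"
    then have vW: "v \<in> W" using WX by blast
    show "pairing A (g 0) v = 0" using hA[OF vW] fg(3)[of 0] o'[OF y0(1) v] by (simp add: pairing_linear)
    show "pairing A (g (Suc i)) v + pairing B (g i) v = 0" for i
      using hB[OF vW, of i] fg(3) o'[OF y0(1) v] by (simp add: pairing_linear)
  qed
  moreover have "f i = 0 \<and> g i = 0" if "h i = 0" for i
  proof -
    have "f i = - g i" using that fg(3)[of i] by (simp add: eq_neg_iff_add_eq_0)
    then have "f i \<in> X \<inter> Y" using fg(1)[of i] vec.subspace_neg[OF sub(2) fg(2)[of i]] by simp
    then have "f i = 0" unfolding XY by simp
    then show ?thesis using \<open>f i = - g i\<close> by simp
  qed
  ultimately show thesis using fg(3) that by blast
qed

text \<open>Chains in a Kronecker block are the convolutions of the basic chain \<open>w\<^sub>2\<^sub>k\<^sub>-\<^sub>2, \<dots>, w\<^sub>2, w\<^sub>0\<close>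
  with scalar sequences.\<close>
lemma kronecker_block_chains:
  assumes X: "kronecker_block A B k X"
  obtains u where "\<And>c j. (\<Sum>j<k. c j *s u j) = 0 \<Longrightarrow> j < k \<Longrightarrow> c j = 0"
    "\<And>h. chain A B X h \<longleftrightarrow> (\<exists>t. \<forall>i. h i = (\<Sum>j<k. (if j \<le> i then t (i - j) else 0) *s u j))"
proof -
  obtain w where w: "inj_on w {..<2*k-1}" "vec.independent (w ` {..<2*k-1})" "vec.span (w ` {..<2*k-1}) = X"
    and gram: "\<And>i j. i < 2*k-1 \<Longrightarrow> j < 2*k-1 \<Longrightarrow> pairing A (w i) (w j) = kronecker_pairing1 i j \<and>
                                 pairing B (w i) (w j) = kronecker_pairing2 i j" and k: "k \<ge> 1"
    using X unfolding kronecker_block_def by blast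
  obtain p where p: "k = Suc p" using k by (cases k) auto
  have k2: "2 * k - 1 = 2 * p + 1" using p by simp
  note w = w[unfolded k2] and gram = gram[unfolded k2]
  have subX: "vec.subspace X" using w(3) vec.subspace_span by metis
  have windep: "c i = 0" if "(\<Sum>i<2 * p + 1. c i *s w i) = 0" "i < 2 * p + 1" for c i
    using independent_family_iff[of "{..<2 * p + 1}" w] w that by auto
  have wX: "w i \<in> X" if "i < 2 * p + 1" for i
    unfolding w(3)[symmetric] using that by (intro vec.span_base) simp
  have X_elem: "\<exists>d. x = (\<Sum>m<2 * p + 1. d m *s w m)" if "x \<in> X" for x
    using that span_family[of "{..<2 * p + 1}" w] w(3) by auto
  \<comment> \<open>Descending indices, because \<open>w (2 * p)\<close> lies in the kernel of
    \<open>A\<close> on the block and \<open>w 0\<close> in the kernel of \<open>B\<close>.\<close>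
  define u where "u j = w (2 * (p - j))" for j
  have kr: "kronecker_pairing1 m (2 * b + 1) = (if m = 2 * b then 1 else 0)"
    "kronecker_pairing1 m (2 * b) = (if m = 2 * b + 1 then - 1 else 0)"
    "kronecker_pairing2 m (2 * b + 1) = (if m = 2 * b + 2 then - 1 else 0)"
    "kronecker_pairing2 m (2 * b) = (if m + 1 = 2 * b then 1 else 0)" for m b
    unfolding kronecker_pairing1_def kronecker_pairing2_def by (auto; presburger)+
  have coord: "pairing A (\<Sum>m<2 * p + 1. d m *s w m) (w (2 * b + 1)) = d (2 * b)"
    "pairing A (\<Sum>m<2 * p + 1. d m *s w m) (w (2 * b)) = - d (2 * b + 1)"
    "pairing B (\<Sum>m<2 * p + 1. d m *s w m) (w (2 * b + 1)) = - d (2 * b + 2)"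
    "pairing B (\<Sum>m<2 * p + 1. d m *s w m) (w (2 * b)) = (if b = 0 then 0 else d (2 * b - 1))"
    if "b < p" for d b
  proof -
    have P: "pairing A (\<Sum>m<2 * p + 1. d m *s w m) (w n) = (\<Sum>m<2 * p + 1. d m * kronecker_pairing1 m n)"
      "pairing B (\<Sum>m<2 * p + 1. d m *s w m) (w n) = (\<Sum>m<2 * p + 1. d m * kronecker_pairing2 m n)"
      if "n < 2 * p + 1" for n
      unfolding pairing_linear using gram that by (auto intro!: sum.cong)
    have n: "2 * b + 1 < 2 * p + 1" "2 * b < 2 * p + 1" "2 * b + 2 < 2 * p + 1" using that by auto
    show "pairing A (\<Sum>m<2 * p + 1. d m *s w m) (w (2 * b + 1)) = d (2 * b)"
      unfolding P[OF n(1)] kr using n by (simp add: if_distrib sum.delta cong: if_cong)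
    show "pairing A (\<Sum>m<2 * p + 1. d m *s w m) (w (2 * b)) = - d (2 * b + 1)"
      unfolding P[OF n(2)] kr using n by (simp add: if_distrib sum.delta cong: if_cong)
    show "pairing B (\<Sum>m<2 * p + 1. d m *s w m) (w (2 * b + 1)) = - d (2 * b + 2)"
      unfolding P[OF n(1)] kr using n by (simp add: if_distrib sum.delta cong: if_cong)
    show "pairing B (\<Sum>m<2 * p + 1. d m *s w m) (w (2 * b)) = (if b = 0 then 0 else d (2 * b - 1))"
    proof (cases b)
      case 0
      then show ?thesis unfolding P[OF n(2)] kr by simp
    next
      case (Suc b')
      have "(\<Sum>m<2 * p + 1. d m * (if m + 1 = 2 * b then 1 else 0)) = (\<Sum>m<2 * p + 1. if m = 2 * b - 1 then d m else 0)"
        using Suc by (intro sum.cong) auto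
      then show ?thesis unfolding P[OF n(2)] kr using n Suc by (simp add: sum.delta)
    qed
  qed
  have last: "pairing A (\<Sum>m<2 * p + 1. d m *s w m) (w (2 * p)) = 0" for d
  proof -
    have "pairing A (\<Sum>m<2 * p + 1. d m *s w m) (w (2 * p)) = (\<Sum>m<2 * p + 1. d m * kronecker_pairing1 m (2 * p))"
      unfolding pairing_linear using gram by (auto intro!: sum.cong)
    also have "\<dots> = 0" unfolding kr by (intro sum.neutral) auto
    finally show ?thesis .
  qed
  have u_indep: "c j = 0" if c: "(\<Sum>j<k. c j *s u j) = 0" and j: "j < k" for c j
  proof -
    define d where "d m = (if even m then c (p - m div 2) else 0)" for m
    have "(\<Sum>m<2 * p + 1. d m *s w m) = (\<Sum>a\<le>p. c (p - a) *s w (2 * a))"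
      unfolding sum_even_odd by (simp add: d_def)
    also have "\<dots> = (\<Sum>j\<le>p. c j *s u j)"
      by (rule sum.reindex_bij_witness[of _ "\<lambda>j. p - j" "\<lambda>j. p - j"]) (auto simp: u_def)
    also have "\<dots> = 0" using c by (simp add: p lessThan_Suc_atMost)
    finally have "d (2 * (p - j)) = 0" by (rule windep) (use j p in auto)
    then show ?thesis using j p by (simp add: d_def)
  qed
  have A_u: "pairing A (u 0) v = 0" "pairing A (u (Suc j)) v + pairing B (u j) v = 0" "pairing B (u p) v = 0"
    if v: "v \<in> X" and j: "j < p" for v j
  proof -
    obtain d where d: "v = (\<Sum>m<2 * p + 1. d m *s w m)" using X_elem[OF v] by blast
    show "pairing A (u 0) v = 0" using last[of d] skewA[of v "u 0"] by (simp add: u_def d)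
    define b where "b = p - Suc j"
    have b: "b < p" "p - j = b + 1" using j by (auto simp: b_def)
    have 1: "pairing A v (u (Suc j)) = - d (2 * b + 1)" using coord(2)[OF b(1), of d] by (simp add: d u_def b_def)
    have "pairing B v (u j) = d (2 * b + 1)"
    proof (cases "b + 1 = p")
      case False
      then show ?thesis using coord(4)[of "b + 1" d] b by (simp add: d u_def)
    next
      case True
      have "pairing B v (u j) = (\<Sum>m<2 * p + 1. d m * kronecker_pairing2 m (2 * p))"
        unfolding d u_def b(2) True pairing_linear using gram by (auto intro!: sum.cong)
      also have "\<dots> = (\<Sum>m<2 * p + 1. if m = 2 * b + 1 then d m else 0)"
        unfolding kr using True by (intro sum.cong) auto
      finally show ?thesis using b by (simp add: sum.delta)
    qed
    then show "pairing A (u (Suc j)) v + pairing B (u j) v = 0"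
      using 1 skewA[of "u (Suc j)" v] skewB[of "u j" v] by simp
    show "pairing B (u p) v = 0" using coord(4)[of 0 d] j skewB[of "u p" v] by (simp add: u_def d)
  qed
  have A_u0: "pairing A (u 0) v = 0" and B_up: "pairing B (u p) v = 0" if v: "v \<in> X" for v
  proof -
    obtain d where d: "v = (\<Sum>m<2 * p + 1. d m *s w m)" using X_elem[OF v] by blast
    show "pairing A (u 0) v = 0" using last[of d] skewA[of v "u 0"] by (simp add: u_def d)
    show "pairing B (u p) v = 0"
    proof (cases "p = 0")
      case True
      then have "pairing B v (u p) = d 0 * kronecker_pairing2 0 0" using gram[of 0 0]
        by (simp add: d u_def pairing_linear lessThan_Suc)
      then show ?thesis using skewB[of "u p" v] by (simp add: kronecker_pairing2_def)
    next
      case False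
      then show ?thesis using A_u(3)[OF v, of 0] by simp
    qed
  qed
  have uX: "u j \<in> X" if "j < k" for j unfolding u_def using that p by (intro wX) auto
  have "chain A B X h \<longleftrightarrow> (\<exists>t. \<forall>i. h i = (\<Sum>j<k. (if j \<le> i then t (i - j) else 0) *s u j))" for h
  proof
    assume h: "chain A B X h"
    have "\<forall>i. \<exists>d. h i = (\<Sum>m<2 * p + 1. d m *s w m)" using h X_elem by (simp add: chain_def)
    then obtain d where d: "\<And>i. h i = (\<Sum>m<2 * p + 1. d i m *s w m)" by metis
    have h0: "pairing A (h 0) (w n) = 0" if "n < 2 * p + 1" for n
      using h wX[OF that] by (simp add: chain_def)
    have hS: "pairing A (h (Suc i)) (w n) + pairing B (h i) (w n) = 0" if "n < 2 * p + 1" for i n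
      using h wX[OF that] by (simp add: chain_def)
    \<comment> \<open>Testing on \<open>w (2 * b)\<close> expresses the odd coordinate at
      \<open>2 * b + 1\<close> by the one at \<open>2 * b - 1\<close> of the preceding term, and
      there is none below \<open>b = 0\<close>.\<close>
    have odd: "b < p \<Longrightarrow> d i (2 * b + 1) = 0" for i b
    proof (induction i arbitrary: b)
      case 0
      then show ?case using h0[of "2 * b"] coord(2)[of b "d 0"] by (simp add: d)
    next
      case (Suc i)
      have "d (Suc i) (2 * b + 1) = (if b = 0 then 0 else d i (2 * b - 1))"
        using hS[of "2 * b" i] coord(2)[of b "d (Suc i)"] coord(4)[of b "d i"] Suc.prems by (simp add: d)
      also have "\<dots> = 0" using Suc.IH[of "b - 1"] Suc.prems by (cases b) auto
      finally show ?case .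
    qed
    have even0: "d 0 (2 * b) = 0" if "b < p" for b
      using h0[of "2 * b + 1"] coord(1)[of b "d 0"] that by (simp add: d)
    have evenS: "d (Suc i) (2 * b) = d i (2 * b + 2)" if "b < p" for i b
      using hS[of "2 * b + 1" i] coord(1)[of b "d (Suc i)"] coord(3)[of b "d i"] that by (simp add: d)
    \<comment> \<open>The coordinate along \<open>w (2 * p)\<close> is the only free one: every
      lower even coordinate equals the next higher even coordinate of the preceding term.\<close>
    define t where "t l = d l (2 * p)" for l
    have c: "j \<le> p \<Longrightarrow> d i (2 * (p - j)) = (if j \<le> i then t (i - j) else 0)" for i j
    proof (induction j arbitrary: i)
      case 0
      then show ?case by (simp add: t_def)
    next
      case (Suc j)
      have e: "2 * (p - j) = 2 * (p - Suc j) + 2" using Suc.prems by simp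
      show ?case
      proof (cases i)
        case 0
        then show ?thesis using even0[of "p - Suc j"] Suc.prems by simp
      next
        case (Suc i')
        then show ?thesis using evenS[of "p - Suc j" i'] Suc.IH[of i'] Suc.prems unfolding e by simp
      qed
    qed
    have "h i = (\<Sum>j<k. (if j \<le> i then t (i - j) else 0) *s u j)" for i
    proof -
      have "h i = (\<Sum>a\<le>p. d i (2 * a) *s w (2 * a))"
        unfolding d sum_even_odd using odd by simp
      also have "\<dots> = (\<Sum>j\<le>p. d i (2 * (p - j)) *s u j)"
        by (rule sum.reindex_bij_witness[of _ "\<lambda>j. p - j" "\<lambda>j. p - j"]) (auto simp: u_def)
      also have "\<dots> = (\<Sum>j<k. (if j \<le> i then t (i - j) else 0) *s u j)"
        unfolding p lessThan_Suc_atMost by (intro sum.cong) (auto simp: c)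
      finally show ?thesis .
    qed
    then show "\<exists>t. \<forall>i. h i = (\<Sum>j<k. (if j \<le> i then t (i - j) else 0) *s u j)" by blast
  next
    assume "\<exists>t. \<forall>i. h i = (\<Sum>j<k. (if j \<le> i then t (i - j) else 0) *s u j)"
    then obtain t where h: "\<And>i. h i = (\<Sum>j<k. (if j \<le> i then t (i - j) else 0) *s u j)" by blast
    show "chain A B X h"
      unfolding chain_def
    proof (intro conjI allI ballI)
      show "h i \<in> X" for i unfolding h
        by (intro vec.subspace_sum[OF subX] vec.subspace_scale[OF subX] uX) auto
    next
      fix v assume v: "v \<in> X"
      show "pairing A (h 0) v = 0"
        unfolding h pairing_linear using A_u0[OF v] by (intro sum.neutral) auto
    next
      fix i v assume v: "v \<in> X"
      have "pairing A (h (Suc i)) v = (\<Sum>j\<le>p. (if j \<le> Suc i then t (Suc i - j) else 0) * pairing A (u j) v)"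
        unfolding h pairing_linear p lessThan_Suc_atMost ..
      also have "\<dots> = (\<Sum>j<p. (if j \<le> i then t (i - j) else 0) * pairing A (u (Suc j)) v)"
        by (auto simp: sum.atMost_shift A_u0[OF v] intro!: sum.cong)
      also have "\<dots> = - (\<Sum>j<p. (if j \<le> i then t (i - j) else 0) * pairing B (u j) v)"
        unfolding sum_negf[symmetric]
      proof (rule sum.cong)
        fix j assume "j \<in> {..<p}"
        then have "pairing A (u (Suc j)) v = - pairing B (u j) v"
          using A_u(2)[OF v] by (simp add: eq_neg_iff_add_eq_0)
        then show "(if j \<le> i then t (i - j) else 0) * pairing A (u (Suc j)) v = - ((if j \<le> i then t (i - j) else 0) * pairing B (u j) v)"
          by simp
      qed simp
      also have "(\<Sum>j<p. (if j \<le> i then t (i - j) else 0) * pairing B (u j) v) = pairing B (h i) v"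
        unfolding h pairing_linear p by (simp add: B_up[OF v])
      finally show "pairing A (h (Suc i)) v + pairing B (h i) v = 0" by simp
    qed
  qed
  then show thesis using that[of u] u_indep by blast
qed

text \<open>In a direct sum of Kronecker blocks of dimensions \<open>2k\<^sub>i - 1\<close> the chains fill a space of
  dimension \<open>\<Sum>k\<^sub>i\<close>; other indecomposable summands contribute nothing.\<close>
lemma chain_space_bound:
  assumes "orthogonal_sum_list A B W Ws" "\<forall>X\<in>set Ws. indecomposable A B X"
  shows "\<exists>L. vec.subspace L \<and> L \<subseteq> W \<and> (\<forall>h i. chain A B W h \<longrightarrow> h i \<in> L) \<and>
           2 * vec.dim L + length (filter (\<lambda>X. \<not> (\<exists>k. kronecker_block A B k X)) Ws)
             \<le> vec.dim W + length (filter (\<lambda>X. \<exists>k. kronecker_block A B k X) Ws)"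
  using assms
proof (induction Ws arbitrary: W)
  case Nil
  then show ?case by (intro exI[of _ "{0}"]) (auto simp: chain_def)
next
  case (Cons X Ws)
  obtain Y where Y: "orthogonal_sum A B X Y W" "orthogonal_sum_list A B Y Ws" using Cons.prems(1) by auto
  have sub: "vec.subspace X" "vec.subspace Y" and XY: "X \<inter> Y = {0}" and W: "W = {x + y |x y. x \<in> X \<and> y \<in> Y}"
    using Y(1) unfolding orthogonal_sum_def by blast+
  have dimW: "vec.dim W = vec.dim X + vec.dim Y" unfolding W by (rule dim_sum_direct[OF sub XY])
  obtain L where L: "vec.subspace L" "L \<subseteq> Y" "\<And>h i. chain A B Y h \<Longrightarrow> h i \<in> L"
    "2 * vec.dim L + length (filter (\<lambda>X. \<not> (\<exists>k. kronecker_block A B k X)) Ws)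
             \<le> vec.dim Y + length (filter (\<lambda>X. \<exists>k. kronecker_block A B k X) Ws)"
    using Cons.IH[OF Y(2)] Cons.prems(2) by auto
  have X: "indecomposable A B X" using Cons.prems(2) by simp
  \<comment> \<open>The balance for one summand. A Kronecker block satisfies
    \<open>2 * k \<le> (2 * k - 1) + 1\<close>; any other summand has only the zero chain but
    dimension at least 1, and this loss is recorded on the left.\<close>
  have "\<exists>M. vec.subspace M \<and> M \<subseteq> X \<and> (\<forall>h i. chain A B X h \<longrightarrow> h i \<in> M) \<and>
      2 * vec.dim M + (if \<exists>k. kronecker_block A B k X then 0 else 1) \<le> vec.dim X + (if \<exists>k. kronecker_block A B k X then 1 else 0)"
  proof (cases "\<exists>k. kronecker_block A B k X")
    case True
    then obtain k where k: "kronecker_block A B k X" by blast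
    obtain u where u: "\<And>c j. (\<Sum>j<k. c j *s u j) = 0 \<Longrightarrow> j < k \<Longrightarrow> c j = 0"
      "\<And>h. chain A B X h \<longleftrightarrow> (\<exists>t. \<forall>i. h i = (\<Sum>j<k. (if j \<le> i then t (i - j) else 0) *s u j))"
      using kronecker_block_chains[OF k] by blast
    define M where "M = vec.span (u ` {..<k})"
    \<comment> \<open>Convolution with the unit sequence gives \<open>u\<close> itself, which shows
      that each \<open>u j\<close> with \<open>j < k\<close> lies in \<open>X\<close>.\<close>
    have "chain A B X (\<lambda>i. \<Sum>j<k. (if j \<le> i then (if i - j = 0 then 1 else 0) else 0) *s u j)"
      unfolding u(2) by (intro exI[of _ "\<lambda>l. if l = 0 then 1 else 0"]) simp
    then have mem: "(\<Sum>j<k. (if j \<le> i then (if i - j = 0 then 1 else 0) else 0) *s u j) \<in> X" for i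
      unfolding chain_def by blast
    have "(\<Sum>j<k. (if j \<le> i then (if i - j = 0 then 1 else 0) else 0) *s u j) = u i" if "i < k" for i
    proof -
      have "(\<Sum>j<k. (if j \<le> i then (if i - j = 0 then 1 else 0) else 0) *s u j) = (\<Sum>j\<in>{i}. 1 *s u j)"
        using that by (intro sum.mono_neutral_cong_right) auto
      then show ?thesis by simp
    qed
    then have "u i \<in> X" if "i < k" for i using mem[of i] that by simp
    then have "M \<subseteq> X" unfolding M_def by (intro vec.span_minimal sub) auto
    moreover have "h i \<in> M" if "chain A B X h" for h i
    proof -
      obtain t where "\<forall>i. h i = (\<Sum>j<k. (if j \<le> i then t (i - j) else 0) *s u j)"
        using \<open>chain A B X h\<close> u(2)[of h] by blast
      then show ?thesis unfolding M_def
        by (auto intro!: vec.span_sum vec.span_scale[OF vec.span_base])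
    qed
    moreover have "vec.dim M \<le> k"
      unfolding M_def vec.dim_span using vec.dim_le_card'[of "u ` {..<k}"] card_image_le[of "{..<k}" u] by simp
    ultimately show ?thesis using kronecker_block_dim[OF k] True
      by (intro exI[of _ M]) (auto simp: M_def)
  next
    case False
    then have "h i = 0" if "chain A B X h" for h i using chain_in_indecomposable[OF X that] by blast
    moreover have "1 \<le> vec.dim X"
    proof -
      have "vec.dim X \<noteq> 0"
        unfolding vec.dim_eq_0 using X vec.subspace_0[OF sub(1)] by (auto simp: indecomposable_def)
      then show ?thesis by linarith
    qed
    ultimately show ?thesis using False vec.subspace_0[OF sub(1)] by (intro exI[of _ "{0}"]) simp
  qed
  then obtain M where M: "vec.subspace M" "M \<subseteq> X" "\<And>h i. chain A B X h \<Longrightarrow> h i \<in> M"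
    "2 * vec.dim M + (if \<exists>k. kronecker_block A B k X then 0 else 1) \<le> vec.dim X + (if \<exists>k. kronecker_block A B k X then 1 else 0)"
    by blast
  define N where "N = {x + y |x y. x \<in> M \<and> y \<in> L}"
  have "M \<inter> L = {0}"
    using Int_mono[OF M(2) L(2)] vec.subspace_0[OF M(1)] vec.subspace_0[OF L(1)] unfolding XY by auto
  then have dimN: "vec.dim N = vec.dim M + vec.dim L" unfolding N_def by (rule dim_sum_direct[OF M(1) L(1)])
  have "h i \<in> N" if h: "chain A B W h" for h i
  proof -
    obtain f g where "chain A B X f" "chain A B Y g" "h i = f i + g i" using chain_split[OF Y(1) h] by metis
    then show ?thesis using M(3) L(3) unfolding N_def by blast
  qed
  moreover have "N \<subseteq> W" unfolding N_def W using M L by blast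
  moreover have "vec.subspace N" unfolding N_def by (rule vec.subspace_sums[OF M(1) L(1)])
  moreover have "2 * vec.dim N + length (filter (\<lambda>X. \<not> (\<exists>k. kronecker_block A B k X)) (X # Ws))
             \<le> vec.dim W + length (filter (\<lambda>X. \<exists>k. kronecker_block A B k X) (X # Ws))"
    using M(4) L(4) dimN dimW by (auto split: if_splits)
  ultimately show ?case by blast
qed

end

subsection \<open>The spaces of polynomial solutions\<close>

text \<open>An arbitrary numbering of the index type. It lets the first component of an index in
  \<open>'n \<times> 'n\<close> play the role of the degree of a coefficient.\<close>

definition idx :: "'n::finite \<Rightarrow> nat" where
  "idx = (SOME f. bij_betw f UNIV {..<CARD('n)})"

lemma bij_idx: "bij_betw (idx :: 'n::finite \<Rightarrow> nat) UNIV {..<CARD('n)}"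
proof -
  have "\<exists>f :: 'n \<Rightarrow> nat. bij_betw f UNIV {..<CARD('n)}"
    using ex_bij_betw_finite_nat[of "UNIV :: 'n set"] by (auto simp: atLeast0LessThan)
  then show ?thesis unfolding idx_def by (rule someI_ex)
qed

text \<open>Vectors of \<open>complex^('n \<times> 'n)\<close> encode the sequences in \<open>complex^'n\<close> of length \<open>CARD('n)\<close>.\<close>

definition coeff_seq :: "complex^('n::finite \<times> 'n) \<Rightarrow> nat \<Rightarrow> complex^'n" where
  "coeff_seq x i = (if i < CARD('n) then (\<chi> j. x $ (inv idx i, j)) else 0)"

definition of_coeff_seq :: "(nat \<Rightarrow> complex^'n) \<Rightarrow> complex^('n::finite \<times> 'n)" where
  "of_coeff_seq h = (\<chi> p. h (idx (fst p)) $ snd p)"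

lemma coeff_seq_of_coeff_seq:
  fixes h :: "nat \<Rightarrow> complex^'n::finite"
  assumes "\<And>i. CARD('n) \<le> i \<Longrightarrow> h i = 0"
  shows "coeff_seq (of_coeff_seq h) = h"
proof
  fix i
  have "idx (inv (idx :: 'n \<Rightarrow> nat) i) = i" if "i < CARD('n)"
    using bij_betw_inv_into_right[OF bij_idx, of i] that by simp
  then show "coeff_seq (of_coeff_seq h) i = h i"
    using assms[of i] by (auto simp: coeff_seq_def of_coeff_seq_def vec_eq_iff)
qed

lemma of_coeff_seq_coeff_seq: "of_coeff_seq (coeff_seq x) = (x :: complex^('n::finite \<times> 'n))"
proof -
  have "idx a < CARD('n)" "inv idx (idx a) = a" for a :: 'n
    using bij_idx bij_betw_apply[OF bij_idx, of a] bij_betw_inv_into_left[OF bij_idx, of a] by auto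
  then show ?thesis by (simp add: coeff_seq_def of_coeff_seq_def vec_eq_iff split_def)
qed

lemma coeff_seq_add: "coeff_seq (x + y) i = coeff_seq x i + coeff_seq y i"
  by (simp add: coeff_seq_def vec_eq_iff)

lemma coeff_seq_scale: "coeff_seq (c *s x) i = c *s coeff_seq x i"
  by (simp add: coeff_seq_def vec_eq_iff)

lemma coeff_seq_0 [simp]: "coeff_seq 0 i = 0"
  by (simp add: coeff_seq_def vec_eq_iff)

lemma coeff_seq_sum: "coeff_seq (\<Sum>l\<in>L. f l) i = (\<Sum>l\<in>L. coeff_seq (f l) i)"
  by (induction L rule: infinite_finite_induct) (simp_all add: coeff_seq_add)

lemma coeff_seq_eqI: "(\<And>i. coeff_seq x i = coeff_seq y i) \<Longrightarrow> x = y"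
  by (metis of_coeff_seq_coeff_seq ext)

text \<open>Polynomial solutions of degree below \<open>q\<close>, encoded as vectors so that they
  have a dimension. The cutoff at \<open>CARD('n)\<close> is harmless for the type: a block of
  dimension \<open>2 * k - 1\<close> in the whole space has \<open>k \<le> CARD('n)\<close>.\<close>

definition finite_chains ::
    "complex^'n^'n \<Rightarrow> complex^'n^'n \<Rightarrow> (complex^'n) set \<Rightarrow> nat \<Rightarrow> (complex^('n::finite \<times> 'n)) set" where
  "finite_chains A B W q = {x. chain A B W (coeff_seq x) \<and> (\<forall>i\<ge>q. coeff_seq x i = 0)}"

lemma subspace_finite_chains:
  assumes "vec.subspace W" shows "vec.subspace (finite_chains A B W q)"
  unfolding vec.subspace_def
proof (intro conjI ballI allI)
  show "0 \<in> finite_chains A B W q" using vec.subspace_0[OF assms] by (simp add: finite_chains_def chain_def)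
next
  fix x y assume xy: "x \<in> finite_chains A B W q" "y \<in> finite_chains A B W q"
  have "pairing A (coeff_seq x (Suc i) + coeff_seq y (Suc i)) v + pairing B (coeff_seq x i + coeff_seq y i) v = 0"
    if "v \<in> W" for i v
  proof -
    have "pairing A (coeff_seq x (Suc i)) v + pairing B (coeff_seq x i) v = 0"
      "pairing A (coeff_seq y (Suc i)) v + pairing B (coeff_seq y i) v = 0"
      using xy that unfolding finite_chains_def chain_def by blast+
    then show ?thesis by (simp add: pairing_add_left eq_neg_iff_add_eq_0[symmetric])
  qed
  then show "x + y \<in> finite_chains A B W q"
    using xy vec.subspace_add[OF assms] by (simp add: finite_chains_def chain_def coeff_seq_add pairing_linear)
next
  fix c x assume x: "x \<in> finite_chains A B W q"
  have "c * pairing A (coeff_seq x (Suc i)) v + c * pairing B (coeff_seq x i) v = 0" if "v \<in> W" for i v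
  proof -
    have "pairing A (coeff_seq x (Suc i)) v + pairing B (coeff_seq x i) v = 0"
      using x that unfolding finite_chains_def chain_def by blast
    then show ?thesis by (simp flip: distrib_left)
  qed
  then show "c *s x \<in> finite_chains A B W q"
    using x vec.subspace_scale[OF assms] by (simp add: finite_chains_def chain_def coeff_seq_scale pairing_linear)
qed

context skew_pencil
begin

lemma finite_chains_orthogonal_sum:
  assumes s: "orthogonal_sum A B X Y W"
  shows "vec.dim (finite_chains A B W q) = vec.dim (finite_chains A B X q) + vec.dim (finite_chains A B Y q)"
proof -
  have sub: "vec.subspace X" "vec.subspace Y" and XY: "X \<inter> Y = {0}"
    using s unfolding orthogonal_sum_def by blast+
  have "finite_chains A B W q = {x + y |x y. x \<in> finite_chains A B X q \<and> y \<in> finite_chains A B Y q}"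
  proof (intro equalityI subsetI)
    fix z assume z: "z \<in> finite_chains A B W q"
    then have c: "chain A B W (coeff_seq z)" by (simp add: finite_chains_def)
    obtain f g where fg: "chain A B X f" "chain A B Y g" "\<And>i. coeff_seq z i = f i + g i"
      "\<And>i. coeff_seq z i = 0 \<Longrightarrow> f i = 0 \<and> g i = 0"
      using chain_split[OF s c] by blast
    have big: "coeff_seq z i = 0" if "CARD('n) \<le> i" for i using that by (simp add: coeff_seq_def)
    have f: "coeff_seq (of_coeff_seq f) = f" and g: "coeff_seq (of_coeff_seq g) = g"
      using fg(4) big by (auto intro!: coeff_seq_of_coeff_seq)
    have "z = of_coeff_seq f + of_coeff_seq g"
      by (rule coeff_seq_eqI) (simp add: coeff_seq_add f g fg(3))
    moreover have "of_coeff_seq f \<in> finite_chains A B X q" "of_coeff_seq g \<in> finite_chains A B Y q"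
      using fg z by (simp_all add: finite_chains_def f g)
    ultimately show "z \<in> {x + y |x y. x \<in> finite_chains A B X q \<and> y \<in> finite_chains A B Y q}" by blast
  next
    fix z assume "z \<in> {x + y |x y. x \<in> finite_chains A B X q \<and> y \<in> finite_chains A B Y q}"
    then obtain x y where z: "z = x + y" "x \<in> finite_chains A B X q" "y \<in> finite_chains A B Y q" by blast
    have "coeff_seq z = (\<lambda>i. coeff_seq x i + coeff_seq y i)" unfolding z(1) by (rule ext) (rule coeff_seq_add)
    then show "z \<in> finite_chains A B W q"
      using z(2,3) chain_add[OF s, of "coeff_seq x" "coeff_seq y"] by (simp add: finite_chains_def)
  qed
  moreover have "finite_chains A B X q \<inter> finite_chains A B Y q = {0}"
  proof (intro equalityI subsetI)
    fix z assume "z \<in> finite_chains A B X q \<inter> finite_chains A B Y q"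
    then have "coeff_seq z i \<in> X \<inter> Y" for i by (auto simp: finite_chains_def chain_def)
    then show "z \<in> {0}" unfolding XY by (auto intro!: coeff_seq_eqI)
  qed (use vec.subspace_0[OF subspace_finite_chains] sub in auto)
  ultimately show ?thesis
    using dim_sum_direct[OF subspace_finite_chains[OF sub(1)] subspace_finite_chains[OF sub(2)]] by simp
qed

text \<open>Solutions in the block are products of a scalar series with the basic solution, whose
  degree is exactly \<open>k - 1\<close>. Degree below \<open>q\<close> therefore leaves
  \<open>q + 1 - k\<close> free scalars, and truncated subtraction covers
  \<open>q < k\<close>.\<close>

lemma finite_chains_kronecker_block:
  assumes X: "kronecker_block A B k X" and q: "q \<le> CARD('n)"
  shows "vec.dim (finite_chains A B X q) = q + 1 - k"
proof -
  obtain u where u: "\<And>c j. (\<Sum>j<k. c j *s u j) = 0 \<Longrightarrow> j < k \<Longrightarrow> c j = 0"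
    "\<And>h. chain A B X h \<longleftrightarrow> (\<exists>t. \<forall>i. h i = (\<Sum>j<k. (if j \<le> i then t (i - j) else 0) *s u j))"
    using kronecker_block_chains[OF X] by blast
  have k: "k \<ge> 1" using kronecker_block_dim[OF X] by simp
  define conv where "conv t i = (\<Sum>j<k. (if j \<le> i then t (i - j) else 0) *s u j)" for t :: "nat \<Rightarrow> complex" and i
  have conv_eq_0: "(if j \<le> i then t (i - j) else 0) = 0" if "conv t i = 0" "j < k" for t i j
    by (rule u(1)[of "\<lambda>j. if j \<le> i then t (i - j) else 0"]) (use that in \<open>simp_all add: conv_def\<close>)
  have conv_supp: "conv t i = 0" if "\<And>l. q + 1 - k \<le> l \<Longrightarrow> t l = 0" "q \<le> i" for t i
    unfolding conv_def using that by (intro sum.neutral) auto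
  define N where "N = q + 1 - k"
  define e where "e l = of_coeff_seq (conv (\<lambda>m. if m = l then 1 else 0))" for l
  have coeff_e: "coeff_seq (e l) = conv (\<lambda>m. if m = l then 1 else 0)" if "l < N" for l
    unfolding e_def
  proof (rule coeff_seq_of_coeff_seq)
    fix i assume "CARD('n) \<le> i"
    then show "conv (\<lambda>m. if m = l then 1 else 0) i = 0"
      using that q by (intro conv_supp) (auto simp: N_def)
  qed
  have comb: "coeff_seq (\<Sum>l<N. t l *s e l) i = conv (\<lambda>m. if m < N then t m else 0) i" for t i
  proof -
    have "coeff_seq (\<Sum>l<N. t l *s e l) i = (\<Sum>l<N. \<Sum>j<k. (t l * (if j \<le> i then if i - j = l then 1 else 0 else 0)) *s u j)"
      by (simp add: coeff_seq_sum coeff_seq_scale coeff_e conv_def vec.scale_sum_right)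
    also have "\<dots> = (\<Sum>j<k. (\<Sum>l<N. t l * (if j \<le> i then if i - j = l then 1 else 0 else 0)) *s u j)"
      by (subst sum.swap) (simp add: vec.scale_sum_left)
    also have "\<dots> = conv (\<lambda>m. if m < N then t m else 0) i"
      unfolding conv_def
    proof (intro sum.cong refl arg_cong2[where f="(*s)"])
      fix j
      show "(\<Sum>l<N. t l * (if j \<le> i then if i - j = l then 1 else 0 else 0)) =
          (if j \<le> i then if i - j < N then t (i - j) else 0 else 0)"
      proof (cases "j \<le> i")
        case True
        then have "(\<Sum>l<N. t l * (if j \<le> i then if i - j = l then 1 else 0 else 0)) =
            (\<Sum>l<N. if l = i - j then t l else 0)"
          by (intro sum.cong) auto
        then show ?thesis using True by (simp add: sum.delta)
      qed simp
    qed
    finally show ?thesis .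
  qed
  have ind: "inj_on e {..<N} \<and> vec.independent (e ` {..<N})"
  proof (subst independent_family_iff, simp, intro allI impI ballI)
    fix t l assume t: "(\<Sum>l<N. t l *s e l) = 0" and l: "l \<in> {..<N}"
    have "conv (\<lambda>m. if m < N then t m else 0) l = 0" using comb[of t l] t by simp
    from conv_eq_0[OF this, of 0] k l show "t l = 0" by simp
  qed
  have "finite_chains A B X q = vec.span (e ` {..<N})"
  proof (subst span_family, simp, intro equalityI subsetI)
    fix x assume x: "x \<in> finite_chains A B X q"
    then obtain t where t: "\<And>i. coeff_seq x i = conv t i" unfolding finite_chains_def conv_def u(2) by blast
    \<comment> \<open>The term at index \<open>l + (k - 1)\<close> has coefficient
      \<open>t l\<close> along \<open>u (k - 1)\<close>. It vanishes when \<open>l \<ge> N\<close>,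
      so the independence of the \<open>u j\<close> bounds the support of \<open>t\<close>.\<close>
    have t0: "t l = 0" if "N \<le> l" for l
    proof -
      have "conv t (l + (k - 1)) = 0"
        using x that k unfolding t[symmetric] by (auto simp: finite_chains_def N_def)
      then have "(if k - 1 \<le> l + (k - 1) then t (l + (k - 1) - (k - 1)) else 0) = 0"
        by (rule conv_eq_0) (use k in simp)
      then show ?thesis by (simp only: le_add2 if_True add_diff_cancel_right')
    qed
    have "(\<lambda>m. if m < N then t m else 0) = t" using t0 by (auto simp: not_less)
    then have "x = (\<Sum>l<N. t l *s e l)" by (intro coeff_seq_eqI) (simp add: comb t)
    then show "x \<in> range (\<lambda>c. \<Sum>i<N. c i *s e i)" by blast
  next
    fix x assume "x \<in> range (\<lambda>c. \<Sum>i<N. c i *s e i)"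
    then obtain t where x: "x = (\<Sum>l<N. t l *s e l)" by blast
    have "coeff_seq x = conv (\<lambda>m. if m < N then t m else 0)" unfolding x by (rule ext) (rule comb)
    moreover have "chain A B X (conv t)" for t unfolding u(2) conv_def by blast
    moreover have "conv (\<lambda>m. if m < N then t m else 0) i = 0" if "q \<le> i" for i
      using that by (intro conv_supp) (auto simp: N_def)
    ultimately show "x \<in> finite_chains A B X q" by (simp add: finite_chains_def)
  qed
  then have "vec.dim (finite_chains A B X q) = card (e ` {..<N})"
    using ind by (simp add: vec.dim_eq_card_independent)
  then show ?thesis using ind by (simp add: card_image N_def)
qed

text \<open>The disjunction in the assumption makes the formula apply both to decompositions into
  indecomposables and to the given Kronecker blocks of \<open>kronecker_type\<close>.\<close>

lemma finite_chains_dim: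
  assumes "orthogonal_sum_list A B W Ws" "\<forall>X\<in>set Ws. indecomposable A B X \<or> (\<exists>k. kronecker_block A B k X)"
  shows "\<exists>ks. length ks = length (filter (\<lambda>X. \<exists>k. kronecker_block A B k X) Ws) \<and> (\<forall>k\<in>set ks. 1 \<le> k) \<and>
          (\<Sum>k\<leftarrow>ks. 2 * k - 1) \<le> vec.dim W \<and>
          list_all2 (kronecker_block A B) ks (filter (\<lambda>X. \<exists>k. kronecker_block A B k X) Ws) \<and>
          (\<forall>q\<le>CARD('n). vec.dim (finite_chains A B W q) = (\<Sum>k\<leftarrow>ks. q + 1 - k))"
  using assms
proof (induction Ws arbitrary: W)
  case Nil
  have "finite_chains A B {0} q = {0}" for q
    by (auto simp: finite_chains_def chain_def intro!: coeff_seq_eqI)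
  then show ?case using Nil by simp
next
  case (Cons X Ws)
  obtain Y where Y: "orthogonal_sum A B X Y W" "orthogonal_sum_list A B Y Ws" using Cons.prems(1) by auto
  have sub: "vec.subspace X" "vec.subspace Y" and XY: "X \<inter> Y = {0}" and W: "W = {x + y |x y. x \<in> X \<and> y \<in> Y}"
    using Y(1) unfolding orthogonal_sum_def by blast+
  have dimW: "vec.dim W = vec.dim X + vec.dim Y" unfolding W by (rule dim_sum_direct[OF sub XY])
  note dimF = finite_chains_orthogonal_sum[OF Y(1)]
  obtain ks where ks: "length ks = length (filter (\<lambda>X. \<exists>k. kronecker_block A B k X) Ws)" "\<forall>k\<in>set ks. 1 \<le> k"
    "(\<Sum>k\<leftarrow>ks. 2 * k - 1) \<le> vec.dim Y" "list_all2 (kronecker_block A B) ks (filter (\<lambda>X. \<exists>k. kronecker_block A B k X) Ws)"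
    "\<forall>q\<le>CARD('n). vec.dim (finite_chains A B Y q) = (\<Sum>k\<leftarrow>ks. q + 1 - k)"
    using Cons.IH[OF Y(2)] Cons.prems(2) by auto
  show ?case
  proof (cases "\<exists>k. kronecker_block A B k X")
    case True
    then obtain k where k: "kronecker_block A B k X" by blast
    show ?thesis
      using ks k kronecker_block_dim[OF k] finite_chains_kronecker_block[OF k]
      by (intro exI[of _ "k # ks"]) (auto simp: dimW dimF)
  next
    case False
    then have X: "indecomposable A B X" using Cons.prems(2) by auto
    have "finite_chains A B X q = {0}" for q
    proof (intro equalityI subsetI)
      fix x assume "x \<in> finite_chains A B X q"
      then have c: "chain A B X (coeff_seq x)" by (simp add: finite_chains_def)
      have "coeff_seq x i = 0" for i using chain_in_indecomposable[OF X c] False by blast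
      then show "x \<in> {0}" by (auto intro: coeff_seq_eqI)
    qed (use vec.subspace_0[OF subspace_finite_chains[OF sub(1)]] in auto)
    then show ?thesis using ks False by (intro exI[of _ ks]) (auto simp: dimW dimF)
  qed
qed

end

section \<open>Recovering block sizes from dimensions\<close>

lemma sum_list_block_sizes:
  fixes ks :: "nat list"
  assumes "\<forall>k\<in>set ks. 1 \<le> k" "(\<Sum>k\<leftarrow>ks. 2 * k - 1) \<le> n"
  shows "\<exists>c. (\<Sum>k\<leftarrow>ks. n + 1 - k) + c = n * length ks \<and> 2 * c + length ks \<le> n" and "\<forall>k\<in>set ks. k \<le> n"
proof -
  show le: "\<forall>k\<in>set ks. k \<le> n"
  proof
    fix k assume k: "k \<in> set ks"
    have "2 * k - 1 \<le> (\<Sum>k\<leftarrow>ks. 2 * k - 1)" using k by (intro member_le_sum_list) auto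
    then show "k \<le> n" using assms k by force
  qed
  \<comment> \<open>The defect \<open>c\<close> is the sum of the \<open>k - 1\<close>. The bound
    \<open>2 * c + length ks \<le> n\<close> keeps it below the gain \<open>n\<close> that one more
    block would bring.\<close>
  have "(\<Sum>k\<leftarrow>ks. n + 1 - k) + (\<Sum>k\<leftarrow>ks. k - 1) = n * length ks \<and>
      2 * (\<Sum>k\<leftarrow>ks. k - 1) + length ks = (\<Sum>k\<leftarrow>ks. 2 * k - 1)"
    using assms(1) le
  proof (induction ks)
    case (Cons k ks)
    then have IH: "(\<Sum>k\<leftarrow>ks. n + 1 - k) + (\<Sum>k\<leftarrow>ks. k - 1) = n * length ks"
      "2 * (\<Sum>k\<leftarrow>ks. k - 1) + length ks = (\<Sum>k\<leftarrow>ks. 2 * k - 1)" and "1 \<le> k" "k \<le> n" by auto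
    then have "n + 1 - k + (k - 1) = n" "2 * (k - 1) + 1 = 2 * k - 1" by auto
    then show ?case using IH by simp
  qed simp
  then show "\<exists>c. (\<Sum>k\<leftarrow>ks. n + 1 - k) + c = n * length ks \<and> 2 * c + length ks \<le> n"
    using assms(2) by (intro exI[of _ "\<Sum>k\<leftarrow>ks. k - 1"]) auto
qed

text \<open>An additional block raises the total by \<open>n\<close>, up to a defect that is at most
  half of \<open>n\<close>. So a list with more blocks cannot have a smaller or equal total.\<close>

lemma number_of_blocks_mono:
  fixes ks ks' :: "nat list"
  assumes ks: "\<forall>k\<in>set ks. 1 \<le> k" "(\<Sum>k\<leftarrow>ks. 2 * k - 1) \<le> n"
    and ks': "\<forall>k\<in>set ks'. 1 \<le> k" "(\<Sum>k\<leftarrow>ks'. 2 * k - 1) \<le> n"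
    and le: "(\<Sum>k\<leftarrow>ks'. n + 1 - k) \<le> (\<Sum>k\<leftarrow>ks. n + 1 - k)"
  shows "length ks' \<le> length ks"
proof (rule ccontr)
  assume "\<not> ?thesis"
  then have l: "length ks + 1 \<le> length ks'" by simp
  obtain c where c: "(\<Sum>k\<leftarrow>ks. n + 1 - k) + c = n * length ks" using sum_list_block_sizes[OF ks] by blast
  obtain c' where c': "(\<Sum>k\<leftarrow>ks'. n + 1 - k) + c' = n * length ks'" "2 * c' + length ks' \<le> n"
    using sum_list_block_sizes[OF ks'] by blast
  have "n * length ks + n \<le> n * length ks'" using mult_le_mono2[OF l, of n] by simp
  then have "n \<le> c'" using c c' le by linarith
  then show False using c'(2) l by linarith
qed

text \<open>The first difference in \<open>q\<close> counts the blocks with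
  \<open>k \<le> q + 1\<close>, and the second difference counts those of one given size.\<close>

lemma block_sizes_unique:
  fixes ks ks' :: "nat list"
  assumes ks: "\<forall>k\<in>set ks. 1 \<le> k \<and> k \<le> n" and ks': "\<forall>k\<in>set ks'. 1 \<le> k \<and> k \<le> n"
    and eq: "\<And>q. q \<le> n \<Longrightarrow> (\<Sum>k\<leftarrow>ks. q + 1 - k) = (\<Sum>k\<leftarrow>ks'. q + 1 - k)"
  shows "mset ks = mset ks'"
proof (rule multiset_eqI)
  fix v
  define F where "F q ks = (\<Sum>k\<leftarrow>ks. q + 1 - k)" for q and ks :: "nat list"
  have step: "F (Suc q) ks = F q ks + length (filter (\<lambda>k. k \<le> Suc q) ks)" if "\<forall>k\<in>set ks. 1 \<le> k" for q ks
    using that by (induction ks) (auto simp: F_def)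
  have F0: "F 0 ks = 0" if "\<forall>k\<in>set ks. 1 \<le> k" for ks using that by (induction ks) (auto simp: F_def)
  have L: "length (filter (\<lambda>k. k \<le> q) ks) = length (filter (\<lambda>k. k \<le> q) ks')" if "q \<le> n" for q
  proof (cases q)
    case 0
    have "filter (\<lambda>k. k \<le> 0) ks = []" if "\<forall>k\<in>set ks. 1 \<le> k" for ks :: "nat list"
      using that by (induction ks) auto
    then show ?thesis using 0 ks ks' by simp
  next
    case (Suc q')
    then show ?thesis using step[of ks q'] step[of ks' q'] eq[of q] eq[of q'] ks ks' that by (simp add: F_def)
  qed
  have cnt: "length (filter (\<lambda>k. k \<le> Suc q) ks) = length (filter (\<lambda>k. k \<le> q) ks) + count (mset ks) (Suc q)"
    for q and ks :: "nat list"
    by (induction ks) auto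
  show "count (mset ks) v = count (mset ks') v"
  proof (cases "1 \<le> v \<and> v \<le> n")
    case True
    then obtain q where "v = Suc q" "Suc q \<le> n" by (cases v) auto
    then show ?thesis using cnt[of q ks] cnt[of q ks'] L[of q] L[of "Suc q"] by simp
  next
    case False
    then have "v \<notin> set ks" "v \<notin> set ks'" using ks ks' by auto
    then have "count (mset ks) v = 0" "count (mset ks') v = 0" by (simp_all add: count_eq_zero_iff)
    then show ?thesis by presburger
  qed
qed

section \<open>Reordering the summands of a direct sum\<close>

lemma orthogonal_sum_exchange:
  assumes WZ: "orthogonal_sum A B Z V W" and VX: "orthogonal_sum A B X V' V"
  shows "\<exists>U. orthogonal_sum A B X U W \<and> orthogonal_sum A B Z V' U"
proof -
  note d = orthogonal_sum_def
  have Z: "vec.subspace Z" "Z \<inter> V = {0}" "W = {x + y |x y. x \<in> Z \<and> y \<in> V}" "orthogonal_spaces A B Z V"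
    using WZ unfolding d by blast+
  have X: "vec.subspace X" "vec.subspace V'" "X \<inter> V' = {0}" "V = {x + y |x y. x \<in> X \<and> y \<in> V'}" "orthogonal_spaces A B X V'"
    using VX unfolding d by blast+
  have sub: "X \<subseteq> V" "V' \<subseteq> V" "vec.subspace V" using orthogonal_sum_subset[OF VX] by auto
  have zero: "0 \<in> X" "0 \<in> V'" "0 \<in> Z" "0 \<in> V" using vec.subspace_0 X(1,2) Z(1) sub(3) by blast+
  define U where "U = {x + y |x y. x \<in> Z \<and> y \<in> V'}"
  have "Z \<inter> V' = {0}" using Z(2) zero sub by auto
  moreover have "orthogonal_spaces A B Z V'" using Z(4) by (rule orthogonal_spaces_mono) (use sub in auto)
  ultimately have ZU: "orthogonal_sum A B Z V' U" using Z(1) X(2) by (simp add: d U_def)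
  have "X \<inter> U = {0}"
  proof (intro equalityI subsetI)
    fix x assume "x \<in> X \<inter> U"
    then obtain z y where x: "x \<in> X" "x = z + y" "z \<in> Z" "y \<in> V'" by (auto simp: U_def)
    have "x - y \<in> V" using x sub by (intro vec.subspace_diff) auto
    then have "z \<in> Z \<inter> V" using x by simp
    then have "z = 0" unfolding Z(2) by simp
    then have "x \<in> X \<inter> V'" using x by simp
    then show "x \<in> {0}" unfolding X(3) .
  qed (use zero in \<open>force simp: U_def\<close>)
  moreover have "W = {x + y |x y. x \<in> X \<and> y \<in> U}"
  proof (intro equalityI subsetI)
    fix w assume "w \<in> W"
    then obtain z x y where w: "w = z + (x + y)" "z \<in> Z" "x \<in> X" "y \<in> V'" unfolding Z(3) X(4) by blast
    have "w = x + (z + y)" using w(1) by (simp add: algebra_simps)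
    moreover have "z + y \<in> U" using w unfolding U_def by blast
    ultimately show "w \<in> {x + y |x y. x \<in> X \<and> y \<in> U}" using w by blast
  next
    fix w assume "w \<in> {x + y |x y. x \<in> X \<and> y \<in> U}"
    then obtain z x y where w: "w = x + (z + y)" "z \<in> Z" "x \<in> X" "y \<in> V'" unfolding U_def by blast
    have "w = z + (x + y)" using w(1) by (simp add: algebra_simps)
    moreover have "x + y \<in> V" using w unfolding X(4) by blast
    ultimately show "w \<in> W" using w unfolding Z(3) by blast
  qed
  moreover have "orthogonal_spaces A B X U"
  proof -
    have "orthogonal_spaces A B Z X" using Z(4) by (rule orthogonal_spaces_mono) (use sub in auto)
    then show ?thesis using X(5) unfolding orthogonal_spaces_def U_def by (auto simp: pairing_linear)
  qed
  moreover have "vec.subspace U" using ZU orthogonal_sum_subset by blast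
  ultimately have "orthogonal_sum A B X U W" using X(1) by (simp add: d)
  then show ?thesis using ZU by blast
qed

lemma orthogonal_sum_list_move:
  "orthogonal_sum_list A B W (L @ X # R) \<Longrightarrow> orthogonal_sum_list A B W (X # L @ R)"
proof (induction L arbitrary: W)
  case (Cons Z L)
  then obtain V where V: "orthogonal_sum A B Z V W" "orthogonal_sum_list A B V (L @ X # R)" by auto
  then obtain V' where V': "orthogonal_sum A B X V' V" "orthogonal_sum_list A B V' (L @ R)"
    using Cons.IH[OF V(2)] by auto
  obtain U where "orthogonal_sum A B X U W" "orthogonal_sum A B Z V' U"
    using orthogonal_sum_exchange[OF V(1) V'(1)] by blast
  then show ?case using V'(2) by auto
qed simp

text \<open>Dimensions determine the multiset of block sizes only, whereas
  \<open>kronecker_type\<close> and \<open>homogeneous_on\<close> ask for one ordered list; hence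
  the summands must be rearranged.\<close>

lemma orthogonal_sum_list_permute:
  assumes "orthogonal_sum_list A B W Ws" "list_all2 P ks Ws" "mset ks = mset ks'"
  shows "\<exists>Ws'. orthogonal_sum_list A B W Ws' \<and> list_all2 P ks' Ws'"
  using assms
proof (induction ks' arbitrary: W ks Ws)
  case Nil
  then show ?case by auto
next
  case (Cons k ks')
  then have "k \<in> set ks" by (metis list.set_intros(1) mset_eq_setD)
  then obtain l r where lr: "ks = l @ k # r" by (meson split_list)
  then obtain L X R where Ws: "Ws = L @ X # R" "list_all2 P l L" "P k X" "list_all2 P r R"
    using Cons.prems(2) by (auto simp: list_all2_append1 list_all2_Cons1)
  obtain V where V: "orthogonal_sum A B X V W" "orthogonal_sum_list A B V (L @ R)"
    using orthogonal_sum_list_move[of A B W L X R] Cons.prems(1) Ws by auto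
  have "list_all2 P (l @ r) (L @ R)" using Ws by (simp add: list_all2_appendI)
  from Cons.IH[OF V(2) this] Cons.prems(3) lr obtain Ws' where
    "orthogonal_sum_list A B V Ws'" "list_all2 P ks' Ws'" by auto
  then show ?case using V(1) Ws(3) by (intro exI[of _ "X # Ws'"]) auto
qed

lemma kronecker_type_iff:
  "kronecker_type A B ks \<longleftrightarrow> (\<exists>Ws. orthogonal_sum_list A B UNIV Ws \<and> list_all2 (kronecker_block A B) ks Ws)"
  unfolding kronecker_type_def is_direct_sum_iff list_all2_conv_all_nth by auto

section \<open>The number and the sizes of the Kronecker blocks as invariants\<close>

context skew_pencil
begin

text \<open>Any two decompositions compute the same dimension of the solutions of degree below
  \<open>CARD('n)\<close>, and this dimension fixes the number of Kronecker blocks. This gives the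
  definite description its value.\<close>

lemma decomposition_data:
  obtains ks where "length ks = number_of_kronecker_blocks A B" "\<forall>k\<in>set ks. 1 \<le> k"
    "(\<Sum>k\<leftarrow>ks. 2 * k - 1) \<le> CARD('n)"
    "\<And>q. q \<le> CARD('n) \<Longrightarrow> vec.dim (finite_chains A B UNIV q) = (\<Sum>k\<leftarrow>ks. q + 1 - k)"
    "\<And>Ws. is_direct_sum A B Ws \<Longrightarrow> \<forall>W\<in>set Ws. indecomposable A B W \<Longrightarrow>
       length (filter (\<lambda>W. \<exists>k. kronecker_block A B k W) Ws) = number_of_kronecker_blocks A B"
proof -
  have data: "\<exists>ks. length ks = length (filter (\<lambda>X. \<exists>k. kronecker_block A B k X) Ws) \<and> (\<forall>k\<in>set ks. 1 \<le> k) \<and>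
          (\<Sum>k\<leftarrow>ks. 2 * k - 1) \<le> CARD('n) \<and>
          (\<forall>q\<le>CARD('n). vec.dim (finite_chains A B UNIV q) = (\<Sum>k\<leftarrow>ks. q + 1 - k))"
    if "is_direct_sum A B Ws" "\<forall>W\<in>set Ws. indecomposable A B W" for Ws
  proof -
    have "orthogonal_sum_list A B UNIV Ws" using that(1) by (simp add: is_direct_sum_iff)
    from finite_chains_dim[OF this] that(2) vec_dim_le_card[of "UNIV :: (complex^'n) set"] show ?thesis
      by (meson order_trans)
  qed
  obtain Ws where Ws: "is_direct_sum A B Ws" "\<forall>W\<in>set Ws. indecomposable A B W"
    using decomposition_exists[of UNIV] vec.subspace_UNIV unfolding is_direct_sum_iff by blast
  obtain ks where ks: "length ks = length (filter (\<lambda>X. \<exists>k. kronecker_block A B k X) Ws)" "\<forall>k\<in>set ks. 1 \<le> k"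
    "(\<Sum>k\<leftarrow>ks. 2 * k - 1) \<le> CARD('n)"
    "\<forall>q\<le>CARD('n). vec.dim (finite_chains A B UNIV q) = (\<Sum>k\<leftarrow>ks. q + 1 - k)"
    using data[OF Ws] by blast
  have uniq: "length (filter (\<lambda>X. \<exists>k. kronecker_block A B k X) Ws') = length ks"
    if Ws': "is_direct_sum A B Ws'" "\<forall>W\<in>set Ws'. indecomposable A B W" for Ws'
  proof -
    obtain ks' where ks': "length ks' = length (filter (\<lambda>X. \<exists>k. kronecker_block A B k X) Ws')" "\<forall>k\<in>set ks'. 1 \<le> k"
      "(\<Sum>k\<leftarrow>ks'. 2 * k - 1) \<le> CARD('n)"
      "\<forall>q\<le>CARD('n). vec.dim (finite_chains A B UNIV q) = (\<Sum>k\<leftarrow>ks'. q + 1 - k)"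
      using data[OF Ws'] by blast
    have "(\<Sum>k\<leftarrow>ks. CARD('n) + 1 - k) = (\<Sum>k\<leftarrow>ks'. CARD('n) + 1 - k)"
      using ks(4) ks'(4) by (metis order_refl)
    then have "length ks' \<le> length ks" "length ks \<le> length ks'"
      using number_of_blocks_mono[OF ks(2,3) ks'(2,3)] number_of_blocks_mono[OF ks'(2,3) ks(2,3)] by simp_all
    then show ?thesis using ks'(1) by simp
  qed
  have num: "number_of_kronecker_blocks A B = length ks"
    unfolding number_of_kronecker_blocks_def
  proof (rule the_equality)
    show "\<exists>Ws. is_direct_sum A B Ws \<and> (\<forall>W\<in>set Ws. indecomposable A B W) \<and>
        length ks = length (filter (\<lambda>W. \<exists>k. kronecker_block A B k W) Ws)"
      using Ws ks(1) by blast
  qed (use uniq in auto)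
  show thesis by (rule that[of ks]) (use num ks uniq in auto)
qed

theorem kronecker_type_if_many_chains:
  fixes h :: "'i \<Rightarrow> nat \<Rightarrow> complex^'n" and Q :: "(complex^'n) set"
  assumes h: "\<And>t. t \<in> T \<Longrightarrow> chain A B UNIV (h t)" and Q: "Q \<subseteq> (\<Union>t\<in>T. range (h t))" "vec.independent Q"
    and card: "CARD('n) + number_of_kronecker_blocks A B \<le> 2 * card Q"
  shows "\<exists>ks. kronecker_type A B ks"
proof -
  obtain Ws where Ws: "orthogonal_sum_list A B UNIV Ws" "\<forall>W\<in>set Ws. indecomposable A B W"
    using decomposition_exists[of UNIV] vec.subspace_UNIV by blast
  have num: "length (filter (\<lambda>W. \<exists>k. kronecker_block A B k W) Ws) = number_of_kronecker_blocks A B"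
    using decomposition_data Ws unfolding is_direct_sum_iff by metis
  obtain L where L: "vec.subspace L" "\<forall>h i. chain A B UNIV h \<longrightarrow> h i \<in> L"
    "2 * vec.dim L + length (filter (\<lambda>X. \<not> (\<exists>k. kronecker_block A B k X)) Ws)
             \<le> vec.dim (UNIV :: (complex^'n) set) + length (filter (\<lambda>X. \<exists>k. kronecker_block A B k X) Ws)"
    using chain_space_bound[OF Ws] by blast
  have "Q \<subseteq> L" using Q(1) h L(2) by blast
  then have "card Q \<le> vec.dim L" using Q(2) by (rule vec.independent_card_le_dim)
  \<comment> \<open>With \<open>n = CARD('n)\<close>, \<open>s\<close> Kronecker blocks and
    \<open>d\<close> other summands, \<open>2 * card Q\<close> is at most
    \<open>2 * vec.dim L\<close>, hence at most \<open>n + s - d\<close>. The assumed lower bound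
    \<open>n + s\<close> leaves \<open>d = 0\<close>.\<close>
  then have "length (filter (\<lambda>X. \<not> (\<exists>k. kronecker_block A B k X)) Ws) = 0"
    using L(3) num card vec_dim_le_card[of "UNIV :: (complex^'n) set"] by linarith
  then have all: "\<forall>X\<in>set Ws. \<exists>k. kronecker_block A B k X" by (auto simp: filter_empty_conv)
  then obtain f where "\<forall>X\<in>set Ws. kronecker_block A B (f X) X" by metis
  then have "list_all2 (kronecker_block A B) (map f Ws) Ws" by (auto simp: list_all2_conv_all_nth)
  then show ?thesis using Ws(1) unfolding kronecker_type_iff by blast
qed

lemma kronecker_type_data:
  assumes "kronecker_type A B ks"
  shows "\<forall>k\<in>set ks. 1 \<le> k \<and> k \<le> CARD('n)"
    and "q \<le> CARD('n) \<Longrightarrow> vec.dim (finite_chains A B UNIV q) = (\<Sum>k\<leftarrow>ks. q + 1 - k)"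
proof -
  obtain Ws where Ws: "orthogonal_sum_list A B UNIV Ws" "list_all2 (kronecker_block A B) ks Ws"
    using assms unfolding kronecker_type_iff by blast
  have all: "\<forall>X\<in>set Ws. \<exists>k. kronecker_block A B k X"
    using Ws(2) unfolding list_all2_conv_all_nth by (metis in_set_conv_nth)
  then have "filter (\<lambda>X. \<exists>k. kronecker_block A B k X) Ws = Ws" by simp
  with finite_chains_dim[OF Ws(1)] all obtain ks' where ks': "\<forall>k\<in>set ks'. 1 \<le> k"
    "(\<Sum>k\<leftarrow>ks'. 2 * k - 1) \<le> vec.dim (UNIV :: (complex^'n) set)" "list_all2 (kronecker_block A B) ks' Ws"
    "\<forall>q\<le>CARD('n). vec.dim (finite_chains A B UNIV q) = (\<Sum>k\<leftarrow>ks'. q + 1 - k)" by auto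
  \<comment> \<open>Both lists describe the same subspaces, and the dimension
    \<open>2 * k - 1\<close> of a block determines \<open>k\<close>.\<close>
  have "ks' = ks"
  proof (rule nth_equalityI)
    show "length ks' = length ks" using ks'(3) Ws(2) by (simp add: list_all2_conv_all_nth)
    fix i assume i: "i < length ks'"
    then have "kronecker_block A B (ks' ! i) (Ws ! i)" "kronecker_block A B (ks ! i) (Ws ! i)"
      using ks'(3) Ws(2) by (auto simp: list_all2_conv_all_nth)
    from kronecker_block_dim[OF this(1)] kronecker_block_dim[OF this(2)] show "ks' ! i = ks ! i" by linarith
  qed
  have le: "(\<Sum>k\<leftarrow>ks'. 2 * k - 1) \<le> CARD('n)"
    using ks'(2) vec_dim_le_card[of "UNIV :: (complex^'n) set"] by linarith
  show "\<forall>k\<in>set ks. 1 \<le> k \<and> k \<le> CARD('n)"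
    using ks'(1) sum_list_block_sizes(2)[OF ks'(1) le] unfolding \<open>ks' = ks\<close> by blast
  show "vec.dim (finite_chains A B UNIV q) = (\<Sum>k\<leftarrow>ks. q + 1 - k)" if "q \<le> CARD('n)"
    using ks'(4) that unfolding \<open>ks' = ks\<close> by blast
qed

end

text \<open>This turns upper semicontinuity of a dimension into upper semicontinuity of the number
  of blocks.\<close>

lemma number_of_kronecker_blocks_mono:
  fixes A B A' B' :: "complex^'n::finite^'n"
  assumes "skew_pencil A B" "skew_pencil A' B'"
    and "vec.dim (finite_chains A' B' UNIV CARD('n)) \<le> vec.dim (finite_chains A B UNIV CARD('n))"
  shows "number_of_kronecker_blocks A' B' \<le> number_of_kronecker_blocks A B"
proof -
  obtain ks where ks: "length ks = number_of_kronecker_blocks A B" "\<forall>k\<in>set ks. 1 \<le> k"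
    "(\<Sum>k\<leftarrow>ks. 2 * k - 1) \<le> CARD('n)"
    "\<And>q. q \<le> CARD('n) \<Longrightarrow> vec.dim (finite_chains A B UNIV q) = (\<Sum>k\<leftarrow>ks. q + 1 - k)"
    using skew_pencil.decomposition_data[OF assms(1)] by metis
  obtain ks' where ks': "length ks' = number_of_kronecker_blocks A' B'" "\<forall>k\<in>set ks'. 1 \<le> k"
    "(\<Sum>k\<leftarrow>ks'. 2 * k - 1) \<le> CARD('n)"
    "\<And>q. q \<le> CARD('n) \<Longrightarrow> vec.dim (finite_chains A' B' UNIV q) = (\<Sum>k\<leftarrow>ks'. q + 1 - k)"
    using skew_pencil.decomposition_data[OF assms(2)] by metis
  show ?thesis
    using number_of_blocks_mono[OF ks(2,3) ks'(2,3)] assms(3) ks(1,4) ks'(1,4) by simp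
qed

lemma kronecker_type_transfer:
  fixes A B A' B' :: "complex^'n::finite^'n"
  assumes "skew_pencil A B" "skew_pencil A' B'" "kronecker_type A B ks" "kronecker_type A' B' ks'"
    and "\<And>q. q \<le> CARD('n) \<Longrightarrow> vec.dim (finite_chains A' B' UNIV q) = vec.dim (finite_chains A B UNIV q)"
  shows "kronecker_type A' B' ks"
proof -
  have "mset ks' = mset ks"
    using skew_pencil.kronecker_type_data[OF assms(1,3)] skew_pencil.kronecker_type_data[OF assms(2,4)] assms(5)
    by (intro block_sizes_unique[of _ "CARD('n)"]) auto
  then show ?thesis
    using assms(4) orthogonal_sum_list_permute unfolding kronecker_type_iff by metis
qed

section \<open>Semicontinuity and congruence invariance of the dimensions\<close>

lemma pairing_axis_sum: "pairing A u v = (\<Sum>j\<in>UNIV. v $ j * pairing A u (axis j 1))"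
proof -
  have "v = (\<Sum>j\<in>UNIV. v $ j *s axis j 1)" by (simp add: basis_expansion)
  then have "pairing A u v = pairing A u (\<Sum>j\<in>UNIV. v $ j *s axis j 1)" by simp
  then show ?thesis by (simp add: pairing_linear)
qed

lemma continuous_on_coeff_seq: "continuous_on S (\<lambda>x. coeff_seq x i)"
  unfolding coeff_seq_def by (cases "i < CARD('a)") (auto intro!: continuous_intros continuous_on_vec_lambda)

lemma scaleR_eq_smult: "r *\<^sub>R x = complex_of_real r *s (x :: complex^'m)"
  unfolding vec_eq_iff
  by (intro allI) (simp only: vector_scaleR_component vector_smult_component scaleR_conv_of_real[where 'a = complex])

lemma closed_vec_subspace:
  fixes F :: "(complex^'m::finite) set"
  assumes "vec.subspace F" shows "closed F"
proof (rule closed_subspace)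
  show "subspace F" using assms unfolding subspace_def vec.subspace_def scaleR_eq_smult by simp
qed

text \<open>The space of polynomial solutions at one point and a complement of it
  still intersect trivially at nearby points.\<close>
lemma finite_chains_dim_usc:
  fixes A B :: "'a::topological_space \<Rightarrow> complex^'n::finite^'n"
  assumes S: "open S" and A: "continuous_on S A" and B: "continuous_on S B"
  shows "open {m \<in> S. vec.dim (finite_chains (A m) (B m) UNIV q) \<le> v}"
proof (subst open_subopen, intro ballI)
  fix m0 assume m0: "m0 \<in> {m \<in> S. vec.dim (finite_chains (A m) (B m) UNIV q) \<le> v}"
  define fc where "fc m = finite_chains (A m) (B m) UNIV q" for m
  have sub: "vec.subspace (fc m)" for m unfolding fc_def by (rule subspace_finite_chains) simp
  obtain F where F: "vec.subspace F" "fc m0 \<inter> F = {0}" "UNIV = {x + y |x y. x \<in> fc m0 \<and> y \<in> F}"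
    using complement_exists[OF sub vec.subspace_UNIV subset_UNIV, of m0] by (elim exE conjE)
  have dim0: "vec.dim (UNIV :: (complex^('n \<times> 'n)) set) = vec.dim (fc m0) + vec.dim F"
    using dim_sum_direct[OF sub F(1,2)] unfolding F(3)[symmetric] .
  \<comment> \<open>A continuous residual that vanishes exactly on the solution space: initial
    condition, recurrence and degree bound, tested on coordinate vectors. Indices beyond
    \<open>CARD('n)\<close> contribute nothing, since coefficients vanish from there on.\<close>
  define R where "R m x = (\<Sum>j\<in>UNIV. norm (pairing (A m) (coeff_seq x 0) (axis j 1))) +
      (\<Sum>i\<le>CARD('n). \<Sum>j\<in>UNIV. norm (pairing (A m) (coeff_seq x (Suc i)) (axis j 1) + pairing (B m) (coeff_seq x i) (axis j 1))) +
      (\<Sum>i\<in>{q..CARD('n)}. norm (coeff_seq x i))" for m x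
  have R_pos: "0 < R m x" if x: "x \<notin> fc m" for m x
  proof (rule ccontr)
    assume "\<not> 0 < R m x"
    moreover have "0 \<le> (\<Sum>j\<in>UNIV. norm (pairing (A m) (coeff_seq x 0) (axis j 1)))"
      "0 \<le> (\<Sum>i\<le>CARD('n). \<Sum>j\<in>UNIV. norm (pairing (A m) (coeff_seq x (Suc i)) (axis j 1) + pairing (B m) (coeff_seq x i) (axis j 1)))"
      "0 \<le> (\<Sum>i\<in>{q..CARD('n)}. norm (coeff_seq x i))"
      by (intro sum_nonneg; simp)+
    ultimately have z: "(\<Sum>j\<in>UNIV. norm (pairing (A m) (coeff_seq x 0) (axis j 1))) = 0"
      "(\<Sum>i\<le>CARD('n). \<Sum>j\<in>UNIV. norm (pairing (A m) (coeff_seq x (Suc i)) (axis j 1) + pairing (B m) (coeff_seq x i) (axis j 1))) = 0"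
      "(\<Sum>i\<in>{q..CARD('n)}. norm (coeff_seq x i)) = 0"
      unfolding R_def by linarith+
    have z1: "pairing (A m) (coeff_seq x 0) (axis j 1) = 0" for j
      using z(1) by (subst (asm) sum_nonneg_eq_0_iff) auto
    have z2: "pairing (A m) (coeff_seq x (Suc i)) (axis j 1) + pairing (B m) (coeff_seq x i) (axis j 1) = 0" for i j
    proof (cases "i \<le> CARD('n)")
      case True
      then have "(\<Sum>j\<in>UNIV. norm (pairing (A m) (coeff_seq x (Suc i)) (axis j 1) + pairing (B m) (coeff_seq x i) (axis j 1))) = 0"
        using z(2) by (subst (asm) sum_nonneg_eq_0_iff) (auto intro: sum_nonneg)
      then show ?thesis by (subst (asm) sum_nonneg_eq_0_iff) auto
    next
      case False
      then show ?thesis by (simp add: coeff_seq_def)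
    qed
    have z3: "coeff_seq x i = 0" if "q \<le> i" for i
    proof (cases "i \<le> CARD('n)")
      case True
      then show ?thesis using z(3) that by (subst (asm) sum_nonneg_eq_0_iff) auto
    next
      case False
      then show ?thesis by (simp add: coeff_seq_def)
    qed
    have "pairing (A m) (coeff_seq x 0) v = 0" for v
      by (subst pairing_axis_sum) (simp add: z1)
    moreover have "pairing (A m) (coeff_seq x (Suc i)) v + pairing (B m) (coeff_seq x i) v = 0" for i v
      unfolding pairing_axis_sum[of _ _ v] sum.distrib[symmetric] distrib_left[symmetric] by (simp add: z2)
    ultimately have "x \<in> fc m" using z3 by (simp add: fc_def finite_chains_def chain_def)
    then show False using x by simp
  qed
  have R_zero: "R m x = 0" if "x \<in> fc m" for m x
    using that by (simp add: R_def fc_def finite_chains_def chain_def)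
  have Ac: "continuous_on (S \<times> UNIV) (\<lambda>z. A (fst z))" and Bc: "continuous_on (S \<times> UNIV) (\<lambda>z. B (fst z))"
    by (rule continuous_on_compose2[OF A] continuous_on_compose2[OF B]; force intro!: continuous_intros)+
  have cc: "continuous_on (S \<times> UNIV) (\<lambda>z. coeff_seq (snd z) i)" for i
    by (rule continuous_on_compose2[OF continuous_on_coeff_seq[of UNIV]]) (auto intro!: continuous_intros)
  have "continuous_on (S \<times> UNIV) (\<lambda>z. R (fst z) (snd z))"
    unfolding R_def pairing_def by (intro continuous_intros Ac Bc cc)
  then have op: "open ((\<lambda>z. R (fst z) (snd z)) -` {0<..} \<inter> S \<times> UNIV)"
    using iffD1[OF continuous_on_open_vimage[OF open_Times[OF S open_UNIV]]] open_greaterThan by blast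
  have cp: "compact (F \<inter> sphere 0 1)"
    using closed_vec_subspace[OF F(1)] by (rule closed_Int_compact) simp
  have sb: "{m0} \<times> (F \<inter> sphere 0 1) \<subseteq> (\<lambda>z. R (fst z) (snd z)) -` {0<..} \<inter> S \<times> UNIV"
  proof -
    have "x \<notin> fc m0" if "x \<in> F \<inter> sphere 0 1" for x
    proof
      assume "x \<in> fc m0"
      then have "x \<in> fc m0 \<inter> F" using that by simp
      then show False using that unfolding F(2) by simp
    qed
    then show ?thesis using R_pos m0 by auto
  qed
  \<comment> \<open>The unit sphere of \<open>F\<close> is compact, so positivity of the residual on
    it persists for all points near \<open>m0\<close>. A nonzero common vector of \<open>F\<close>
    and a nearby solution space could be scaled to this sphere.\<close>
  from Elementary_Topology.tube_lemma[OF cp op sb] obtain X0 where X0: "m0 \<in> X0" "open X0"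
    "X0 \<times> (F \<inter> sphere 0 1) \<subseteq> (\<lambda>z. R (fst z) (snd z)) -` {0<..} \<inter> S \<times> UNIV"
    by (elim exE conjE)
  have "vec.dim (fc m) \<le> vec.dim (fc m0)" if m: "m \<in> X0 \<inter> S" for m
  proof -
    have "x = 0" if x: "x \<in> fc m \<inter> F" for x
    proof (rule ccontr)
      assume nz: "x \<noteq> 0"
      define y where "y = complex_of_real (1 / norm x) *s x"
      have "y = (1 / norm x) *\<^sub>R x"
        unfolding y_def scaleR_eq_smult ..
      then have "norm y = 1" using nz by simp
      moreover have yF: "y \<in> F" and yfc: "y \<in> fc m"
        unfolding y_def using x by (auto intro: vec.subspace_scale[OF F(1)] vec.subspace_scale[OF sub])
      ultimately have "(m, y) \<in> X0 \<times> (F \<inter> sphere 0 1)" using m by simp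
      from subsetD[OF X0(3) this] have "0 < R m y" by simp
      then show False using R_zero[OF yfc] by simp
    qed
    then have "fc m \<inter> F = {0}" using vec.subspace_0[OF sub] vec.subspace_0[OF F(1)] by auto
    have "vec.dim (fc m) + vec.dim F \<le> vec.dim (UNIV :: (complex^('n \<times> 'n)) set)"
      unfolding dim_sum_direct[OF sub F(1) \<open>fc m \<inter> F = {0}\<close>, symmetric] by (rule vec.dim_subset[OF subset_UNIV])
    then show ?thesis using dim0 by simp
  qed
  then show "\<exists>T. open T \<and> m0 \<in> T \<and> T \<subseteq> {m \<in> S. vec.dim (finite_chains (A m) (B m) UNIV q) \<le> v}"
    using X0 S m0 unfolding fc_def by (intro exI[of _ "X0 \<inter> S"]) (auto intro: order_trans)
qed

text \<open>Applying \<open>K\<close> to every coefficient is injective, and it preserves the chain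
  equations because \<open>L\<close> carries the test vectors back. In the application
  \<open>K\<close> comes from a change of chart.\<close>

lemma finite_chains_dim_congruence_le:
  fixes A B A' B' K L :: "complex^'n::finite^'n"
  assumes A: "\<And>u v. pairing A u v = pairing A' (K *v u) (K *v v)"
    and B: "\<And>u v. pairing B u v = pairing B' (K *v u) (K *v v)"
    and KL: "K ** L = mat 1" "L ** K = mat 1"
  shows "vec.dim (finite_chains A B UNIV q) \<le> vec.dim (finite_chains A' B' UNIV q)"
proof -
  define \<Phi> where "\<Phi> x = of_coeff_seq (\<lambda>i. K *v coeff_seq x i)" for x :: "complex^('n \<times> 'n)"
  have coeff: "coeff_seq (\<Phi> x) = (\<lambda>i. K *v coeff_seq x i)" for x
    unfolding \<Phi>_def by (rule coeff_seq_of_coeff_seq) (simp add: coeff_seq_def)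
  have lin: "Vector_Spaces.linear (*s) (*s) \<Phi>"
  proof (unfold Vector_Spaces.linear_iff, intro conjI allI)
    show "\<Phi> (x + y) = \<Phi> x + \<Phi> y" for x y
      by (rule coeff_seq_eqI) (simp add: coeff coeff_seq_add matrix_vector_right_distrib)
    show "\<Phi> (c *s x) = c *s \<Phi> x" for c x
      by (rule coeff_seq_eqI) (simp add: coeff coeff_seq_scale vec.scale)
  qed unfold_locales
  have inv: "L *v (K *v u) = u" "K *v (L *v u) = u" for u
    using KL by (simp_all add: matrix_vector_mul_assoc)
  have inj: "inj \<Phi>"
  proof (rule injI)
    fix x y assume "\<Phi> x = \<Phi> y"
    then have "K *v coeff_seq x i = K *v coeff_seq y i" for i using coeff by metis
    then have "coeff_seq x i = coeff_seq y i" for i by (metis inv(1))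
    then show "x = y" by (rule coeff_seq_eqI)
  qed
  have "\<Phi> ` finite_chains A B UNIV q \<subseteq> finite_chains A' B' UNIV q"
  proof (rule image_subsetI)
    fix x assume x: "x \<in> finite_chains A B UNIV q"
    have "pairing A' (K *v u) v = pairing A u (L *v v)" "pairing B' (K *v u) v = pairing B u (L *v v)" for u v
      by (simp_all add: A B inv)
    then show "\<Phi> x \<in> finite_chains A' B' UNIV q"
      using x by (simp add: finite_chains_def chain_def coeff)
  qed
  then have "vec.dim (\<Phi> ` finite_chains A B UNIV q) \<le> vec.dim (finite_chains A' B' UNIV q)"
    by (rule vec.dim_subset)
  moreover have "vec.dim (\<Phi> ` finite_chains A B UNIV q) = vec.dim (finite_chains A B UNIV q)"
    by (rule vec.dim_image_eq[OF lin]) (use inj in \<open>simp add: inj_on_def\<close>)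
  ultimately show ?thesis by simp
qed

lemma finite_chains_dim_congruence:
  fixes A B A' B' K L :: "complex^'n::finite^'n"
  assumes A: "\<And>u v. pairing A u v = pairing A' (K *v u) (K *v v)"
    and B: "\<And>u v. pairing B u v = pairing B' (K *v u) (K *v v)"
    and KL: "K ** L = mat 1" "L ** K = mat 1"
  shows "vec.dim (finite_chains A B UNIV q) = vec.dim (finite_chains A' B' UNIV q)"
proof (rule antisym)
  show "vec.dim (finite_chains A B UNIV q) \<le> vec.dim (finite_chains A' B' UNIV q)"
    by (rule finite_chains_dim_congruence_le[OF A B KL])
  show "vec.dim (finite_chains A' B' UNIV q) \<le> vec.dim (finite_chains A B UNIV q)"
    by (rule finite_chains_dim_congruence_le[OF _ _ KL(2,1)])
      (simp_all add: A B matrix_vector_mul_assoc KL)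
qed

section \<open>Regular functions\<close>

lemma bounded_linear_to_complex: "bounded_linear (to_complex :: 'k::ground_field \<Rightarrow> complex)"
  by (rule bounded_linear_intro[of _ 1]) (simp_all add: to_complex_add to_complex_scaleR norm_to_complex)

text \<open>Unconditional summability of complex families is absolute; the isometry
  \<open>to_complex\<close> carries this over to the ground field.\<close>

lemma summable_imp_norm_summable:
  fixes f :: "'b \<Rightarrow> 'k::ground_field"
  assumes "f summable_on I"
  shows "(\<lambda>x. norm (f x)) summable_on I"
proof -
  have "(\<lambda>x. to_complex (f x)) summable_on I"
    using summable_on_bounded_linear[OF bounded_linear_to_complex assms] .
  then have "(\<lambda>x. norm (to_complex (f x))) summable_on I"
    by (simp add: summable_on_iff_abs_summable_on_complex)
  then show ?thesis by (simp add: norm_to_complex)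
qed

lemma has_sum_sum:
  fixes f :: "'i \<Rightarrow> 'b \<Rightarrow> 'c::topological_comm_monoid_add"
  assumes "\<And>i. i \<in> J \<Longrightarrow> (f i has_sum s i) I"
  shows "((\<lambda>x. \<Sum>i\<in>J. f i x) has_sum (\<Sum>i\<in>J. s i)) I"
  using assms
  by (induction J rule: infinite_finite_induct) (auto intro: has_sum_add)

subsection \<open>Power series\<close>

definition mpow :: "('n::finite \<Rightarrow> nat) \<Rightarrow> 'k::ground_field ^ 'n \<Rightarrow> 'k" where
  "mpow \<alpha> y = (\<Prod>i\<in>UNIV. y $ i ^ \<alpha> i)"

definition mdeg :: "('n::finite \<Rightarrow> nat) \<Rightarrow> nat" where
  "mdeg \<alpha> = (\<Sum>i\<in>UNIV. \<alpha> i)"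

definition polydisc :: "'k::ground_field ^ 'n \<Rightarrow> real \<Rightarrow> ('k ^ 'n) set" where
  "polydisc a \<rho> = {x. \<forall>i. norm (x $ i - a $ i) \<le> \<rho>}"

text \<open>Convergence on the closed polydisc with bound \<open>M\<close> for the weighted \<open>\<ell>\<^sup>1\<close> norm of the coefficients.\<close>
definition power_series_on :: "'k::ground_field ^ 'n::finite \<Rightarrow> real \<Rightarrow> real \<Rightarrow> ('k ^ 'n \<Rightarrow> 'k) \<Rightarrow> bool" where
  "power_series_on a \<rho> M f \<longleftrightarrow> (\<exists>c N. ((\<lambda>\<alpha>. norm (c \<alpha>) * \<rho> ^ mdeg \<alpha>) has_sum N) UNIV \<and> N \<le> M \<and>
     (\<forall>x\<in>polydisc a \<rho>. ((\<lambda>\<alpha>. c \<alpha> * mpow \<alpha> (x - a)) has_sum f x) UNIV))"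

lemma norm_mpow_le:
  assumes "x \<in> polydisc a \<rho>" shows "norm (mpow \<alpha> (x - a)) \<le> \<rho> ^ mdeg \<alpha>"
proof -
  have "norm (mpow \<alpha> (x - a)) = (\<Prod>i\<in>UNIV. norm (x $ i - a $ i) ^ \<alpha> i)"
    by (simp add: mpow_def prod_norm[symmetric] norm_power)
  also have "\<dots> \<le> (\<Prod>i\<in>UNIV. \<rho> ^ \<alpha> i)"
    using assms by (intro prod_mono) (auto simp: polydisc_def intro!: power_mono)
  finally show ?thesis by (simp add: power_sum mdeg_def)
qed

lemma center_in_polydisc: "0 \<le> \<rho> \<Longrightarrow> a \<in> polydisc a \<rho>"
  by (simp add: polydisc_def)

lemma power_series_on_mono:
  "power_series_on a \<rho> M f \<Longrightarrow> M \<le> M' \<Longrightarrow> power_series_on a \<rho> M' f"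
  unfolding power_series_on_def using order_trans by blast

lemma power_series_on_cong:
  "power_series_on a \<rho> M f \<Longrightarrow> (\<And>x. x \<in> polydisc a \<rho> \<Longrightarrow> f x = g x) \<Longrightarrow> power_series_on a \<rho> M g"
  unfolding power_series_on_def by simp

lemma power_series_on_nonneg:
  assumes "power_series_on a \<rho> M f" "0 \<le> \<rho>" shows "0 \<le> M"
proof -
  obtain c :: "('b \<Rightarrow> nat) \<Rightarrow> 'a" and N where cN: "((\<lambda>\<alpha>. norm (c \<alpha>) * \<rho> ^ mdeg \<alpha>) has_sum N) UNIV" "N \<le> M"
    using assms(1) unfolding power_series_on_def by blast
  have "0 \<le> N" using cN(1) by (rule has_sum_nonneg) (simp add: assms(2))
  then show ?thesis using cN by simp
qed

lemma power_series_on_bound: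
  assumes f: "power_series_on a \<rho> M f" and x: "x \<in> polydisc a \<rho>"
  shows "norm (f x) \<le> M"
proof -
  obtain c N where c: "((\<lambda>\<alpha>. norm (c \<alpha>) * \<rho> ^ mdeg \<alpha>) has_sum N) UNIV" "N \<le> M"
    "((\<lambda>\<alpha>. c \<alpha> * mpow \<alpha> (x - a)) has_sum f x) UNIV"
    using f x unfolding power_series_on_def by blast
  have n: "(\<lambda>\<alpha>. norm (c \<alpha> * mpow \<alpha> (x - a))) summable_on UNIV"
    using c(3) by (intro summable_imp_norm_summable) (auto simp: summable_on_def)
  have "norm (f x) \<le> (\<Sum>\<^sub>\<infinity>\<alpha>. norm (c \<alpha> * mpow \<alpha> (x - a)))"
    using norm_infsum_bound[OF n] infsumI[OF c(3)] by simp
  also have "\<dots> \<le> (\<Sum>\<^sub>\<infinity>\<alpha>. norm (c \<alpha>) * \<rho> ^ mdeg \<alpha>)"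
    using c(1) by (intro infsum_mono n) (auto simp: summable_on_def norm_mult intro!: mult_left_mono norm_mpow_le x)
  also have "\<dots> \<le> M" using infsumI[OF c(1)] c(2) by simp
  finally show ?thesis .
qed

text \<open>An interchange of a double sum: \<open>F\<close> dominates all terms on the polydisc, so
  coefficients may be collected by exponent. Sums, products and compositions of power series are all
  obtained as instances.\<close>

lemma power_series_on_has_sum:
  fixes f :: "'b \<Rightarrow> 'k::ground_field ^ 'n::finite \<Rightarrow> 'k"
  assumes \<rho>: "0 < \<rho>" and f: "\<And>\<beta>. power_series_on a \<rho> (M \<beta>) (f \<beta>)"
    and sM: "((\<lambda>\<beta>. norm (c \<beta>) * M \<beta>) has_sum N) UNIV"
    and g: "\<And>x. x \<in> polydisc a \<rho> \<Longrightarrow> ((\<lambda>\<beta>. c \<beta> * f \<beta> x) has_sum g x) UNIV"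
  shows "power_series_on a \<rho> N g"
proof -
  define P where "P \<beta> E K \<longleftrightarrow> ((\<lambda>\<alpha>. norm (E \<alpha>) * \<rho> ^ mdeg \<alpha>) has_sum K) UNIV \<and> K \<le> M \<beta> \<and>
     (\<forall>x\<in>polydisc a \<rho>. ((\<lambda>\<alpha>. E \<alpha> * mpow \<alpha> (x - a)) has_sum f \<beta> x) UNIV)" for \<beta> E K
  have "\<exists>E K. P \<beta> E K" for \<beta> using f[of \<beta>] unfolding power_series_on_def P_def .
  then obtain E K where "\<And>\<beta>. P \<beta> (E \<beta>) (K \<beta>)" by metis
  then have E: "\<And>\<beta>. ((\<lambda>\<alpha>. norm (E \<beta> \<alpha>) * \<rho> ^ mdeg \<alpha>) has_sum K \<beta>) UNIV" "\<And>\<beta>. K \<beta> \<le> M \<beta>"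
     "\<And>\<beta> x. x \<in> polydisc a \<rho> \<Longrightarrow> ((\<lambda>\<alpha>. E \<beta> \<alpha> * mpow \<alpha> (x - a)) has_sum f \<beta> x) UNIV"
    unfolding P_def by blast+
  have K0: "0 \<le> K \<beta>" for \<beta> using E(1)[of \<beta>] by (rule has_sum_nonneg) (use \<rho> in simp)
  define F where "F = (\<lambda>(\<beta>, \<alpha>). norm (c \<beta>) * (norm (E \<beta> \<alpha>) * \<rho> ^ mdeg \<alpha>))"
  have F0: "0 \<le> F z" for z using \<rho> by (simp add: F_def split_def)
  have sK: "(\<lambda>\<beta>. norm (c \<beta>) * K \<beta>) summable_on UNIV"
    by (rule summable_on_comparison_test[OF has_sum_imp_summable[OF sM]]) (auto intro!: mult_left_mono E(2) mult_nonneg_nonneg K0)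
  have Fin: "((\<lambda>\<alpha>. F (\<beta>, \<alpha>)) has_sum norm (c \<beta>) * K \<beta>) UNIV" for \<beta>
    unfolding F_def split_conv by (rule has_sum_cmult_right[OF E(1)])
  have Fs: "F summable_on UNIV \<times> UNIV"
    by (rule summable_on_SigmaI[where g="\<lambda>\<beta>. norm (c \<beta>) * K \<beta>"]) (use Fin sK F0 in auto)
  obtain NF where NF: "(F has_sum NF) (UNIV \<times> UNIV)" using Fs by (auto simp: summable_on_def)
  have "((\<lambda>\<beta>. norm (c \<beta>) * K \<beta>) has_sum NF) UNIV"
    by (rule has_sum_SigmaD[OF NF]) (rule Fin)
  then have NFN: "NF \<le> N"
    by (rule has_sum_mono[OF _ sM]) (auto intro!: mult_left_mono E(2))
  have NF': "((\<lambda>(\<alpha>, \<beta>). F (\<beta>, \<alpha>)) has_sum NF) (UNIV \<times> UNIV)" using NF by (subst (asm) has_sum_swap)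
  have Fb: "(\<lambda>\<beta>. F (\<beta>, \<alpha>)) summable_on UNIV" for \<alpha>
    by (rule summable_on_SigmaD1[where A=UNIV and B="\<lambda>_. UNIV", OF has_sum_imp_summable[OF NF']]) simp
  define G where "G \<alpha> = (\<Sum>\<^sub>\<infinity>\<beta>. F (\<beta>, \<alpha>))" for \<alpha>
  have Gs: "(G has_sum NF) UNIV"
    by (rule has_sum_SigmaD[OF NF']) (use Fb in \<open>auto simp: G_def\<close>)
  have ns: "(\<lambda>\<beta>. norm (c \<beta> * E \<beta> \<alpha>)) summable_on UNIV" for \<alpha>
  proof -
    have "(\<lambda>\<beta>. F (\<beta>, \<alpha>) * inverse (\<rho> ^ mdeg \<alpha>)) summable_on UNIV"
      by (rule summable_on_cmult_left[OF Fb])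
    moreover have "F (\<beta>, \<alpha>) * inverse (\<rho> ^ mdeg \<alpha>) = norm (c \<beta> * E \<beta> \<alpha>)" for \<beta>
      using \<rho> by (simp add: F_def norm_mult)
    ultimately show ?thesis by simp
  qed
  define e where "e \<alpha> = (\<Sum>\<^sub>\<infinity>\<beta>. c \<beta> * E \<beta> \<alpha>)" for \<alpha>
  have es: "((\<lambda>\<beta>. c \<beta> * E \<beta> \<alpha>) has_sum e \<alpha>) UNIV" for \<alpha>
    unfolding e_def by (rule has_sum_infsum[OF abs_summable_summable[OF ns]])
  have eG: "norm (e \<alpha>) * \<rho> ^ mdeg \<alpha> \<le> G \<alpha>" for \<alpha>
  proof -
    have "norm (e \<alpha>) \<le> (\<Sum>\<^sub>\<infinity>\<beta>. norm (c \<beta> * E \<beta> \<alpha>))"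
      unfolding e_def by (rule norm_infsum_bound[OF ns])
    then have "norm (e \<alpha>) * \<rho> ^ mdeg \<alpha> \<le> (\<Sum>\<^sub>\<infinity>\<beta>. norm (c \<beta> * E \<beta> \<alpha>)) * \<rho> ^ mdeg \<alpha>"
      using \<rho> by (intro mult_right_mono) auto
    also have "\<dots> = (\<Sum>\<^sub>\<infinity>\<beta>. norm (c \<beta> * E \<beta> \<alpha>) * \<rho> ^ mdeg \<alpha>)"
      by (rule infsum_cmult_left'[symmetric])
    also have "\<dots> = G \<alpha>" by (simp add: G_def F_def norm_mult mult.assoc)
    finally show ?thesis .
  qed
  have "(\<lambda>\<alpha>. norm (e \<alpha>) * \<rho> ^ mdeg \<alpha>) summable_on UNIV"
    by (rule summable_on_comparison_test[OF has_sum_imp_summable[OF Gs]]) (use eG \<rho> in auto)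
  then obtain Ne where Ne: "((\<lambda>\<alpha>. norm (e \<alpha>) * \<rho> ^ mdeg \<alpha>) has_sum Ne) UNIV" by (auto simp: summable_on_def)
  have "Ne \<le> NF" by (rule has_sum_mono[OF Ne Gs]) (rule eG)
  moreover have "((\<lambda>\<alpha>. e \<alpha> * mpow \<alpha> (x - a)) has_sum g x) UNIV" if x: "x \<in> polydisc a \<rho>" for x
  proof -
    define T where "T = (\<lambda>(\<beta>, \<alpha>). c \<beta> * (E \<beta> \<alpha> * mpow \<alpha> (x - a)))"
    have "norm (T z) \<le> F z" for z
      unfolding T_def F_def split_def norm_mult
      by (intro mult_left_mono norm_mpow_le[OF x]) auto
    then have "(\<lambda>z. norm (T z)) summable_on UNIV \<times> UNIV"
      by (intro summable_on_comparison_test[OF Fs]) auto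
    then have "T summable_on UNIV \<times> UNIV" by (rule abs_summable_summable)
    then obtain S where S: "(T has_sum S) (UNIV \<times> UNIV)" by (auto simp: summable_on_def)
    have "((\<lambda>\<beta>. c \<beta> * f \<beta> x) has_sum S) UNIV"
      by (rule has_sum_SigmaD[OF S]) (auto simp: T_def intro!: has_sum_cmult_right E(3) x)
    then have "S = g x" using g[OF x] has_sum_unique by blast
    have S': "((\<lambda>(\<alpha>, \<beta>). T (\<beta>, \<alpha>)) has_sum S) (UNIV \<times> UNIV)" using S by (subst (asm) has_sum_swap)
    have "((\<lambda>\<alpha>. e \<alpha> * mpow \<alpha> (x - a)) has_sum S) UNIV"
    proof (rule has_sum_SigmaD[OF S'])
      fix \<alpha>
      have "((\<lambda>\<beta>. c \<beta> * E \<beta> \<alpha> * mpow \<alpha> (x - a)) has_sum e \<alpha> * mpow \<alpha> (x - a)) UNIV"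
        by (rule has_sum_cmult_left[OF es])
      then show "((\<lambda>\<beta>. case (\<alpha>, \<beta>) of (\<alpha>, \<beta>) \<Rightarrow> T (\<beta>, \<alpha>)) has_sum e \<alpha> * mpow \<alpha> (x - a)) UNIV"
        by (simp add: T_def mult.assoc)
    qed
    then show ?thesis using \<open>S = g x\<close> by simp
  qed
  ultimately show ?thesis unfolding power_series_on_def using Ne NFN order_trans by blast
qed

lemma mpow_add: "mpow (\<lambda>i. \<alpha> i + \<beta> i) y = mpow \<alpha> y * mpow \<beta> y"
  by (simp add: mpow_def power_add prod.distrib)

lemma mdeg_add: "mdeg (\<lambda>i. \<alpha> i + \<beta> i) = mdeg \<alpha> + mdeg \<beta>"
  by (simp add: mdeg_def sum.distrib)

lemma power_series_on_mpow_mult: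
  assumes \<rho>: "0 < \<rho>" and f: "power_series_on a \<rho> M f"
  shows "power_series_on a \<rho> (\<rho> ^ mdeg \<beta> * M) (\<lambda>x. mpow \<beta> (x - a) * f x)"
proof -
  obtain c N where c: "((\<lambda>\<alpha>. norm (c \<alpha>) * \<rho> ^ mdeg \<alpha>) has_sum N) UNIV" "N \<le> M"
    "\<And>x. x \<in> polydisc a \<rho> \<Longrightarrow> ((\<lambda>\<alpha>. c \<alpha> * mpow \<alpha> (x - a)) has_sum f x) UNIV"
    using f unfolding power_series_on_def by blast
  define sh where "sh = (\<lambda>\<gamma> i. \<gamma> i + \<beta> i)"
  have inj: "inj sh"
  proof (rule injI)
    fix x y assume "sh x = sh y"
    then show "x = y" unfolding sh_def by (metis add_right_imp_eq ext)
  qed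
  \<comment> \<open>The coefficients of \<open>f\<close> moved up by the exponent
    \<open>\<beta>\<close>, with zeros at exponents that are not reached.\<close>
  define d where "d \<alpha> = (if \<alpha> \<in> range sh then c (inv sh \<alpha>) else 0)" for \<alpha>
  have d: "d (sh \<gamma>) = c \<gamma>" for \<gamma> by (simp add: d_def inv_f_f[OF inj])
  have reindex: "(g has_sum s) UNIV" if "((\<lambda>\<gamma>. g (sh \<gamma>)) has_sum s) UNIV" "\<And>\<alpha>. \<alpha> \<notin> range sh \<Longrightarrow> g \<alpha> = 0"
    for g and s :: "'c::topological_comm_monoid_add"
  proof -
    have "(g has_sum s) (range sh)" using that(1) by (subst has_sum_reindex[OF inj]) (simp add: o_def)
    moreover have "(g has_sum s) (range sh) \<longleftrightarrow> (g has_sum s) UNIV"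
      by (rule has_sum_cong_neutral) (use that(2) in auto)
    ultimately show ?thesis by simp
  qed
  have "((\<lambda>\<alpha>. norm (d \<alpha>) * \<rho> ^ mdeg \<alpha>) has_sum \<rho> ^ mdeg \<beta> * N) UNIV"
  proof (rule reindex)
    have "((\<lambda>\<gamma>. \<rho> ^ mdeg \<beta> * (norm (c \<gamma>) * \<rho> ^ mdeg \<gamma>)) has_sum \<rho> ^ mdeg \<beta> * N) UNIV"
      by (rule has_sum_cmult_right[OF c(1)])
    moreover have "norm (d (sh \<gamma>)) * \<rho> ^ mdeg (sh \<gamma>) = \<rho> ^ mdeg \<beta> * (norm (c \<gamma>) * \<rho> ^ mdeg \<gamma>)" for \<gamma>
      unfolding d by (simp add: sh_def mdeg_add power_add)
    ultimately show "((\<lambda>\<gamma>. norm (d (sh \<gamma>)) * \<rho> ^ mdeg (sh \<gamma>)) has_sum \<rho> ^ mdeg \<beta> * N) UNIV" by simp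
  qed (simp add: d_def)
  moreover have "((\<lambda>\<alpha>. d \<alpha> * mpow \<alpha> (x - a)) has_sum mpow \<beta> (x - a) * f x) UNIV" if x: "x \<in> polydisc a \<rho>" for x
  proof (rule reindex)
    have "((\<lambda>\<gamma>. mpow \<beta> (x - a) * (c \<gamma> * mpow \<gamma> (x - a))) has_sum mpow \<beta> (x - a) * f x) UNIV"
      by (rule has_sum_cmult_right[OF c(3)[OF x]])
    moreover have "d (sh \<gamma>) * mpow (sh \<gamma>) (x - a) = mpow \<beta> (x - a) * (c \<gamma> * mpow \<gamma> (x - a))" for \<gamma>
      unfolding d by (simp add: sh_def mpow_add)
    ultimately show "((\<lambda>\<gamma>. d (sh \<gamma>) * mpow (sh \<gamma>) (x - a)) has_sum mpow \<beta> (x - a) * f x) UNIV" by simp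
  qed (simp add: d_def)
  moreover have "\<rho> ^ mdeg \<beta> * N \<le> \<rho> ^ mdeg \<beta> * M" using \<rho> c(2) by simp
  ultimately show ?thesis unfolding power_series_on_def by blast
qed

lemma power_series_on_const: "power_series_on a \<rho> (norm z) (\<lambda>_. z)"
proof -
  define c where "c \<alpha> = (if \<alpha> = (\<lambda>_. 0) then z else 0)" for \<alpha> :: "'b \<Rightarrow> nat"
  have "((\<lambda>\<alpha>. norm (c \<alpha>) * \<rho> ^ mdeg \<alpha>) has_sum norm z) UNIV"
    by (rule has_sum_finite_neutralI[of "{\<lambda>_. 0}"]) (auto simp: c_def mdeg_def)
  moreover have "((\<lambda>\<alpha>. c \<alpha> * mpow \<alpha> (x - a)) has_sum z) UNIV" for x
    by (rule has_sum_finite_neutralI[of "{\<lambda>_. 0}"]) (auto simp: c_def mpow_def)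
  ultimately show ?thesis unfolding power_series_on_def by blast
qed

text \<open>Only \<open>f\<close> is expanded, so the product is a weighted family of monomials
  times \<open>g\<close>. The weighted norm is submultiplicative, as powers inside a composition
  require.\<close>

lemma power_series_on_mult:
  assumes \<rho>: "0 < \<rho>" and f: "power_series_on a \<rho> M f" and g: "power_series_on a \<rho> N g"
  shows "power_series_on a \<rho> (M * N) (\<lambda>x. f x * g x)"
proof -
  obtain c K where c: "((\<lambda>\<alpha>. norm (c \<alpha>) * \<rho> ^ mdeg \<alpha>) has_sum K) UNIV" "K \<le> M"
    "\<And>x. x \<in> polydisc a \<rho> \<Longrightarrow> ((\<lambda>\<alpha>. c \<alpha> * mpow \<alpha> (x - a)) has_sum f x) UNIV"
    using f unfolding power_series_on_def by blast
  have "power_series_on a \<rho> (K * N) (\<lambda>x. f x * g x)"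
  proof (rule power_series_on_has_sum[OF \<rho>, where M="\<lambda>\<beta>. \<rho> ^ mdeg \<beta> * N" and c=c])
    show "power_series_on a \<rho> (\<rho> ^ mdeg \<beta> * N) (\<lambda>x. mpow \<beta> (x - a) * g x)" for \<beta>
      by (rule power_series_on_mpow_mult[OF \<rho> g])
    show "((\<lambda>\<beta>. norm (c \<beta>) * (\<rho> ^ mdeg \<beta> * N)) has_sum K * N) UNIV"
      using has_sum_cmult_left[OF c(1), of N] by (simp add: mult.assoc)
    show "((\<lambda>\<beta>. c \<beta> * (mpow \<beta> (x - a) * g x)) has_sum f x * g x) UNIV" if "x \<in> polydisc a \<rho>" for x
      using has_sum_cmult_left[OF c(3)[OF that], of "g x"] by (simp add: mult.assoc)
  qed
  moreover have "K * N \<le> M * N"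
    using c(2) power_series_on_nonneg[OF g] \<rho> by (intro mult_right_mono) auto
  ultimately show ?thesis by (rule power_series_on_mono)
qed

text \<open>The two summands are treated as a family indexed by \<open>bool\<close> with weights
  1.\<close>

lemma power_series_on_add:
  assumes \<rho>: "0 < \<rho>" and f: "power_series_on a \<rho> M f" and g: "power_series_on a \<rho> N g"
  shows "power_series_on a \<rho> (M + N) (\<lambda>x. f x + g x)"
  by (rule power_series_on_has_sum[OF \<rho>, where M="\<lambda>b. if b then M else N" and c="\<lambda>_. 1"
        and f="\<lambda>b. if b then f else g"])
    (auto simp: f g UNIV_bool add.commute intro!: has_sum_finiteI)

lemma power_series_on_sum:
  assumes "0 < \<rho>" "\<And>i. i \<in> I \<Longrightarrow> power_series_on a \<rho> (M i) (f i)"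
  shows "power_series_on a \<rho> (\<Sum>i\<in>I. M i) (\<lambda>x. \<Sum>i\<in>I. f i x)"
  using assms(2)
proof (induction I rule: infinite_finite_induct)
  case (insert i I)
  then show ?case by (simp add: power_series_on_add[OF assms(1)])
qed (use power_series_on_const[of a \<rho> 0] in simp_all)

lemma power_series_on_power:
  assumes "0 < \<rho>" "power_series_on a \<rho> M f"
  shows "power_series_on a \<rho> (M ^ j) (\<lambda>x. f x ^ j)"
proof (induction j)
  case 0
  then show ?case using power_series_on_const[of a \<rho> 1] by simp
next
  case (Suc j)
  then show ?case by (simp add: power_series_on_mult[OF assms])
qed

lemma power_series_on_prod:
  assumes "0 < \<rho>" "\<And>i. i \<in> I \<Longrightarrow> power_series_on a \<rho> (M i) (f i)"
  shows "power_series_on a \<rho> (\<Prod>i\<in>I. M i) (\<lambda>x. \<Prod>i\<in>I. f i x)"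
  using assms(2)
proof (induction I rule: infinite_finite_induct)
  case (insert i I)
  then show ?case by (simp add: power_series_on_mult[OF assms(1)])
qed (use power_series_on_const[of a \<rho> 1] in simp_all)

text \<open>A coordinate is a degree-one monomial around \<open>a\<close> plus a constant. Allowing
  \<open>z\<close> other than \<open>a $ i\<close> serves the change of centre.\<close>

lemma power_series_on_coordinate:
  assumes \<rho>: "0 < \<rho>"
  shows "power_series_on a \<rho> (\<rho> + norm (a $ i - z)) (\<lambda>x. x $ i - z)"
proof -
  define \<beta> :: "'b \<Rightarrow> nat" where "\<beta> j = (if j = i then 1 else 0)" for j
  have \<beta>: "mdeg \<beta> = 1" "mpow \<beta> y = y $ i" for y :: "'a^'b"
    by (simp_all add: mdeg_def mpow_def \<beta>_def if_distrib prod.delta cong: if_cong)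
  have "power_series_on a \<rho> (\<rho> ^ mdeg \<beta> * norm (1 :: 'a)) (\<lambda>x. mpow \<beta> (x - a) * 1)"
    by (rule power_series_on_mpow_mult[OF \<rho> power_series_on_const])
  then have "power_series_on a \<rho> (\<rho> * 1) (\<lambda>x. (x - a) $ i)" by (simp only: \<beta> power_one_right mult_1_right norm_one)
  from power_series_on_add[OF \<rho> this power_series_on_const[of a \<rho> "a $ i - z"]]
  show ?thesis by simp
qed

text \<open>The bound \<open>R\<close> for the inner components does two things: it keeps their
  values in the polydisc of \<open>f\<close>, and it bounds each substituted monomial by
  \<open>R ^ mdeg \<beta>\<close>, so the coefficient norm of \<open>f\<close> bounds the
  total.\<close>

lemma power_series_on_comp:
  assumes \<rho>: "0 < \<rho>" and R: "0 \<le> R" and f: "power_series_on b R M f"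
    and \<phi>: "\<And>i. power_series_on a \<rho> R (\<lambda>x. \<phi> x $ i - b $ i)"
  shows "power_series_on a \<rho> M (\<lambda>x. f (\<phi> x))"
proof -
  obtain c K where c: "((\<lambda>\<alpha>. norm (c \<alpha>) * R ^ mdeg \<alpha>) has_sum K) UNIV" "K \<le> M"
    "\<And>x. x \<in> polydisc b R \<Longrightarrow> ((\<lambda>\<alpha>. c \<alpha> * mpow \<alpha> (x - b)) has_sum f x) UNIV"
    using f unfolding power_series_on_def by blast
  have "power_series_on a \<rho> K (\<lambda>x. f (\<phi> x))"
  proof (rule power_series_on_has_sum[OF \<rho>, where M="\<lambda>\<beta>. R ^ mdeg \<beta>" and c=c])
    show "power_series_on a \<rho> (R ^ mdeg \<beta>) (\<lambda>x. mpow \<beta> (\<phi> x - b))" for \<beta>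
    proof -
      have "power_series_on a \<rho> (\<Prod>i\<in>UNIV. R ^ \<beta> i) (\<lambda>x. \<Prod>i\<in>UNIV. (\<phi> x $ i - b $ i) ^ \<beta> i)"
        by (intro power_series_on_prod power_series_on_power \<rho> \<phi>)
      then show ?thesis by (simp add: mpow_def mdeg_def power_sum)
    qed
    show "((\<lambda>\<beta>. norm (c \<beta>) * R ^ mdeg \<beta>) has_sum K) UNIV" by (rule c(1))
    show "((\<lambda>\<beta>. c \<beta> * mpow \<beta> (\<phi> x - b)) has_sum f (\<phi> x)) UNIV" if "x \<in> polydisc a \<rho>" for x
      by (rule c(3)) (use power_series_on_bound[OF \<phi> that] in \<open>simp add: polydisc_def\<close>)
  qed
  then show ?thesis using c(2) by (rule power_series_on_mono)
qed

lemma power_series_on_shrink: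
  assumes f: "power_series_on a \<rho> M f" and r: "0 < r" "r \<le> \<rho>"
  shows "power_series_on a r M f"
proof -
  obtain c K where c: "((\<lambda>\<alpha>. norm (c \<alpha>) * \<rho> ^ mdeg \<alpha>) has_sum K) UNIV" "K \<le> M"
    "\<And>x. x \<in> polydisc a \<rho> \<Longrightarrow> ((\<lambda>\<alpha>. c \<alpha> * mpow \<alpha> (x - a)) has_sum f x) UNIV"
    using f unfolding power_series_on_def by blast
  have le: "norm (c \<alpha>) * r ^ mdeg \<alpha> \<le> norm (c \<alpha>) * \<rho> ^ mdeg \<alpha>" for \<alpha>
    using r by (intro mult_left_mono power_mono) auto
  have "(\<lambda>\<alpha>. norm (c \<alpha>) * r ^ mdeg \<alpha>) summable_on UNIV"
    by (rule summable_on_comparison_test[OF has_sum_imp_summable[OF c(1)]]) (use le r in auto)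
  then obtain K' where K': "((\<lambda>\<alpha>. norm (c \<alpha>) * r ^ mdeg \<alpha>) has_sum K') UNIV" by (auto simp: summable_on_def)
  have "K' \<le> K" by (rule has_sum_mono[OF K' c(1)]) (rule le)
  moreover have "polydisc a r \<subseteq> polydisc a \<rho>" using r(2) by (auto simp: polydisc_def intro: order_trans)
  ultimately show ?thesis unfolding power_series_on_def using K' c(2,3) by (meson order_trans subsetD)
qed

text \<open>Each monomial of positive degree is assigned to one variable that occurs in it and
  divided by that variable. The division costs at most a factor \<open>inverse \<rho>\<close> in the
  norm.\<close>

lemma power_series_on_hadamard:
  assumes \<rho>: "0 < \<rho>" and f: "power_series_on a \<rho> M f"
  shows "\<exists>G N. (\<forall>i. power_series_on a \<rho> (N i) (G i)) \<and>
           (\<forall>x\<in>polydisc a \<rho>. f x = f a + (\<Sum>i\<in>UNIV. (x $ i - a $ i) * G i x))"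
proof -
  obtain c K where c: "((\<lambda>\<alpha>. norm (c \<alpha>) * \<rho> ^ mdeg \<alpha>) has_sum K) UNIV" "K \<le> M"
    "\<And>x. x \<in> polydisc a \<rho> \<Longrightarrow> ((\<lambda>\<alpha>. c \<alpha> * mpow \<alpha> (x - a)) has_sum f x) UNIV"
    using f unfolding power_series_on_def by blast
  define \<iota> :: "('b \<Rightarrow> nat) \<Rightarrow> 'b" where "\<iota> \<alpha> = (SOME i. \<alpha> i \<noteq> 0)" for \<alpha>
  have \<iota>: "\<alpha> (\<iota> \<alpha>) \<noteq> 0" if "\<alpha> \<noteq> (\<lambda>_. 0)" for \<alpha>
  proof -
    have "\<exists>i. \<alpha> i \<noteq> 0" using that by auto
    then show ?thesis unfolding \<iota>_def by (rule someI_ex)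
  qed
  \<comment> \<open>The coefficients are partitioned by the chosen variable
    \<open>\<iota> \<alpha>\<close>, so that no monomial is counted twice when the parts are
    added.\<close>
  define d where "d i \<alpha> = (if \<alpha> \<noteq> (\<lambda>_. 0) \<and> \<iota> \<alpha> = i then c \<alpha> else 0)" for i \<alpha>
  define low where "low i \<alpha> = \<alpha>(i := \<alpha> i - 1)" for i and \<alpha> :: "'b \<Rightarrow> nat"
  have up: "mdeg \<alpha> = Suc (mdeg (low i \<alpha>))" "mpow \<alpha> y = y $ i * mpow (low i \<alpha>) y"
    if "d i \<alpha> \<noteq> 0" for i \<alpha> and y :: "'a^'b"
  proof -
    have nz: "\<alpha> i \<noteq> 0" using that \<iota>[of \<alpha>] by (auto simp: d_def split: if_splits)
    define e where "e j = (if j = i then 1 else 0 :: nat)" for j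
    have \<alpha>: "\<alpha> = (\<lambda>j. low i \<alpha> j + e j)" using nz by (auto simp: low_def e_def)
    have e: "mdeg e = 1" "mpow e y = y $ i"
      by (simp_all add: mdeg_def mpow_def e_def if_distrib prod.delta cong: if_cong)
    have "mdeg \<alpha> = mdeg (\<lambda>j. low i \<alpha> j + e j)" using \<alpha> by (rule arg_cong)
    then show "mdeg \<alpha> = Suc (mdeg (low i \<alpha>))" by (simp add: mdeg_add e)
    have "mpow \<alpha> y = mpow (\<lambda>j. low i \<alpha> j + e j) y" using \<alpha> by (rule arg_cong)
    then show "mpow \<alpha> y = y $ i * mpow (low i \<alpha>) y" by (simp add: mpow_add e mult.commute)
  qed
  have dle: "norm (d i \<alpha>) * \<rho> ^ mdeg (low i \<alpha>) \<le> norm (c \<alpha>) * \<rho> ^ mdeg \<alpha> * inverse \<rho>" for i \<alpha>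
  proof (cases "d i \<alpha> = 0")
    case False
    then have "d i \<alpha> = c \<alpha>" by (auto simp: d_def split: if_splits)
    then show ?thesis using up(1)[OF False] \<rho> by (simp add: field_simps)
  qed (use \<rho> in simp)
  have Ns: "(\<lambda>\<alpha>. norm (d i \<alpha>) * \<rho> ^ mdeg (low i \<alpha>)) summable_on UNIV" for i
  proof (rule summable_on_comparison_test)
    show "(\<lambda>\<alpha>. norm (c \<alpha>) * \<rho> ^ mdeg \<alpha> * inverse \<rho>) summable_on UNIV"
      by (rule summable_on_cmult_left[OF has_sum_imp_summable[OF c(1)]])
    show "norm (d i \<alpha>) * \<rho> ^ mdeg (low i \<alpha>) \<le> norm (c \<alpha>) * \<rho> ^ mdeg \<alpha> * inverse \<rho>" for \<alpha>
      by (rule dle)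
    show "0 \<le> norm (d i \<alpha>) * \<rho> ^ mdeg (low i \<alpha>)" for \<alpha>
      using \<rho> by simp
  qed
  define N where "N i = (\<Sum>\<^sub>\<infinity>\<alpha>. norm (d i \<alpha>) * \<rho> ^ mdeg (low i \<alpha>))" for i
  have N: "((\<lambda>\<alpha>. norm (d i \<alpha>) * \<rho> ^ mdeg (low i \<alpha>)) has_sum N i) UNIV" for i
    unfolding N_def by (rule has_sum_infsum[OF Ns])
  define G where "G i x = (\<Sum>\<^sub>\<infinity>\<alpha>. d i \<alpha> * mpow (low i \<alpha>) (x - a))" for i x
  have G: "((\<lambda>\<alpha>. d i \<alpha> * mpow (low i \<alpha>) (x - a)) has_sum G i x) UNIV" if x: "x \<in> polydisc a \<rho>" for i x
  proof -
    have "(\<lambda>\<alpha>. norm (d i \<alpha> * mpow (low i \<alpha>) (x - a))) summable_on UNIV"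
      by (rule summable_on_comparison_test[OF has_sum_imp_summable[OF N[of i]]])
        (auto simp: norm_mult intro!: mult_left_mono norm_mpow_le x)
    from has_sum_infsum[OF abs_summable_summable[OF this]] show ?thesis unfolding G_def .
  qed
  have PG: "power_series_on a \<rho> (N i) (G i)" for i
  proof (rule power_series_on_has_sum[OF \<rho>, where M="\<lambda>\<alpha>. \<rho> ^ mdeg (low i \<alpha>)" and c="d i"])
    show "power_series_on a \<rho> (\<rho> ^ mdeg (low i \<alpha>)) (\<lambda>x. mpow (low i \<alpha>) (x - a))" for \<alpha>
      using power_series_on_mpow_mult[OF \<rho> power_series_on_const[of a \<rho> 1], of "low i \<alpha>"] by simp
  qed (use N G in auto)
  have exp: "f x = c (\<lambda>_. 0) + (\<Sum>i\<in>UNIV. (x $ i - a $ i) * G i x)" if x: "x \<in> polydisc a \<rho>" for x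
  proof -
    have "((\<lambda>\<alpha>. (if \<alpha> = (\<lambda>_. 0) then c \<alpha> else 0) + (\<Sum>i\<in>UNIV. (x $ i - a $ i) * (d i \<alpha> * mpow (low i \<alpha>) (x - a)))) has_sum
        (c (\<lambda>_. 0) + (\<Sum>i\<in>UNIV. (x $ i - a $ i) * G i x))) UNIV"
      by (intro has_sum_add has_sum_sum has_sum_cmult_right G x has_sum_finite_neutralI[of "{\<lambda>_. 0}"]) auto
    moreover have "(if \<alpha> = (\<lambda>_. 0) then c \<alpha> else 0) + (\<Sum>i\<in>UNIV. (x $ i - a $ i) * (d i \<alpha> * mpow (low i \<alpha>) (x - a))) =
        c \<alpha> * mpow \<alpha> (x - a)" for \<alpha>
    proof -
      have "(x $ i - a $ i) * (d i \<alpha> * mpow (low i \<alpha>) (x - a)) = d i \<alpha> * mpow \<alpha> (x - a)" for i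
        using up(2)[of i \<alpha> "x - a"] by (cases "d i \<alpha> = 0") simp_all
      then have "(\<Sum>i\<in>UNIV. (x $ i - a $ i) * (d i \<alpha> * mpow (low i \<alpha>) (x - a))) = (\<Sum>i\<in>UNIV. d i \<alpha>) * mpow \<alpha> (x - a)"
        unfolding sum_distrib_right by (intro sum.cong refl)
      moreover have "(\<Sum>i\<in>UNIV. d i \<alpha>) = (if \<alpha> = (\<lambda>_. 0) then 0 else c \<alpha>)"
        by (cases "\<alpha> = (\<lambda>_. 0)") (simp_all add: d_def)
      ultimately show ?thesis by (simp add: mpow_def)
    qed
    ultimately show ?thesis using c(3)[OF x] has_sum_unique by simp blast
  qed
  have "f a = c (\<lambda>_. 0)" using exp[OF center_in_polydisc] \<rho> by simp
  then show ?thesis using PG exp by (intro exI[of _ G] exI[of _ N]) simp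
qed

lemma power_series_on_imp_at:
  assumes "0 < \<rho>" "power_series_on a \<rho> M f" shows "power_series_at f a"
proof -
  obtain c where c: "\<And>x. x \<in> polydisc a \<rho> \<Longrightarrow> ((\<lambda>\<alpha>. c \<alpha> * mpow \<alpha> (x - a)) has_sum f x) UNIV"
    using assms(2) unfolding power_series_on_def by blast
  have "x \<in> polydisc a \<rho>" if "x \<in> ball a \<rho>" for x
    unfolding polydisc_def
  proof (intro CollectI allI)
    fix i
    have "norm ((x - a) $ i) \<le> norm (x - a)" by (rule Finite_Cartesian_Product.norm_nth_le)
    then show "norm (x $ i - a $ i) \<le> \<rho>" using that by (simp add: dist_norm norm_minus_commute)
  qed
  then show ?thesis unfolding power_series_at_def using assms(1) c
    by (intro exI[of _ c] exI[of _ \<rho>]) (simp add: mpow_def)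
qed

lemma norm_vec_le_card_mult:
  fixes x :: "'b::real_normed_vector ^ 'n::finite" and r :: real
  assumes "\<And>i. norm (x $ i) \<le> r" shows "norm x \<le> real CARD('n) * r"
proof -
  have "norm x \<le> (\<Sum>i\<in>UNIV. norm (x $ i))" unfolding norm_vec_def by (rule L2_set_le_sum) simp
  also have "\<dots> \<le> (\<Sum>i\<in>(UNIV :: 'n set). r)" by (intro sum_mono assms)
  finally show ?thesis by simp
qed

lemma polydisc_subset_ball:
  fixes a :: "'k::ground_field ^ 'n::finite"
  assumes "0 < r" shows "polydisc a (r / (2 * CARD('n))) \<subseteq> ball a r"
proof
  fix x assume "x \<in> polydisc a (r / (2 * CARD('n)))"
  then have "norm (x - a) \<le> real CARD('n) * (r / (2 * CARD('n)))"
    by (intro norm_vec_le_card_mult) (simp add: polydisc_def)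
  also have "\<dots> < r" using assms by simp
  finally show "x \<in> ball a r" by (simp add: dist_norm norm_minus_commute)
qed

lemma power_series_at_imp_on:
  fixes f :: "'k::ground_field ^ 'n::finite \<Rightarrow> 'k"
  assumes "power_series_at f a" shows "\<exists>\<rho>>0. \<exists>M. power_series_on a \<rho> M f"
proof -
  obtain c r where r: "0 < r" and
    c: "\<And>x. x \<in> ball a r \<Longrightarrow> ((\<lambda>\<alpha>. c \<alpha> * (\<Prod>i\<in>UNIV. (x $ i - a $ i) ^ \<alpha> i)) has_sum f x) UNIV"
    using assms unfolding power_series_at_def by blast
  \<comment> \<open>The norm is at most the sum of the coordinate norms, so a polydisc of this
    radius lies within distance \<open>r / 2\<close> of the centre.\<close>
  define \<rho> where "\<rho> = r / (2 * CARD('n))"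
  have \<rho>: "0 < \<rho>" using r by (simp add: \<rho>_def)
  have ball: "polydisc a \<rho> \<subseteq> ball a r" unfolding \<rho>_def by (rule polydisc_subset_ball[OF r])
  \<comment> \<open>At the point displaced by \<open>\<rho>\<close> in every coordinate the
    monomials take the values \<open>\<rho> ^ mdeg \<alpha>\<close>. Absolute convergence at this
    single point is the required weighted norm.\<close>
  define y where "y = (\<chi> i. a $ i + of_real \<rho>)"
  have "y \<in> polydisc a \<rho>" using \<rho> by (simp add: y_def polydisc_def)
  then have "((\<lambda>\<alpha>. c \<alpha> * of_real (\<rho> ^ mdeg \<alpha>)) has_sum f y) UNIV"
    using c[of y] ball by (auto simp: y_def power_sum mdeg_def)
  then have "(\<lambda>\<alpha>. norm (c \<alpha> * of_real (\<rho> ^ mdeg \<alpha>))) summable_on UNIV"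
    by (intro summable_imp_norm_summable has_sum_imp_summable)
  then have "(\<lambda>\<alpha>. norm (c \<alpha>) * \<rho> ^ mdeg \<alpha>) summable_on UNIV"
    using \<rho> by (simp add: norm_mult norm_power)
  then obtain M where "((\<lambda>\<alpha>. norm (c \<alpha>) * \<rho> ^ mdeg \<alpha>) has_sum M) UNIV" by (auto simp: summable_on_def)
  then have "power_series_on a \<rho> M f"
    unfolding power_series_on_def using c ball by (intro exI[of _ c] exI[of _ M]) (auto simp: mpow_def)
  then show ?thesis using \<rho> by blast
qed

text \<open>Change of centre is composition with the identity: on the polydisc of radius
  \<open>\<rho> / 2\<close> around \<open>b\<close>, each \<open>x $ i - a $ i\<close> has norm at
  most \<open>\<rho> / 2 + \<rho> / 2\<close>.\<close>

lemma power_series_on_imp_at_nearby: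
  assumes \<rho>: "0 < \<rho>" and f: "power_series_on a \<rho> M f" and b: "b \<in> polydisc a (\<rho> / 2)"
  shows "power_series_at f b"
proof -
  have r: "0 < \<rho> / 2" using \<rho> by simp
  have "power_series_on b (\<rho> / 2) \<rho> (\<lambda>x. x $ i - a $ i)" for i
  proof (rule power_series_on_mono[OF power_series_on_coordinate[OF r]])
    have "norm (b $ i - a $ i) \<le> \<rho> / 2" using b by (simp add: polydisc_def)
    then show "\<rho> / 2 + norm (b $ i - a $ i) \<le> \<rho>" by linarith
  qed
  then have "power_series_on b (\<rho> / 2) M (\<lambda>x. f x)"
    using \<rho> by (intro power_series_on_comp[OF r _ f]) auto
  then show ?thesis using power_series_on_imp_at[OF r] by blast
qed

text \<open>By Hadamard's lemma \<open>f - f a\<close> is a sum of terms with a factor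
  \<open>x $ i - a $ i\<close>, of norm \<open>r\<close> on radius \<open>r\<close>. Composition
  needs this to fit the inner map into the polydisc of the outer one.\<close>

lemma power_series_on_small:
  assumes \<rho>: "0 < \<rho>" and f: "power_series_on a \<rho> M f" and e: "0 < e"
  shows "\<exists>r. 0 < r \<and> r \<le> \<rho> \<and> power_series_on a r e (\<lambda>x. f x - f a)"
proof -
  obtain G N where G: "\<And>i. power_series_on a \<rho> (N i) (G i)"
    "\<And>x. x \<in> polydisc a \<rho> \<Longrightarrow> f x = f a + (\<Sum>i\<in>UNIV. (x $ i - a $ i) * G i x)"
    using power_series_on_hadamard[OF \<rho> f] by blast
  have N0: "0 \<le> N i" for i using power_series_on_nonneg[OF G(1)] \<rho> by simp
  define S where "S = (\<Sum>i\<in>UNIV. N i)"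
  have S: "0 \<le> S" unfolding S_def by (rule sum_nonneg) (rule N0)
  \<comment> \<open>The added 1 keeps the quotient meaningful when all \<open>N i\<close> are
    zero.\<close>
  define r where "r = min \<rho> (e / (S + 1))"
  have r: "0 < r" "r \<le> \<rho>" "r * S \<le> e"
  proof -
    show "0 < r" "r \<le> \<rho>" using \<rho> e S by (auto simp: r_def)
    have "r * S \<le> e / (S + 1) * S" using S by (intro mult_right_mono) (auto simp: r_def)
    also have "\<dots> \<le> e" using S e by (simp add: field_simps)
    finally show "r * S \<le> e" .
  qed
  have "power_series_on a r (r * N i) (\<lambda>x. (x $ i - a $ i) * G i x)" for i
    using power_series_on_mult[OF r(1) power_series_on_coordinate[OF r(1), of a i "a $ i"]
        power_series_on_shrink[OF G(1) r(1,2)]] by simp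
  then have "power_series_on a r (\<Sum>i\<in>UNIV. r * N i) (\<lambda>x. \<Sum>i\<in>UNIV. (x $ i - a $ i) * G i x)"
    by (intro power_series_on_sum r)
  then have "power_series_on a r e (\<lambda>x. \<Sum>i\<in>UNIV. (x $ i - a $ i) * G i x)"
    by (rule power_series_on_mono) (use r(3) in \<open>simp add: S_def sum_distrib_left\<close>)
  then have "power_series_on a r e (\<lambda>x. f x - f a)"
  proof (rule power_series_on_cong)
    fix x assume "x \<in> polydisc a r"
    then have "x \<in> polydisc a \<rho>" using r(2) by (auto simp: polydisc_def intro: order_trans)
    then show "(\<Sum>i\<in>UNIV. (x $ i - a $ i) * G i x) = f x - f a" by (simp add: G(2))
  qed
  then show ?thesis using r by blast
qed

lemma power_series_at_imp_isCont:
  fixes f :: "'k::ground_field ^ 'n::finite \<Rightarrow> 'k"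
  assumes "power_series_at f a" shows "isCont f a"
  unfolding isCont_def LIM_eq
proof (intro allI impI)
  fix e :: real assume e: "0 < e"
  obtain \<rho> M where \<rho>: "0 < \<rho>" "power_series_on a \<rho> M f" using power_series_at_imp_on[OF assms] by blast
  obtain r where r: "0 < r" "power_series_on a r (e / 2) (\<lambda>x. f x - f a)"
    using power_series_on_small[OF \<rho>, of "e / 2"] e by auto
  have "norm (f x - f a) < e" if "norm (x - a) < r" for x
  proof -
    have "norm ((x - a) $ i) \<le> norm (x - a)" for i by (rule Finite_Cartesian_Product.norm_nth_le)
    then have "x \<in> polydisc a r" using that by (auto simp: polydisc_def intro: order_trans less_imp_le)
    from power_series_on_bound[OF r(2) this] e show ?thesis by simp
  qed
  then show "\<exists>s>0. \<forall>x. x \<noteq> a \<and> norm (x - a) < s \<longrightarrow> norm (f x - f a) < e" using r(1) by blast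
qed

lemma power_series_at_comp:
  fixes f :: "'k::ground_field ^ 'm::finite \<Rightarrow> 'k" and \<phi> :: "'k ^ 'n::finite \<Rightarrow> 'k ^ 'm"
  assumes f: "power_series_at f (\<phi> a)" and \<phi>: "\<And>i. power_series_at (\<lambda>x. \<phi> x $ i) a"
  shows "power_series_at (\<lambda>x. f (\<phi> x)) a"
proof -
  obtain R M where R: "0 < R" "power_series_on (\<phi> a) R M f" using power_series_at_imp_on[OF f] by blast
  have "\<exists>r. 0 < r \<and> power_series_on a r R (\<lambda>x. \<phi> x $ i - \<phi> a $ i)" for i
    using power_series_at_imp_on[OF \<phi>[of i]] power_series_on_small[OF _ _ R(1)] by blast
  then obtain r where r: "\<And>i. 0 < r i" "\<And>i. power_series_on a (r i) R (\<lambda>x. \<phi> x $ i - \<phi> a $ i)" by metis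
  define \<rho> where "\<rho> = Min (range r)"
  have \<rho>: "0 < \<rho>" "\<rho> \<le> r i" for i using r(1) by (auto simp: \<rho>_def)
  have "power_series_on a \<rho> M (\<lambda>x. f (\<phi> x))"
    using R by (intro power_series_on_comp[OF \<rho>(1) _ R(2)] power_series_on_shrink[OF r(2) \<rho>]) simp_all
  then show ?thesis by (rule power_series_on_imp_at[OF \<rho>(1)])
qed

lemma power_series_at_binary:
  assumes f: "power_series_at f a" and g: "power_series_at g a"
  shows power_series_at_add: "power_series_at (\<lambda>x. f x + g x) a"
    and power_series_at_mult: "power_series_at (\<lambda>x. f x * g x) a"
proof -
  obtain r s M N where rs: "0 < r" "power_series_on a r M f" "0 < s" "power_series_on a s N g"
    using power_series_at_imp_on[OF f] power_series_at_imp_on[OF g] by blast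
  define \<rho> where "\<rho> = min r s"
  have \<rho>: "0 < \<rho>" "\<rho> \<le> r" "\<rho> \<le> s" using rs by (auto simp: \<rho>_def)
  note fg = power_series_on_shrink[OF rs(2) \<rho>(1,2)] power_series_on_shrink[OF rs(4) \<rho>(1,3)]
  show "power_series_at (\<lambda>x. f x + g x) a" "power_series_at (\<lambda>x. f x * g x) a"
    using power_series_on_imp_at[OF \<rho>(1)] power_series_on_add[OF \<rho>(1) fg] power_series_on_mult[OF \<rho>(1) fg] by blast+
qed

lemma power_series_at_const: "power_series_at (\<lambda>_. c) a"
  by (rule power_series_on_imp_at[OF zero_less_one power_series_on_const])

lemma power_series_at_hadamard:
  fixes f :: "'k::ground_field ^ 'n::finite \<Rightarrow> 'k"
  assumes "power_series_at f a"
  shows "\<exists>r>0. \<exists>G. (\<forall>i. \<forall>x\<in>ball a r. power_series_at (G i) x) \<and>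
           (\<forall>x\<in>ball a r. f x = f a + (\<Sum>i\<in>UNIV. (x $ i - a $ i) * G i x))"
proof -
  obtain \<rho> M where \<rho>: "0 < \<rho>" "power_series_on a \<rho> M f" using power_series_at_imp_on[OF assms] by blast
  obtain G N where G: "\<And>i. power_series_on a \<rho> (N i) (G i)"
    "\<And>x. x \<in> polydisc a \<rho> \<Longrightarrow> f x = f a + (\<Sum>i\<in>UNIV. (x $ i - a $ i) * G i x)"
    using power_series_on_hadamard[OF \<rho>] by blast
  have "x \<in> polydisc a (\<rho> / 2) \<and> x \<in> polydisc a \<rho>" if "x \<in> ball a (\<rho> / 2)" for x
  proof -
    have "norm (x - a) < \<rho> / 2" using that by (simp add: dist_norm norm_minus_commute)
    then have le: "norm (x $ i - a $ i) \<le> \<rho> / 2" for i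
      using Finite_Cartesian_Product.norm_nth_le[of "x - a" i] unfolding vector_minus_component by linarith
    have "norm (x $ i - a $ i) \<le> \<rho>" for i using le[of i] \<rho>(1) by linarith
    then show ?thesis using le unfolding polydisc_def by blast
  qed
  then have "\<forall>i. \<forall>x\<in>ball a (\<rho> / 2). power_series_at (G i) x"
    "\<forall>x\<in>ball a (\<rho> / 2). f x = f a + (\<Sum>i\<in>UNIV. (x $ i - a $ i) * G i x)"
    using power_series_on_imp_at_nearby[OF \<rho>(1) G(1)] G(2) by blast+
  moreover have "0 < \<rho> / 2" using \<rho>(1) by simp
  ultimately show ?thesis by blast
qed

subsection \<open>Continuously differentiable functions\<close>

lemma Ck_on_subset: "Ck_on j S f \<Longrightarrow> T \<subseteq> S \<Longrightarrow> Ck_on j T f"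
proof (induction j arbitrary: f)
  case 0
  then show ?case using continuous_on_subset by auto
next
  case (Suc j)
  then show ?case by (auto, blast)
qed

lemma has_derivative_imp_continuous_on:
  assumes "\<And>x. x \<in> S \<Longrightarrow> (f has_derivative f' x) (at x)" shows "continuous_on S f"
  using assms by (meson continuous_at_imp_continuous_on has_derivative_continuous)

lemma Ck_on_Suc_imp: "Ck_on (Suc j) S f \<Longrightarrow> Ck_on j S f"
proof (induction j arbitrary: f)
  case 0
  then obtain g where "\<forall>x\<in>S. (f has_derivative (\<lambda>h. \<Sum>i\<in>UNIV. g i x * h $ i)) (at x)" by auto
  then show ?case using has_derivative_imp_continuous_on[of S f "\<lambda>x h. \<Sum>i\<in>UNIV. g i x * h $ i"] by simp
next
  case (Suc j)
  obtain g where "\<forall>x\<in>S. (f has_derivative (\<lambda>h. \<Sum>i\<in>UNIV. g i x * h $ i)) (at x)" "\<forall>i. Ck_on (Suc j) S (g i)"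
    using Suc.prems by auto
  then show ?case using Suc.IH by auto
qed

lemma Ck_on_continuous: "Ck_on j S f \<Longrightarrow> continuous_on S f"
  by (induction j) (auto dest: Ck_on_Suc_imp simp del: Ck_on.simps(2))

lemma Ck_on_cong:
  assumes "open S" "Ck_on j S f" "\<And>x. x \<in> S \<Longrightarrow> f x = g x"
  shows "Ck_on j S g"
proof (cases j)
  case 0
  then show ?thesis using assms by (simp cong: continuous_on_cong)
next
  case (Suc j')
  then obtain h where h: "\<forall>x\<in>S. (f has_derivative (\<lambda>v. \<Sum>i\<in>UNIV. h i x * v $ i)) (at x)" "\<forall>i. Ck_on j' S (h i)"
    using assms(2) by auto
  have "(g has_derivative (\<lambda>v. \<Sum>i\<in>UNIV. h i x * v $ i)) (at x)" if "x \<in> S" for x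
    by (rule has_derivative_transform_within_open[OF _ assms(1) that assms(3)]) (use h that in auto)
  then show ?thesis using h Suc by auto
qed

lemma Ck_on_const: "Ck_on j S (\<lambda>_. c)"
proof (induction j arbitrary: c)
  case (Suc j)
  show ?case by (auto intro!: exI[of _ "\<lambda>_ _. 0"] derivative_eq_intros Suc)
qed simp

lemma Ck_on_add: "Ck_on j S f \<Longrightarrow> Ck_on j S g \<Longrightarrow> Ck_on j S (\<lambda>x. f x + g x)"
proof (induction j arbitrary: f g)
  case 0
  then show ?case by (auto intro!: continuous_intros)
next
  case (Suc j)
  obtain f' where f': "\<forall>x\<in>S. (f has_derivative (\<lambda>h. \<Sum>i\<in>UNIV. f' i x * h $ i)) (at x)" "\<forall>i. Ck_on j S (f' i)"
    using Suc.prems by auto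
  obtain g' where g': "\<forall>x\<in>S. (g has_derivative (\<lambda>h. \<Sum>i\<in>UNIV. g' i x * h $ i)) (at x)" "\<forall>i. Ck_on j S (g' i)"
    using Suc.prems by auto
  have "((\<lambda>x. f x + g x) has_derivative (\<lambda>h. \<Sum>i\<in>UNIV. (f' i x + g' i x) * h $ i)) (at x)" if "x \<in> S" for x
    by (rule has_derivative_eq_rhs[OF has_derivative_add[OF f'(1)[rule_format, OF that] g'(1)[rule_format, OF that]]])
      (simp add: sum.distrib algebra_simps)
  then show ?case using f'(2) g'(2) Suc.IH unfolding Ck_on.simps
    by (intro exI[of _ "\<lambda>i x. f' i x + g' i x"]) auto
qed

lemma Ck_on_mult: "Ck_on j S f \<Longrightarrow> Ck_on j S g \<Longrightarrow> Ck_on j S (\<lambda>x. f x * g x)"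
proof (induction j arbitrary: f g)
  case 0
  then show ?case by (auto intro!: continuous_intros)
next
  case (Suc j)
  obtain f' where f': "\<forall>x\<in>S. (f has_derivative (\<lambda>h. \<Sum>i\<in>UNIV. f' i x * h $ i)) (at x)" "\<forall>i. Ck_on j S (f' i)"
    using Suc.prems by auto
  obtain g' where g': "\<forall>x\<in>S. (g has_derivative (\<lambda>h. \<Sum>i\<in>UNIV. g' i x * h $ i)) (at x)" "\<forall>i. Ck_on j S (g' i)"
    using Suc.prems by auto
  have "((\<lambda>x. f x * g x) has_derivative (\<lambda>h. \<Sum>i\<in>UNIV. (f x * g' i x + f' i x * g x) * h $ i)) (at x)" if "x \<in> S" for x
    by (rule has_derivative_eq_rhs[OF has_derivative_mult[OF f'(1)[rule_format, OF that] g'(1)[rule_format, OF that]]])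
      (simp add: sum.distrib algebra_simps sum_distrib_left sum_distrib_right)
  then show ?case using f'(2) g'(2) Suc.IH Ck_on_Suc_imp[OF Suc.prems(1)] Ck_on_Suc_imp[OF Suc.prems(2)]
    unfolding Ck_on.simps
    by (intro exI[of _ "\<lambda>i x. f x * g' i x + f' i x * g x"]) (auto intro!: Ck_on_add)
qed

lemma Ck_on_sum: "(\<And>i. i \<in> I \<Longrightarrow> Ck_on j S (f i)) \<Longrightarrow> Ck_on j S (\<lambda>x. \<Sum>i\<in>I. f i x)"
  by (induction I rule: infinite_finite_induct) (auto intro: Ck_on_const Ck_on_add)

lemma bounded_linear_axis: "bounded_linear (axis i :: 'b::real_normed_vector \<Rightarrow> 'b ^ 'n::finite)"
proof (rule bounded_linear_intro[of _ 1])
  fix x :: 'b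
  have "norm (axis i x :: 'b ^ 'n) \<le> (\<Sum>j\<in>UNIV. norm ((axis i x :: 'b ^ 'n) $ j))"
    unfolding norm_vec_def by (rule L2_set_le_sum) simp
  also have "\<dots> = norm x" by (simp add: axis_def if_distrib cong: if_cong)
  finally show "norm (axis i x :: 'b ^ 'n) \<le> norm x * 1" by simp
qed (simp_all add: vec_eq_iff axis_def)

lemma has_derivative_vec_lambda:
  fixes f :: "'n::finite \<Rightarrow> 'c::real_normed_vector \<Rightarrow> 'b::real_normed_vector"
  assumes "\<And>i. (f i has_derivative f' i) F"
  shows "((\<lambda>x. \<chi> i. f i x) has_derivative (\<lambda>h. \<chi> i. f' i h)) F"
proof -
  have e: "(\<chi> i. g i) = (\<Sum>i\<in>UNIV. axis i (g i))" for g :: "'n \<Rightarrow> 'b"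
    by (simp add: vec_eq_iff axis_def if_distrib cong: if_cong)
  show ?thesis unfolding e
    by (intro has_derivative_sum bounded_linear.has_derivative[OF bounded_linear_axis] assms)
qed

lemma Ck_on_comp:
  fixes \<phi> :: "'k::ground_field ^ 'n::finite \<Rightarrow> 'k ^ 'm::finite"
  assumes "Ck_on j S f" "\<And>i. Ck_on j T (\<lambda>x. \<phi> x $ i)" "\<phi> ` T \<subseteq> S"
  shows "Ck_on j T (\<lambda>x. f (\<phi> x))"
  using assms
proof (induction j arbitrary: f)
  case 0
  have "continuous_on T (\<lambda>x. \<chi> i. \<phi> x $ i)" using 0 by (intro continuous_on_vec_lambda) simp
  then have "continuous_on T \<phi>" by simp
  then show ?case using 0 continuous_on_compose2 by (simp, blast)
next
  case (Suc j)
  obtain f' where f': "\<forall>x\<in>S. (f has_derivative (\<lambda>h. \<Sum>i\<in>UNIV. f' i x * h $ i)) (at x)" "\<forall>i. Ck_on j S (f' i)"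
    using Suc.prems by auto
  define P where "P i g \<longleftrightarrow> (\<forall>x\<in>T. ((\<lambda>x. \<phi> x $ i) has_derivative (\<lambda>h. \<Sum>l\<in>UNIV. g l x * h $ l)) (at x)) \<and>
      (\<forall>l. Ck_on j T (g l))" for i g
  have "\<exists>g. P i g" for i using Suc.prems(2)[of i] unfolding P_def by simp
  then obtain g where "\<And>i. P i (g i)" by metis
  then have g: "\<And>i x. x \<in> T \<Longrightarrow> ((\<lambda>x. \<phi> x $ i) has_derivative (\<lambda>h. \<Sum>l\<in>UNIV. g i l x * h $ l)) (at x)"
    "\<And>i l. Ck_on j T (g i l)" unfolding P_def by blast+
  have Df: "((\<lambda>x. f (\<phi> x)) has_derivative (\<lambda>h. \<Sum>l\<in>UNIV. (\<Sum>i\<in>UNIV. f' i (\<phi> x) * g i l x) * h $ l)) (at x)"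
    if x: "x \<in> T" for x
  proof -
    have "((\<lambda>x. \<chi> i. \<phi> x $ i) has_derivative (\<lambda>h. \<chi> i. \<Sum>l\<in>UNIV. g i l x * h $ l)) (at x)"
      by (rule has_derivative_vec_lambda) (rule g(1)[OF x])
    then have "(\<phi> has_derivative (\<lambda>h. \<chi> i. \<Sum>l\<in>UNIV. g i l x * h $ l)) (at x)" by simp
    moreover have "(f has_derivative (\<lambda>h. \<Sum>i\<in>UNIV. f' i (\<phi> x) * h $ i)) (at (\<phi> x))"
      using f'(1) Suc.prems(3) x by blast
    ultimately have "((\<lambda>x. f (\<phi> x)) has_derivative (\<lambda>h. \<Sum>i\<in>UNIV. f' i (\<phi> x) * (\<chi> i. \<Sum>l\<in>UNIV. g i l x * h $ l) $ i)) (at x)"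
      by (rule has_derivative_compose)
    then show ?thesis
    proof (rule has_derivative_eq_rhs)
      show "(\<lambda>h. \<Sum>i\<in>UNIV. f' i (\<phi> x) * (\<chi> i. \<Sum>l\<in>UNIV. g i l x * h $ l) $ i) =
          (\<lambda>h. \<Sum>l\<in>UNIV. (\<Sum>i\<in>UNIV. f' i (\<phi> x) * g i l x) * h $ l)"
        by (rule ext) (simp add: sum_distrib_left sum_distrib_right mult.assoc, rule sum.swap)
    qed
  qed
  have "Ck_on j T (\<lambda>x. f' i (\<phi> x))" for i
    by (rule Suc.IH) (use f'(2) Suc.prems(2,3) Ck_on_Suc_imp in blast)+
  then have "Ck_on j T (\<lambda>x. \<Sum>i\<in>UNIV. f' i (\<phi> x) * g i l x)" for l
    by (intro Ck_on_sum Ck_on_mult g(2))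
  then show ?case unfolding Ck_on.simps
    by (intro exI[of _ "\<lambda>l x. \<Sum>i\<in>UNIV. f' i (\<phi> x) * g i l x"] conjI ballI allI Df)
qed

text \<open>Induction by differentiation under the integral sign. The weight \<open>t ^ p\<close> is
  part of the statement because each derivative of \<open>f (a + t *\<^sub>R (x - a))\<close> in
  \<open>x\<close> brings out one more factor \<open>t\<close>.\<close>

lemma Ck_on_integral:
  assumes S: "convex S" "open S" "a \<in> S" and f: "Ck_on j S f"
  shows "Ck_on j S (\<lambda>x. integral (cbox 0 1) (\<lambda>t::real. t ^ p *\<^sub>R f (a + t *\<^sub>R (x - a))))"
  using f
proof (induction j arbitrary: f p)
  case (0 f p)
  have seg: "a + t *\<^sub>R (x - a) \<in> S" if "x \<in> S" "t \<in> cbox 0 1" for x and t :: real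
    using convexD_alt[OF S(1,3) that(1), of t] that(2) by (simp add: algebra_simps)
  have c: "continuous_on (S \<times> cbox 0 1) (\<lambda>z. f (a + snd z *\<^sub>R (fst z - a)))"
    by (rule continuous_on_compose2[of S f]) (use 0 seg in \<open>auto intro!: continuous_intros\<close>)
  have "continuous_on (S \<times> cbox 0 1) (\<lambda>(x, t). t ^ p *\<^sub>R f (a + t *\<^sub>R (x - a)))"
    unfolding split_def by (intro continuous_intros c)
  from integral_continuous_on_param[OF this] show ?case by simp
next
  case (Suc j f p)
  have seg: "a + t *\<^sub>R (x - a) \<in> S" if "x \<in> S" "t \<in> cbox 0 1" for x and t :: real
    using convexD_alt[OF S(1,3) that(1), of t] that(2) by (simp add: algebra_simps)
  obtain g where g: "\<And>x. x \<in> S \<Longrightarrow> (f has_derivative (\<lambda>h. \<Sum>i\<in>UNIV. g i x * h $ i)) (at x)"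
    "\<And>i. Ck_on j S (g i)" using Suc.prems by auto
  have gc: "continuous_on (S \<times> cbox 0 1) (\<lambda>z. g i (a + snd z *\<^sub>R (fst z - a)))" for i
    by (rule continuous_on_compose2[OF Ck_on_continuous[OF g(2)[of i]]])
      (use seg in \<open>auto intro!: continuous_intros\<close>)
  have fc: "continuous_on (cbox 0 1) (\<lambda>t. f (a + t *\<^sub>R (x - a)))" if "x \<in> S" for x
    by (rule continuous_on_compose2[OF Ck_on_continuous[OF Suc.prems]])
      (use seg that in \<open>auto intro!: continuous_intros\<close>)
  define nth where "nth i = Blinfun (\<lambda>h :: 'a ^ 'b. h $ i)" for i
  have nth: "blinfun_apply (nth i) h = h $ i" for i h
    unfolding nth_def by (simp add: bounded_linear_Blinfun_apply bounded_linear_vec_nth)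
  \<comment> \<open>The derivative of the integrand as a bounded linear map, which can be integrated
    as a whole and then evaluated at \<open>h\<close>.\<close>
  define D where "D x t = (\<Sum>i\<in>UNIV. blinfun_mult_right (t ^ Suc p *\<^sub>R g i (a + t *\<^sub>R (x - a))) o\<^sub>L nth i)" for x and t :: real
  have D: "blinfun_apply (D x t) h = (\<Sum>i\<in>UNIV. (t ^ Suc p *\<^sub>R g i (a + t *\<^sub>R (x - a))) * h $ i)" for x t h
    by (simp add: D_def blinfun.sum_left nth)
  have Dc: "continuous_on (S \<times> cbox 0 1) (\<lambda>(x, t). D x t)"
    unfolding D_def split_def by (intro continuous_intros gc)
  have "((\<lambda>x. integral (cbox 0 1) (\<lambda>t. t ^ p *\<^sub>R f (a + t *\<^sub>R (x - a)))) has_derivative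
      (\<lambda>h. \<Sum>i\<in>UNIV. integral (cbox 0 1) (\<lambda>t. t ^ Suc p *\<^sub>R g i (a + t *\<^sub>R (x - a))) * h $ i)) (at x)"
    if x: "x \<in> S" for x
  proof -
    have "((\<lambda>x. integral (cbox 0 1) (\<lambda>t. t ^ p *\<^sub>R f (a + t *\<^sub>R (x - a)))) has_derivative
        blinfun_apply (integral (cbox 0 1) (D x))) (at x within S)"
    proof (rule leibniz_rule[OF _ _ Dc x S(1)])
      fix y and t :: real assume y: "y \<in> S" and t: "t \<in> cbox 0 1"
      have "((\<lambda>x. a + t *\<^sub>R (x - a)) has_derivative (\<lambda>h. t *\<^sub>R h)) (at y)"
        by (auto intro!: derivative_eq_intros)
      from has_derivative_compose[OF this g(1)[OF seg[OF y t]]]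
      have "((\<lambda>x. t ^ p *\<^sub>R f (a + t *\<^sub>R (x - a))) has_derivative
          (\<lambda>h. t ^ p *\<^sub>R (\<Sum>i\<in>UNIV. g i (a + t *\<^sub>R (y - a)) * (t *\<^sub>R h) $ i))) (at y)"
        by (rule has_derivative_scaleR_right)
      then have "((\<lambda>x. t ^ p *\<^sub>R f (a + t *\<^sub>R (x - a))) has_derivative blinfun_apply (D y t)) (at y)"
      proof (rule has_derivative_eq_rhs)
        show "(\<lambda>h. t ^ p *\<^sub>R (\<Sum>i\<in>UNIV. g i (a + t *\<^sub>R (y - a)) * (t *\<^sub>R h) $ i)) = blinfun_apply (D y t)"
          by (rule ext) (simp add: D scaleR_sum_right mult.commute)
      qed
      then show "((\<lambda>x. t ^ p *\<^sub>R f (a + t *\<^sub>R (x - a))) has_derivative blinfun_apply (D y t)) (at y within S)"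
        by (rule has_derivative_at_withinI)
    next
      fix y assume "y \<in> S"
      then show "(\<lambda>t. t ^ p *\<^sub>R f (a + t *\<^sub>R (y - a))) integrable_on cbox 0 1"
        by (intro integrable_continuous continuous_intros fc)
    qed
    then have "((\<lambda>x. integral (cbox 0 1) (\<lambda>t. t ^ p *\<^sub>R f (a + t *\<^sub>R (x - a)))) has_derivative
        blinfun_apply (integral (cbox 0 1) (D x))) (at x)"
      using at_within_open[OF x S(2)] by simp
    then show ?thesis
    proof (rule has_derivative_eq_rhs)
      have gx: "(\<lambda>t. t ^ Suc p *\<^sub>R g i (a + t *\<^sub>R (x - a))) integrable_on cbox 0 1" for i
      proof (intro integrable_continuous continuous_intros)
        show "continuous_on (cbox 0 1) (\<lambda>t. g i (a + t *\<^sub>R (x - a)))"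
          by (rule continuous_on_compose2[OF Ck_on_continuous[OF g(2)[of i]]])
            (use seg x in \<open>auto intro!: continuous_intros\<close>)
      qed
      have Dx: "D x integrable_on cbox 0 1"
      proof (rule integrable_continuous)
        have "continuous_on (cbox 0 1) (\<lambda>t. (\<lambda>(x, t). D x t) (x, t))"
          by (rule continuous_on_compose2[OF Dc]) (use x in \<open>auto intro!: continuous_intros\<close>)
        then show "continuous_on (cbox 0 1) (D x)" by simp
      qed
      show "blinfun_apply (integral (cbox 0 1) (D x)) =
          (\<lambda>h. \<Sum>i\<in>UNIV. integral (cbox 0 1) (\<lambda>t. t ^ Suc p *\<^sub>R g i (a + t *\<^sub>R (x - a))) * h $ i)"
      proof
        fix h
        have "blinfun_apply (integral (cbox 0 1) (D x)) h =
            integral (cbox 0 1) (\<lambda>t. \<Sum>i\<in>UNIV. (t ^ Suc p *\<^sub>R g i (a + t *\<^sub>R (x - a))) * h $ i)"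
          by (simp only: blinfun_apply_integral[OF Dx] D)
        also have "\<dots> = (\<Sum>i\<in>UNIV. integral (cbox 0 1) (\<lambda>t. (t ^ Suc p *\<^sub>R g i (a + t *\<^sub>R (x - a))) * h $ i))"
          by (rule integral_sum[OF finite integrable_on_mult_left[OF gx]])
        also have "\<dots> = (\<Sum>i\<in>UNIV. integral (cbox 0 1) (\<lambda>t. t ^ Suc p *\<^sub>R g i (a + t *\<^sub>R (x - a))) * h $ i)"
          by (intro sum.cong refl integral_mult_left)
        finally show "blinfun_apply (integral (cbox 0 1) (D x)) h = \<dots>" .
      qed
    qed
  qed
  then show ?case unfolding Ck_on.simps using Suc.IH[OF g(2)]
    by (intro exI[of _ "\<lambda>i x. integral (cbox 0 1) (\<lambda>t. t ^ Suc p *\<^sub>R g i (a + t *\<^sub>R (x - a)))"] conjI ballI allI)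
qed

text \<open>The derivative of \<open>f\<close> along the segment from \<open>a\<close> to
  \<open>x\<close> is integrated; the averages of the partial derivatives are the factors
  \<open>G i\<close>.\<close>

lemma smooth_hadamard:
  fixes f :: "'k::ground_field ^ 'n::finite \<Rightarrow> 'k"
  assumes f: "\<And>j. Ck_on j (ball a r) f" and r: "0 < r"
  shows "\<exists>G. (\<forall>i j. Ck_on j (ball a r) (G i)) \<and>
           (\<forall>x\<in>ball a r. f x = f a + (\<Sum>i\<in>UNIV. (x $ i - a $ i) * G i x))"
proof -
  define S where "S = ball a r"
  have S: "convex S" "open S" "a \<in> S" using r by (auto simp: S_def)
  define g where "g i x = frechet_derivative f (at x) (axis i 1)" for i x
  have repr: "\<exists>h. (\<forall>x\<in>S. (f has_derivative (\<lambda>v. \<Sum>i\<in>UNIV. h i x * v $ i)) (at x)) \<and> (\<forall>i. Ck_on j S (h i))" for j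
    using f[of "Suc j"] by (simp add: S_def)
  \<comment> \<open>\<open>Ck_on (Suc j)\<close> provides a family of partial derivatives for each
    \<open>j\<close> separately. Uniqueness of the derivative identifies them all with
    \<open>g\<close>, which is thus of every class.\<close>
  have g_eq: "h i x = g i x" if d: "(f has_derivative (\<lambda>v. \<Sum>i\<in>UNIV. h i x * v $ i)) (at x)" for h i x
    unfolding g_def frechet_derivative_at[OF d, symmetric]
    by (simp add: axis_def if_distrib cong: if_cong)
  have gk: "Ck_on j S (g i)" for i j
  proof -
    obtain h where h: "\<forall>x\<in>S. (f has_derivative (\<lambda>v. \<Sum>i\<in>UNIV. h i x * v $ i)) (at x)" "\<forall>i. Ck_on j S (h i)"
      using repr by blast
    show ?thesis by (rule Ck_on_cong[OF S(2) h(2)[rule_format, of i]]) (use h(1) g_eq in blast)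
  qed
  have df: "(f has_derivative (\<lambda>v. \<Sum>i\<in>UNIV. g i x * v $ i)) (at x)" if x: "x \<in> S" for x
  proof -
    obtain h where h: "\<forall>x\<in>S. (f has_derivative (\<lambda>v. \<Sum>i\<in>UNIV. h i x * v $ i)) (at x)"
      using repr by blast
    then have d: "(f has_derivative (\<lambda>v. \<Sum>i\<in>UNIV. h i x * v $ i)) (at x)" using x by blast
    have "h i x = g i x" for i by (rule g_eq[where h=h, OF d])
    then show ?thesis using d by simp
  qed
  have seg: "a + t *\<^sub>R (x - a) \<in> S" if "x \<in> S" "t \<in> {0..1}" for x and t :: real
    using convexD_alt[OF S(1,3) that(1), of t] that(2) by (simp add: algebra_simps)
  define G where "G i x = integral (cbox 0 1) (\<lambda>t::real. t ^ 0 *\<^sub>R g i (a + t *\<^sub>R (x - a)))" for i x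
  have Gk: "Ck_on j S (G i)" for i j unfolding G_def by (rule Ck_on_integral[OF S gk])
  have "f x = f a + (\<Sum>i\<in>UNIV. (x $ i - a $ i) * G i x)" if x: "x \<in> S" for x
  proof -
    have "((\<lambda>t. f (a + t *\<^sub>R (x - a))) has_vector_derivative (\<Sum>i\<in>UNIV. g i (a + t *\<^sub>R (x - a)) * (x - a) $ i)) (at t within {0..1})"
      if t: "t \<in> {0..1}" for t :: real
    proof -
      have "((\<lambda>t. a + t *\<^sub>R (x - a)) has_derivative (\<lambda>s. s *\<^sub>R (x - a))) (at t within {0..1})"
        by (auto intro!: derivative_eq_intros)
      from has_derivative_compose[OF this df[OF seg[OF x t]]]
      show ?thesis unfolding has_vector_derivative_def
        by (rule has_derivative_eq_rhs) (simp add: scaleR_sum_right fun_eq_iff)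
    qed
    from fundamental_theorem_of_calculus[OF zero_le_one this]
    have "((\<lambda>t. \<Sum>i\<in>UNIV. g i (a + t *\<^sub>R (x - a)) * (x - a) $ i) has_integral (f x - f a)) {0..1}" by simp
    then have e: "f x - f a = integral {0..1} (\<lambda>t. \<Sum>i\<in>UNIV. g i (a + t *\<^sub>R (x - a)) * (x - a) $ i)"
      by (simp add: integral_unique)
    have gi: "(\<lambda>t. g i (a + t *\<^sub>R (x - a))) integrable_on {0..1}" for i
    proof (rule integrable_continuous_real)
      show "continuous_on {0..1} (\<lambda>t. g i (a + t *\<^sub>R (x - a)))"
        by (rule continuous_on_compose2[OF Ck_on_continuous[OF gk[of 0 i]]])
          (use seg x in \<open>auto intro!: continuous_intros\<close>)
    qed
    have "f x - f a = (\<Sum>i\<in>UNIV. integral {0..1} (\<lambda>t. g i (a + t *\<^sub>R (x - a)) * (x - a) $ i))"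
      unfolding e by (rule integral_sum) (auto intro!: integrable_on_mult_left gi)
    also have "\<dots> = (\<Sum>i\<in>UNIV. (x $ i - a $ i) * G i x)"
      by (simp add: G_def mult.commute)
    finally show ?thesis by (simp add: algebra_simps)
  qed
  then show ?thesis using Gk unfolding S_def by blast
qed

subsection \<open>Smooth and analytic functions\<close>

lemma regular_on_subset: "regular_on \<rho> S f \<Longrightarrow> T \<subseteq> S \<Longrightarrow> regular_on \<rho> T f"
  by (cases \<rho>) (auto intro: Ck_on_subset)

lemma regular_on_const: "regular_on \<rho> S (\<lambda>_. c)"
  by (cases \<rho>) (auto intro: Ck_on_const power_series_at_const)

lemma regular_on_add: "regular_on \<rho> S f \<Longrightarrow> regular_on \<rho> S g \<Longrightarrow> regular_on \<rho> S (\<lambda>x. f x + g x)"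
  by (cases \<rho>) (auto intro: Ck_on_add power_series_at_add)

lemma regular_on_mult: "regular_on \<rho> S f \<Longrightarrow> regular_on \<rho> S g \<Longrightarrow> regular_on \<rho> S (\<lambda>x. f x * g x)"
  by (cases \<rho>) (auto intro: Ck_on_mult power_series_at_mult)

lemma regular_on_comp:
  fixes \<phi> :: "'k::ground_field ^ 'n::finite \<Rightarrow> 'k ^ 'm::finite"
  assumes "regular_on \<rho> S f" "\<And>i. regular_on \<rho> T (\<lambda>x. \<phi> x $ i)" "\<phi> ` T \<subseteq> S"
  shows "regular_on \<rho> T (\<lambda>x. f (\<phi> x))"
proof (cases \<rho>)
  case C_infinity
  have "Ck_on j T (\<lambda>x. f (\<phi> x))" for j
    by (rule Ck_on_comp[OF _ _ assms(3)]) (use assms(1,2) C_infinity in simp_all)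
  then show ?thesis using C_infinity by simp
next
  case C_omega
  have "power_series_at (\<lambda>x. f (\<phi> x)) a" if a: "a \<in> T" for a
  proof (rule power_series_at_comp)
    show "power_series_at f (\<phi> a)" using assms(1,3) a C_omega by auto
    show "power_series_at (\<lambda>x. \<phi> x $ i) a" for i using assms(2)[of i] a C_omega by simp
  qed
  then show ?thesis using C_omega by simp
qed

lemma regular_on_continuous:
  assumes "regular_on \<rho> S f" shows "continuous_on S f"
proof (cases \<rho>)
  case C_infinity
  then have "Ck_on 0 S f" using assms by (simp only: regular_on.simps)
  then show ?thesis by simp
next
  case C_omega
  then show ?thesis using assms
    by (auto intro!: continuous_at_imp_continuous_on power_series_at_imp_isCont)
qed

lemma regular_on_hadamard:
  assumes S: "open S" "a \<in> S" and f: "regular_on \<rho> S f"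
  shows "\<exists>r>0. \<exists>G. ball a r \<subseteq> S \<and> (\<forall>i. regular_on \<rho> (ball a r) (G i)) \<and>
           (\<forall>x\<in>ball a r. f x = f a + (\<Sum>i\<in>UNIV. (x $ i - a $ i) * G i x))"
proof -
  obtain r where r: "0 < r" "ball a r \<subseteq> S" using S open_contains_ball by blast
  show ?thesis
  proof (cases \<rho>)
    case C_infinity
    have "\<And>j. Ck_on j (ball a r) f" using f r(2) C_infinity by (auto intro: Ck_on_subset)
    from smooth_hadamard[OF this r(1)] obtain G where "\<forall>i j. Ck_on j (ball a r) (G i)"
      "\<forall>x\<in>ball a r. f x = f a + (\<Sum>i\<in>UNIV. (x $ i - a $ i) * G i x)" by (elim exE conjE)
    moreover from this(1) have "\<forall>i. regular_on \<rho> (ball a r) (G i)" using C_infinity by simp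
    ultimately show ?thesis using r by blast
  next
    case C_omega
    then have "power_series_at f a" using f S by simp
    from power_series_at_hadamard[OF this] obtain s G where s: "0 < s" "\<forall>i. \<forall>x\<in>ball a s. power_series_at (G i) x"
      "\<forall>x\<in>ball a s. f x = f a + (\<Sum>i\<in>UNIV. (x $ i - a $ i) * G i x)" by (elim exE conjE)
    have sub: "ball a (min r s) \<subseteq> ball a r" "ball a (min r s) \<subseteq> ball a s" "0 < min r s" using r(1) s(1) by auto
    have "\<forall>i. regular_on \<rho> (ball a (min r s)) (G i)" using s(2) sub(2) C_omega by auto
    moreover have "ball a (min r s) \<subseteq> S" using sub(1) r(2) by blast
    moreover have "\<forall>x\<in>ball a (min r s). f x = f a + (\<Sum>i\<in>UNIV. (x $ i - a $ i) * G i x)"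
      using s(3) sub(2) by blast
    ultimately show ?thesis using sub(3) by blast
  qed
qed

text \<open>The remainder in direction \<open>i\<close> is
  \<open>(y - a) $ i * (G i y - G i a)\<close>, which continuity of \<open>G i\<close> makes small.
  In the analytic case this gives the derivative without termwise differentiation.\<close>

lemma has_derivative_if_hadamard:
  fixes f :: "'k::ground_field ^ 'n::finite \<Rightarrow> 'k"
  assumes r: "0 < r" and G: "\<And>i. continuous_on (ball a r) (G i)"
    and f: "\<And>x. x \<in> ball a r \<Longrightarrow> f x = f a + (\<Sum>i\<in>UNIV. (x $ i - a $ i) * G i x)"
  shows "(f has_derivative (\<lambda>h. \<Sum>i\<in>UNIV. G i a * h $ i)) (at a)"
proof -
  have "((\<lambda>x. (x $ i - a $ i) * G i x) has_derivative (\<lambda>h. G i a * h $ i)) (at a)" for i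
  proof -
    have tend: "((\<lambda>x. norm (G i x - G i a)) \<longlongrightarrow> 0) (at a)"
    proof -
      have "isCont (G i) a" using G[of i] r by (simp add: continuous_on_eq_continuous_at)
      then show ?thesis unfolding isCont_def using LIM_zero tendsto_norm_zero by blast
    qed
    have bl: "bounded_linear (\<lambda>h :: 'k ^ 'n. G i a * h $ i)"
      by (rule bounded_linear_compose[OF bounded_linear_mult_right bounded_linear_vec_nth])
    show ?thesis
      unfolding has_derivative_at_within
    proof (intro conjI bl)
      show "((\<lambda>y. ((y $ i - a $ i) * G i y - (a $ i - a $ i) * G i a - G i a * (y - a) $ i) /\<^sub>R norm (y - a)) \<longlongrightarrow> 0) (at a)"
      proof (rule tendsto_norm_zero_cancel, rule tendsto_sandwich[OF _ _ tendsto_const tend])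
        show "\<forall>\<^sub>F y in at a. norm (((y $ i - a $ i) * G i y - (a $ i - a $ i) * G i a - G i a * (y - a) $ i) /\<^sub>R norm (y - a)) \<le> norm (G i y - G i a)"
        proof (intro always_eventually allI)
          fix y
          have "norm ((y - a) $ i) \<le> norm (y - a)" by (rule Finite_Cartesian_Product.norm_nth_le)
          then have "norm ((y - a) $ i) * norm (G i y - G i a) \<le> norm (y - a) * norm (G i y - G i a)"
            by (rule mult_right_mono) simp
          moreover have "(y $ i - a $ i) * G i y - (a $ i - a $ i) * G i a - G i a * (y - a) $ i = (y - a) $ i * (G i y - G i a)"
            by (simp add: algebra_simps)
          ultimately show "norm (((y $ i - a $ i) * G i y - (a $ i - a $ i) * G i a - G i a * (y - a) $ i) /\<^sub>R norm (y - a)) \<le> norm (G i y - G i a)"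
            by (cases "y = a") (simp_all add: norm_mult divide_simps mult.commute)
        qed
      qed simp
    qed
  qed
  then have "((\<lambda>x. f a + (\<Sum>i\<in>UNIV. (x $ i - a $ i) * G i x)) has_derivative (\<lambda>h. 0 + (\<Sum>i\<in>UNIV. G i a * h $ i))) (at a)"
    by (intro has_derivative_add has_derivative_const has_derivative_sum)
  then have "((\<lambda>x. f a + (\<Sum>i\<in>UNIV. (x $ i - a $ i) * G i x)) has_derivative (\<lambda>h. \<Sum>i\<in>UNIV. G i a * h $ i)) (at a)" by simp
  then show ?thesis
    by (rule has_derivative_transform_within_open[OF _ open_ball[of a r]]) (simp_all add: r f[symmetric])
qed

section \<open>Brackets in coordinates\<close>

lemma to_complex_0 [simp]: "to_complex (0 :: 'k::ground_field) = 0"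
  using norm_to_complex[of "0 :: 'k"] by simp

lemma to_complex_minus: "to_complex (- x) = - to_complex (x :: 'k::ground_field)"
  using to_complex_add[of x "- x"] by (simp add: eq_neg_iff_add_eq_0 add.commute)

lemma to_complex_1 [simp]: "to_complex (1 :: 'k::ground_field) = 1"
proof -
  have "to_complex (1 :: 'k) * to_complex (1 :: 'k) = to_complex (1 :: 'k)"
    by (simp flip: to_complex_mult)
  moreover have "to_complex (1 :: 'k) \<noteq> 0" using norm_to_complex[of "1 :: 'k"] by auto
  ultimately show ?thesis by simp
qed

lemma to_complex_sum: "to_complex (\<Sum>i\<in>I. f i) = (\<Sum>i\<in>I. to_complex (f i :: 'k::ground_field))"
  by (induction I rule: infinite_finite_induct) (simp_all add: to_complex_add)

definition complexify :: "'k::ground_field ^ 'n \<Rightarrow> complex ^ 'n" where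
  "complexify x = (\<chi> i. to_complex (x $ i))"

locale manifold =
  fixes \<rho> :: regularity
    and \<A> :: "('a::{t2_space,second_countable_topology}, 'k::ground_field, 'n::finite) chart set"
  assumes manifold: "is_manifold \<rho> \<A>"
begin

lemma chart:
  assumes "c \<in> \<A>"
  shows chart_open: "open (fst c)" and chart_image_open: "open (snd c ` fst c)"
    and chart_homeomorphism: "homeomorphism (fst c) (snd c ` fst c) (snd c) (chart_inv c)"
  using manifold assms unfolding is_manifold_def is_chart_def by blast+

lemma chart_inv [simp]: "c \<in> \<A> \<Longrightarrow> m \<in> fst c \<Longrightarrow> chart_inv c (snd c m) = m"
  using homeomorphism_apply1[OF chart_homeomorphism] by blast

lemma chart_at: "chart_at \<A> m \<in> \<A>" "m \<in> fst (chart_at \<A> m)"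
proof -
  have "\<exists>c. c \<in> \<A> \<and> m \<in> fst c" using manifold unfolding is_manifold_def by blast
  then have "chart_at \<A> m \<in> \<A> \<and> m \<in> fst (chart_at \<A> m)" unfolding chart_at_def by (rule someI_ex)
  then show "chart_at \<A> m \<in> \<A>" "m \<in> fst (chart_at \<A> m)" by blast+
qed

lemma open_chart_image:
  assumes c: "c \<in> \<A>" and V: "open V" shows "open (snd c ` (fst c \<inter> V))"
proof -
  have "continuous_on (snd c ` fst c) (chart_inv c)"
    using chart_homeomorphism[OF c] by (simp add: homeomorphism_def)
  then have "open (chart_inv c -` V \<inter> snd c ` fst c)"
    using continuous_on_open_vimage[OF chart_image_open[OF c]] V by blast
  moreover have "chart_inv c -` V \<inter> snd c ` fst c = snd c ` (fst c \<inter> V)" using c by auto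
  ultimately show ?thesis by simp
qed

lemma functions_on_subset: "f \<in> functions_on \<rho> \<A> V \<Longrightarrow> W \<subseteq> V \<Longrightarrow> f \<in> functions_on \<rho> \<A> W"
  unfolding functions_on_def by (auto intro: regular_on_subset)

lemma functions_on_const: "(\<lambda>_. z) \<in> functions_on \<rho> \<A> V"
  by (simp add: functions_on_def regular_on_const)

lemma functions_on_add:
  "f \<in> functions_on \<rho> \<A> V \<Longrightarrow> g \<in> functions_on \<rho> \<A> V \<Longrightarrow> (\<lambda>p. f p + g p) \<in> functions_on \<rho> \<A> V"
  by (simp add: functions_on_def regular_on_add)

lemma functions_on_mult:
  "f \<in> functions_on \<rho> \<A> V \<Longrightarrow> g \<in> functions_on \<rho> \<A> V \<Longrightarrow> (\<lambda>p. f p * g p) \<in> functions_on \<rho> \<A> V"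
  by (simp add: functions_on_def regular_on_mult)

lemma functions_on_sum:
  "(\<And>i. i \<in> I \<Longrightarrow> f i \<in> functions_on \<rho> \<A> V) \<Longrightarrow> (\<lambda>p. \<Sum>i\<in>I. f i p) \<in> functions_on \<rho> \<A> V"
  by (induction I rule: infinite_finite_induct) (auto intro: functions_on_const functions_on_add)

lemma coordinate_in_functions_on:
  assumes "c \<in> \<A>" "W \<subseteq> fst c" shows "(\<lambda>p. snd c p $ i) \<in> functions_on \<rho> \<A> W"
proof -
  have "(\<lambda>p. snd c p $ i) \<in> functions_on \<rho> \<A> (fst c)"
    using manifold assms(1) unfolding functions_on_def is_manifold_def by blast
  then show ?thesis by (rule functions_on_subset[OF _ assms(2)])
qed

lemma function_of_coordinates:
  assumes c: "c \<in> \<A>" and G: "regular_on \<rho> S G" and W: "W \<subseteq> fst c" "snd c ` W \<subseteq> S"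
  shows "(\<lambda>p. G (snd c p)) \<in> functions_on \<rho> \<A> W"
  unfolding functions_on_def
proof (intro CollectI ballI)
  fix d assume d: "d \<in> \<A>"
  show "regular_on \<rho> (snd d ` (fst d \<inter> W)) (\<lambda>x. G (snd c (chart_inv d x)))"
  proof (rule regular_on_comp[OF G])
    show "regular_on \<rho> (snd d ` (fst d \<inter> W)) (\<lambda>x. snd c (chart_inv d x) $ i)" for i
      using coordinate_in_functions_on[OF c W(1)] d unfolding functions_on_def by blast
    show "(\<lambda>x. snd c (chart_inv d x)) ` snd d ` (fst d \<inter> W) \<subseteq> S" using W(2) d by auto
  qed
qed

lemma functions_on_continuous:
  assumes c: "c \<in> \<A>" and f: "f \<in> functions_on \<rho> \<A> (fst c)"
  shows "continuous_on (fst c) f"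
proof -
  have "continuous_on (snd c ` fst c) (\<lambda>x. f (chart_inv c x))"
    using f c unfolding functions_on_def by (auto dest!: bspec intro: regular_on_continuous)
  moreover have "continuous_on (fst c) (snd c)"
    using chart_homeomorphism[OF c] by (simp add: homeomorphism_def)
  ultimately have "continuous_on (fst c) (\<lambda>p. f (chart_inv c (snd c p)))"
    by (rule continuous_on_compose2) simp
  then show ?thesis using c by (simp cong: continuous_on_cong)
qed

definition partial :: "('a, 'k, 'n) chart \<Rightarrow> ('a \<Rightarrow> 'k) \<Rightarrow> 'a \<Rightarrow> 'n \<Rightarrow> 'k" where
  "partial c f m i = frechet_derivative (\<lambda>x. f (chart_inv c x)) (at (snd c m)) (axis i 1)"

lemma differential_nth: "differential \<A> f m $ i = partial (chart_at \<A> m) f m i"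
  by (simp add: differential_def partial_def Let_def)

text \<open>Hadamard's lemma carried over by a chart. The factors \<open>G i\<close> live only on a
  small neighbourhood \<open>W\<close>, to which the bracket is then restricted; their values at
  \<open>m\<close> are the partial derivatives.\<close>

lemma local_expansion:
  assumes c: "c \<in> \<A>" and m: "m \<in> fst c" "m \<in> V" and V: "open V" and f: "f \<in> functions_on \<rho> \<A> V"
  shows "\<exists>W G. open W \<and> m \<in> W \<and> W \<subseteq> V \<inter> fst c \<and> (\<forall>i. G i \<in> functions_on \<rho> \<A> W) \<and>
      (\<forall>p\<in>W. f p = f m + (\<Sum>i\<in>UNIV. (snd c p $ i - snd c m $ i) * G i p)) \<and> (\<forall>i. G i m = partial c f m i)"
    and has_derivative_partial:
      "((\<lambda>x. f (chart_inv c x)) has_derivative (\<lambda>h. \<Sum>i\<in>UNIV. partial c f m i * h $ i)) (at (snd c m))"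
proof -
  define a where "a = snd c m"
  define F where "F x = f (chart_inv c x)" for x
  define S where "S = snd c ` (fst c \<inter> V)"
  have S: "open S" "a \<in> S" unfolding S_def a_def using open_chart_image[OF c V] m by auto
  have F: "regular_on \<rho> S F" using f c unfolding functions_on_def F_def S_def by blast
  obtain r G where r: "0 < r" "ball a r \<subseteq> S" and G: "\<And>i. regular_on \<rho> (ball a r) (G i)"
    and exp: "\<And>x. x \<in> ball a r \<Longrightarrow> F x = F a + (\<Sum>i\<in>UNIV. (x $ i - a $ i) * G i x)"
    using regular_on_hadamard[OF S F] by (elim exE conjE) blast
  define W where "W = snd c -` ball a r \<inter> fst c"
  have "continuous_on (fst c) (snd c)" using chart_homeomorphism[OF c] by (simp add: homeomorphism_def)
  then have W1: "open W" unfolding W_def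
    using continuous_on_open_vimage[OF chart_open[OF c]] open_ball by blast
  have W2: "m \<in> W" using m r by (simp add: W_def a_def)
  have W3: "W \<subseteq> V \<inter> fst c"
  proof
    fix p assume p: "p \<in> W"
    then have "snd c p \<in> S" using r(2) by (auto simp: W_def)
    then obtain q where q: "q \<in> fst c" "q \<in> V" "snd c p = snd c q" by (auto simp: S_def)
    have "p = q" using chart_inv[OF c, of p] chart_inv[OF c q(1)] p q(3) by (simp add: W_def)
    then show "p \<in> V \<inter> fst c" using q by simp
  qed
  have W4: "(\<lambda>p. G i (snd c p)) \<in> functions_on \<rho> \<A> W" for i
    by (rule function_of_coordinates[OF c G]) (auto simp: W_def)
  have W5: "f p = f m + (\<Sum>i\<in>UNIV. (snd c p $ i - snd c m $ i) * G i (snd c p))" if "p \<in> W" for p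
  proof -
    have p: "snd c p \<in> ball a r" "p \<in> fst c" using that by (auto simp: W_def)
    have "F (snd c p) = f p" "F a = f m" using c m p by (simp_all add: F_def a_def)
    then show ?thesis using exp[OF p(1)] unfolding a_def by argo
  qed
  have der: "(F has_derivative (\<lambda>h. \<Sum>i\<in>UNIV. G i a * h $ i)) (at a)"
    by (rule has_derivative_if_hadamard[OF r(1) regular_on_continuous[OF G] exp])
  have pG: "partial c f m i = G i a" for i
  proof -
    have "partial c f m i = frechet_derivative F (at a) (axis i 1)"
      by (simp add: partial_def F_def[abs_def] a_def)
    also have "\<dots> = (\<Sum>l\<in>UNIV. G l a * axis i 1 $ l)"
      unfolding frechet_derivative_at[OF der, symmetric] ..
    also have "\<dots> = G i a" by (simp add: axis_def if_distrib cong: if_cong)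
    finally show ?thesis .
  qed
  have W6: "G i (snd c m) = partial c f m i" for i by (simp add: pG a_def)
  show "((\<lambda>x. f (chart_inv c x)) has_derivative (\<lambda>h. \<Sum>i\<in>UNIV. partial c f m i * h $ i)) (at (snd c m))"
    using der unfolding pG F_def[abs_def] a_def .
  show "\<exists>W G. open W \<and> m \<in> W \<and> W \<subseteq> V \<inter> fst c \<and> (\<forall>i. G i \<in> functions_on \<rho> \<A> W) \<and>
      (\<forall>p\<in>W. f p = f m + (\<Sum>i\<in>UNIV. (snd c p $ i - snd c m $ i) * G i p)) \<and> (\<forall>i. G i m = partial c f m i)"
    by (intro exI[of _ W] exI[of _ "\<lambda>i p. G i (snd c p)"] conjI allI ballI W1 W2 W3 W4 W5 W6)
qed

text \<open>The composition of the two coordinate changes is the identity near the point, so their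
  Jacobians are inverse to each other.\<close>

lemma chain_rule:
  assumes c: "c \<in> \<A>" "m \<in> fst c" and d: "d \<in> \<A>" "m \<in> fst d"
  shows "(\<Sum>k\<in>UNIV. partial c (\<lambda>p. snd d p $ i) m k * partial d (\<lambda>p. snd c p $ k) m j) = (if i = j then 1 else 0)"
proof -
  define V where "V = fst c \<inter> fst d"
  have V: "open V" "m \<in> V" "V \<subseteq> fst c" "V \<subseteq> fst d" 
    using open_Int[OF chart_open[OF c(1)] chart_open[OF d(1)]] c d by (auto simp: V_def)
  have D1: "((\<lambda>x. snd d (chart_inv c x) $ i) has_derivative (\<lambda>h. \<Sum>k\<in>UNIV. partial c (\<lambda>p. snd d p $ i) m k * h $ k)) (at (snd c m))"
    by (rule has_derivative_partial[OF c V(2,1) coordinate_in_functions_on[OF d(1) V(4)]])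
  have "((\<lambda>y. \<chi> k. snd c (chart_inv d y) $ k) has_derivative
      (\<lambda>h. \<chi> k. \<Sum>l\<in>UNIV. partial d (\<lambda>p. snd c p $ k) m l * h $ l)) (at (snd d m))"
  proof (rule has_derivative_vec_lambda)
    fix k
    show "((\<lambda>y. snd c (chart_inv d y) $ k) has_derivative (\<lambda>h. \<Sum>l\<in>UNIV. partial d (\<lambda>p. snd c p $ k) m l * h $ l)) (at (snd d m))"
      by (rule has_derivative_partial[OF d V(2,1) coordinate_in_functions_on[OF c(1) V(3)]])
  qed
  then have D2: "((\<lambda>y. snd c (chart_inv d y)) has_derivative
      (\<lambda>h. \<chi> k. \<Sum>l\<in>UNIV. partial d (\<lambda>p. snd c p $ k) m l * h $ l)) (at (snd d m))" by simp
  have "snd c m = snd c (chart_inv d (snd d m))" using d by simp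
  from has_derivative_compose[OF D2 D1[unfolded this]]
  have "((\<lambda>y. snd d (chart_inv c (snd c (chart_inv d y))) $ i) has_derivative
     (\<lambda>h. \<Sum>k\<in>UNIV. partial c (\<lambda>p. snd d p $ i) m k * (\<chi> k. \<Sum>l\<in>UNIV. partial d (\<lambda>p. snd c p $ k) m l * h $ l) $ k)) (at (snd d m))"
    using d by simp
  from this[unfolded vec_lambda_beta] have "((\<lambda>y. y $ i) has_derivative
     (\<lambda>h. \<Sum>k\<in>UNIV. partial c (\<lambda>p. snd d p $ i) m k * (\<Sum>l\<in>UNIV. partial d (\<lambda>p. snd c p $ k) m l * h $ l))) (at (snd d m))"
    (is "(_ has_derivative ?D) _")
  proof (rule has_derivative_transform_within_open[OF _ open_chart_image[OF d(1) V(1)]])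
    show "snd d m \<in> snd d ` (fst d \<inter> V)" using V d by auto
    show "snd d (chart_inv c (snd c (chart_inv d y))) $ i = y $ i" if "y \<in> snd d ` (fst d \<inter> V)" for y
      using that c d V(3) by auto
  qed
  from has_derivative_unique[OF this bounded_linear_imp_has_derivative[OF bounded_linear_vec_nth]]
  have "?D (axis j 1) = axis j 1 $ i" by (rule fun_cong)
  then show ?thesis by (simp add: axis_def if_distrib cong: if_cong)
qed

text \<open>The matrix of \<open>cotangent_pairing\<close> in a chart fixed in advance. As
  \<open>chart_at\<close> may vary irregularly with the point, it is this version that is shown to
  be continuous.\<close>

definition gram :: "('a, 'k) bracket \<Rightarrow> ('a, 'k, 'n) chart \<Rightarrow> 'a \<Rightarrow> complex ^ 'n ^ 'n" where
  "gram B c m = (\<chi> i j. to_complex (B (\<lambda>p. snd c p $ i) (\<lambda>p. snd c p $ j) m))"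

lemma cotangent_pairing_eq_gram: "cotangent_pairing \<A> B m = gram B (chart_at \<A> m) m"
  by (simp add: cotangent_pairing_def gram_def Let_def)

end

locale poisson_manifold = manifold +
  fixes B :: "('a::{t2_space,second_countable_topology}, 'k::ground_field) bracket"
  assumes poisson: "is_poisson \<rho> \<A> B"
begin

lemma bracket:
  assumes V: "open V" "x \<in> V" and f: "f \<in> functions_on \<rho> \<A> V" and g: "g \<in> functions_on \<rho> \<A> V"
  shows bracket_in_functions: "B f g \<in> functions_on \<rho> \<A> V"
    and bracket_skew: "B f g x = - B g f x"
    and bracket_local: "f' \<in> functions_on \<rho> \<A> V \<Longrightarrow> (\<And>y. y \<in> V \<Longrightarrow> f y = f' y) \<Longrightarrow> B f g x = B f' g x"
    and bracket_scale: "B (\<lambda>y. z * f y) g x = z * B f g x"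
    and bracket_add: "f' \<in> functions_on \<rho> \<A> V \<Longrightarrow> B (\<lambda>y. f y + f' y) g x = B f g x + B f' g x"
    and bracket_mult: "f' \<in> functions_on \<rho> \<A> V \<Longrightarrow> B (\<lambda>y. f y * f' y) g x = f x * B f' g x + f' x * B f g x"
  using poisson[unfolded is_poisson_def, rule_format, OF V(1)] V(2) f g by blast+

lemma bracket_const:
  assumes V: "open V" "x \<in> V" and g: "g \<in> functions_on \<rho> \<A> V"
  shows "B (\<lambda>_. z) g x = 0"
proof -
  have "B (\<lambda>y. 1 * 1) g x = 1 * B (\<lambda>_. 1) g x + 1 * B (\<lambda>_. 1) g x"
    by (rule bracket_mult[OF V functions_on_const g functions_on_const])
  then have "B (\<lambda>_. 1) g x = 0" by simp
  then show ?thesis using bracket_scale[OF V functions_on_const[of 1] g, of z] by simp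
qed

lemma bracket_sum:
  assumes V: "open V" "x \<in> V" and g: "g \<in> functions_on \<rho> \<A> V" and I: "finite I"
    and f: "\<And>i. i \<in> I \<Longrightarrow> f i \<in> functions_on \<rho> \<A> V"
  shows "B (\<lambda>y. \<Sum>i\<in>I. f i y) g x = (\<Sum>i\<in>I. B (f i) g x)"
  using I f
proof (induction I rule: finite_induct)
  case empty
  then show ?case using bracket_const[OF V g, of 0] by simp
next
  case (insert i I)
  then show ?case
    using bracket_add[OF V, of "f i" g "\<lambda>y. \<Sum>i\<in>I. f i y"] g functions_on_sum[of I f V] by simp
qed

text \<open>A derivation at \<open>m\<close> is determined by its values on coordinates, by Hadamard's lemma.\<close>
lemma bracket_coordinates:
  assumes c: "c \<in> \<A>" and m: "m \<in> fst c" "m \<in> V" and V: "open V"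
    and f: "f \<in> functions_on \<rho> \<A> V" and g: "g \<in> functions_on \<rho> \<A> V"
  shows "B f g m = (\<Sum>i\<in>UNIV. partial c f m i * B (\<lambda>p. snd c p $ i) g m)"
proof -
  obtain W G where W: "open W" "m \<in> W" "W \<subseteq> V \<inter> fst c" and G': "\<forall>i. G i \<in> functions_on \<rho> \<A> W"
    and exp: "\<forall>p\<in>W. f p = f m + (\<Sum>i\<in>UNIV. (snd c p $ i - snd c m $ i) * G i p)"
    and Gm: "\<forall>i. G i m = partial c f m i"
    using local_expansion[OF c m V f] by (elim exE conjE)
  have G: "G i \<in> functions_on \<rho> \<A> W" for i using G' by blast
  have fW: "f \<in> functions_on \<rho> \<A> W" and gW: "g \<in> functions_on \<rho> \<A> W"
    using f g W(3) functions_on_subset by blast+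
  \<comment> \<open>Centred coordinates, written as a sum with a constant so that additivity
    applies. They vanish at \<open>m\<close>, so the Leibniz rule retains only the terms with
    \<open>G i m\<close>, and the constant drops out of the bracket.\<close>
  define x where "x i p = snd c p $ i + (- (snd c m $ i))" for i p
  have coord: "(\<lambda>p. snd c p $ i) \<in> functions_on \<rho> \<A> W" for i
    using coordinate_in_functions_on[OF c] W(3) by blast
  have x: "x i \<in> functions_on \<rho> \<A> W" for i
    unfolding x_def[abs_def] by (rule functions_on_add[OF coord functions_on_const])
  have xG: "(\<lambda>p. x i p * G i p) \<in> functions_on \<rho> \<A> W" for i by (rule functions_on_mult[OF x G])
  have sum: "(\<lambda>p. \<Sum>i\<in>UNIV. x i p * G i p) \<in> functions_on \<rho> \<A> W" by (rule functions_on_sum) (rule xG)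
  have "B f g m = B (\<lambda>p. f m + (\<Sum>i\<in>UNIV. x i p * G i p)) g m"
  proof (rule bracket_local[OF W(1,2) fW gW functions_on_add[OF functions_on_const sum]])
    fix p assume p: "p \<in> W"
    show "f p = f m + (\<Sum>i\<in>UNIV. x i p * G i p)" by (subst exp[rule_format, OF p]) (simp add: x_def)
  qed
  also have "\<dots> = B (\<lambda>p. \<Sum>i\<in>UNIV. x i p * G i p) g m"
    using bracket_add[OF W(1,2) functions_on_const[of "f m"] gW sum] bracket_const[OF W(1,2) gW] by simp
  also have "\<dots> = (\<Sum>i\<in>UNIV. B (\<lambda>p. x i p * G i p) g m)"
    by (rule bracket_sum[OF W(1,2) gW finite xG])
  also have "\<dots> = (\<Sum>i\<in>UNIV. partial c f m i * B (\<lambda>p. snd c p $ i) g m)"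
  proof (rule sum.cong[OF refl])
    fix i
    have "B (x i) g m = B (\<lambda>p. snd c p $ i) g m"
      unfolding x_def[abs_def]
      using bracket_add[OF W(1,2) coord gW functions_on_const, of i "- (snd c m $ i)"] bracket_const[OF W(1,2) gW]
      by (simp only: add_0_right)
    moreover have "x i m = 0" by (simp add: x_def)
    ultimately show "B (\<lambda>p. x i p * G i p) g m = partial c f m i * B (\<lambda>p. snd c p $ i) g m"
      using bracket_mult[OF W(1,2) x gW G] Gm by simp
  qed
  finally show ?thesis .
qed

lemma gram_skew:
  assumes c: "c \<in> \<A>" "m \<in> fst c" shows "gram B c m $ i $ j = - gram B c m $ j $ i"
  using bracket_skew[OF chart_open[OF c(1)] c(2) coordinate_in_functions_on[OF c(1) subset_refl] coordinate_in_functions_on[OF c(1) subset_refl], of i j]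
  by (simp add: gram_def to_complex_minus)

lemma pairing_gram_skew:
  assumes c: "c \<in> \<A>" "m \<in> fst c" shows "pairing (gram B c m) u v = - pairing (gram B c m) v u"
proof -
  have "pairing (gram B c m) u v = (\<Sum>j\<in>UNIV. \<Sum>i\<in>UNIV. gram B c m $ i $ j * u $ i * v $ j)"
    unfolding pairing_def by (rule sum.swap)
  also have "\<dots> = (\<Sum>j\<in>UNIV. \<Sum>i\<in>UNIV. - (gram B c m $ j $ i * v $ j * u $ i))"
    by (intro sum.cong refl) (subst gram_skew[OF c], simp)
  finally show ?thesis unfolding pairing_def by (simp add: sum_negf)
qed

lemma gram_continuous:
  assumes c: "c \<in> \<A>" shows "continuous_on (fst c) (gram B c)"
proof -
  have coord: "(\<lambda>p. snd c p $ i) \<in> functions_on \<rho> \<A> (fst c)" for i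
    by (rule coordinate_in_functions_on[OF c subset_refl])
  have "continuous_on (fst c) (\<lambda>m. to_complex (B (\<lambda>p. snd c p $ i) (\<lambda>p. snd c p $ j) m))" for i j
  proof (cases "fst c = {}")
    case False
    then obtain x where "x \<in> fst c" by blast
    then have "B (\<lambda>p. snd c p $ i) (\<lambda>p. snd c p $ j) \<in> functions_on \<rho> \<A> (fst c)"
      by (rule bracket_in_functions[OF chart_open[OF c] _ coord coord])
    from functions_on_continuous[OF c this] show ?thesis
      by (rule bounded_linear.continuous_on[OF bounded_linear_to_complex])
  qed simp
  then show ?thesis unfolding gram_def[abs_def] by (intro continuous_on_vec_lambda)
qed

lemma bracket_with_coordinate:
  assumes c: "c \<in> \<A>" and m: "m \<in> fst c" "m \<in> V" and V: "open V" and f: "f \<in> functions_on \<rho> \<A> V"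
  shows "to_complex (B f (\<lambda>p. snd c p $ j) m) = (\<Sum>i\<in>UNIV. gram B c m $ i $ j * to_complex (partial c f m i))"
proof -
  have "open (V \<inter> fst c)" using V chart_open[OF c] by blast
  from bracket_coordinates[OF c m(1) _ this functions_on_subset[OF f] coordinate_in_functions_on[OF c], of j] m
  show ?thesis by (simp add: gram_def to_complex_sum to_complex_mult mult.commute)
qed

lemma gram_change_chart:
  assumes c: "c \<in> \<A>" "m \<in> fst c" and d: "d \<in> \<A>" "m \<in> fst d"
  shows "gram B d m $ i $ j = (\<Sum>k\<in>UNIV. \<Sum>l\<in>UNIV. to_complex (partial c (\<lambda>p. snd d p $ i) m k) *
           to_complex (partial c (\<lambda>p. snd d p $ j) m l) * gram B c m $ k $ l)"
proof -
  define V where "V = fst c \<inter> fst d"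
  have V: "open V" "m \<in> V" "V \<subseteq> fst c" "V \<subseteq> fst d" 
    using open_Int[OF chart_open[OF c(1)] chart_open[OF d(1)]] c d by (auto simp: V_def)
  define J where "J i k = partial c (\<lambda>p. snd d p $ i) m k" for i k
  note cV = coordinate_in_functions_on[OF c(1) V(3)] and dV = coordinate_in_functions_on[OF d(1) V(4)]
  have "B (\<lambda>p. snd d p $ i) (\<lambda>p. snd d p $ j) m = (\<Sum>k\<in>UNIV. J i k * B (\<lambda>p. snd c p $ k) (\<lambda>p. snd d p $ j) m)"
    unfolding J_def by (rule bracket_coordinates[OF c V(2,1) dV dV])
  also have "\<dots> = (\<Sum>k\<in>UNIV. J i k * (\<Sum>l\<in>UNIV. J j l * B (\<lambda>p. snd c p $ k) (\<lambda>p. snd c p $ l) m))"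
  proof (intro sum.cong refl arg_cong2[where f="(*)"])
    fix k
    have "B (\<lambda>p. snd c p $ k) (\<lambda>p. snd d p $ j) m = - B (\<lambda>p. snd d p $ j) (\<lambda>p. snd c p $ k) m"
      by (rule bracket_skew[OF V(1,2) cV dV])
    also have "\<dots> = - (\<Sum>l\<in>UNIV. J j l * B (\<lambda>p. snd c p $ l) (\<lambda>p. snd c p $ k) m)"
      unfolding J_def by (subst bracket_coordinates[OF c V(2,1) dV cV]) simp
    also have "\<dots> = (\<Sum>l\<in>UNIV. J j l * B (\<lambda>p. snd c p $ k) (\<lambda>p. snd c p $ l) m)"
      unfolding sum_negf[symmetric] by (intro sum.cong refl) (subst bracket_skew[OF V(1,2) cV cV], simp)
    finally show "B (\<lambda>p. snd c p $ k) (\<lambda>p. snd d p $ j) m = \<dots>" .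
  qed
  finally show ?thesis
    by (simp add: gram_def J_def to_complex_sum to_complex_mult sum_distrib_left mult.assoc)
qed

text \<open>Column \<open>i\<close> of \<open>K\<close> is the differential of the
  \<open>i\<close>-th coordinate of \<open>d\<close> written in the chart \<open>c\<close>. Thus
  \<open>K\<close> translates covectors from one basis to the other and the Gram matrices are
  congruent.\<close>

lemma pairing_gram_change_chart:
  assumes c: "c \<in> \<A>" "m \<in> fst c" and d: "d \<in> \<A>" "m \<in> fst d"
  defines "K \<equiv> \<chi> k i. to_complex (partial c (\<lambda>p. snd d p $ i) m k)"
  shows "pairing (gram B d m) u v = pairing (gram B c m) (K *v u) (K *v v)"
proof -
  have "pairing (gram B c m) (K *v u) (K *v v) =
      (\<Sum>k\<in>UNIV. \<Sum>l\<in>UNIV. \<Sum>i\<in>UNIV. \<Sum>j\<in>UNIV. gram B c m $ k $ l * (K $ k $ i * u $ i) * (K $ l $ j * v $ j))"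
  proof -
    have "x * (\<Sum>i\<in>UNIV. f i) * (\<Sum>j\<in>UNIV. g j) = (\<Sum>i\<in>UNIV. \<Sum>j\<in>UNIV. x * f i * g j)"
      for x :: complex and f g :: "'n \<Rightarrow> complex"
      unfolding mult.assoc sum_product by (simp add: sum_distrib_left)
    note expand = this
    show ?thesis unfolding pairing_def matrix_vector_mult_def vec_lambda_beta
      by (intro sum.cong refl) (rule expand)
  qed
  also have "\<dots> = (\<Sum>k\<in>UNIV. \<Sum>i\<in>UNIV. \<Sum>l\<in>UNIV. \<Sum>j\<in>UNIV. gram B c m $ k $ l * (K $ k $ i * u $ i) * (K $ l $ j * v $ j))"
    by (intro sum.cong refl sum.swap)
  also have "\<dots> = (\<Sum>i\<in>UNIV. \<Sum>k\<in>UNIV. \<Sum>l\<in>UNIV. \<Sum>j\<in>UNIV. gram B c m $ k $ l * (K $ k $ i * u $ i) * (K $ l $ j * v $ j))"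
    by (rule sum.swap)
  also have "\<dots> = (\<Sum>i\<in>UNIV. \<Sum>k\<in>UNIV. \<Sum>j\<in>UNIV. \<Sum>l\<in>UNIV. gram B c m $ k $ l * (K $ k $ i * u $ i) * (K $ l $ j * v $ j))"
    by (intro sum.cong refl sum.swap)
  also have "\<dots> = (\<Sum>i\<in>UNIV. \<Sum>j\<in>UNIV. \<Sum>k\<in>UNIV. \<Sum>l\<in>UNIV. gram B c m $ k $ l * (K $ k $ i * u $ i) * (K $ l $ j * v $ j))"
    by (intro sum.cong refl sum.swap)
  also have "\<dots> = pairing (gram B d m) u v"
    unfolding pairing_def gram_change_chart[OF c d]
    by (intro sum.cong refl) (simp add: K_def sum_distrib_left sum_distrib_right mult_ac)
  finally show ?thesis by simp
qed

end

context manifold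
begin

lemma change_chart_inverse:
  assumes c: "c \<in> \<A>" "m \<in> fst c" and d: "d \<in> \<A>" "m \<in> fst d"
  shows "(\<chi> k i. to_complex (partial c (\<lambda>p. snd d p $ i) m k)) ** (\<chi> i k. to_complex (partial d (\<lambda>p. snd c p $ k) m i)) = mat 1"
proof -
  have "(\<Sum>i\<in>UNIV. to_complex (partial c (\<lambda>p. snd d p $ i) m k) * to_complex (partial d (\<lambda>p. snd c p $ l) m i)) =
      (if k = l then 1 else 0)" for k l
  proof -
    have "(\<Sum>i\<in>UNIV. to_complex (partial c (\<lambda>p. snd d p $ i) m k) * to_complex (partial d (\<lambda>p. snd c p $ l) m i)) =
        to_complex (\<Sum>i\<in>UNIV. partial d (\<lambda>p. snd c p $ l) m i * partial c (\<lambda>p. snd d p $ i) m k)"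
      by (simp add: to_complex_sum to_complex_mult mult.commute)
    also have "\<dots> = (if k = l then 1 else 0)" unfolding chain_rule[OF d c] by auto
    finally show ?thesis .
  qed
  then show ?thesis by (simp add: matrix_matrix_mult_def mat_def vec_eq_iff)
qed

end

section \<open>Bihamiltonian structures\<close>

text \<open>Dual vectors over the ground field stay dual after complexification.\<close>
lemma complexify_independent:
  fixes w :: "'i \<Rightarrow> 'k::ground_field ^ 'n::finite"
  assumes I: "finite I" and w: "inj_on w I" "vec.independent (w ` I)"
  shows "inj_on (\<lambda>i. complexify (w i)) I" "vec.independent ((\<lambda>i. complexify (w i)) ` I)"
proof -
  have "inj_on (\<lambda>i. complexify (w i)) I \<and> vec.independent ((\<lambda>i. complexify (w i)) ` I)"
  proof (subst independent_family_iff[OF I], intro allI impI ballI)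
    fix c i0 assume c: "(\<Sum>i\<in>I. c i *s complexify (w i)) = 0" and i0: "i0 \<in> I"
    have "\<exists>x. \<forall>i\<in>I. (\<Sum>j\<in>UNIV. w i $ j * x j) = (if i = i0 then 1 else 0)"
    proof (rule fredholm_alternative[OF finite I])
      fix y assume y: "\<forall>j\<in>UNIV. (\<Sum>i\<in>I. y i * w i $ j) = 0"
      have "(\<Sum>i\<in>I. y i *s w i) = 0" using y by (simp add: vec_eq_iff)
      then have "\<forall>i\<in>I. y i = 0" using independent_family_iff[OF I] w by blast
      then show "(\<Sum>i\<in>I. y i * (if i = i0 then 1 else 0)) = 0" by simp
    qed
    then obtain x where x: "\<And>i. i \<in> I \<Longrightarrow> (\<Sum>j\<in>UNIV. w i $ j * x j) = (if i = i0 then 1 else 0)" by blast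
    have x': "(\<Sum>j\<in>UNIV. to_complex (w i $ j) * to_complex (x j)) = (if i = i0 then 1 else 0)" if "i \<in> I" for i
    proof -
      have "(\<Sum>j\<in>UNIV. to_complex (w i $ j) * to_complex (x j)) = to_complex (\<Sum>j\<in>UNIV. w i $ j * x j)"
        by (simp add: to_complex_sum to_complex_mult)
      then show ?thesis by (simp add: x[OF that])
    qed
    have "0 = (\<Sum>j\<in>UNIV. (\<Sum>i\<in>I. c i *s complexify (w i)) $ j * to_complex (x j))" by (simp add: c)
    also have "\<dots> = (\<Sum>j\<in>UNIV. \<Sum>i\<in>I. c i * (to_complex (w i $ j) * to_complex (x j)))"
      by (simp add: complexify_def sum_distrib_right mult.assoc)
    also have "\<dots> = (\<Sum>i\<in>I. c i * (\<Sum>j\<in>UNIV. to_complex (w i $ j) * to_complex (x j)))"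
      by (subst sum.swap) (simp add: sum_distrib_left)
    also have "\<dots> = (\<Sum>i\<in>I. if i = i0 then c i else 0)" by (intro sum.cong refl) (simp add: x')
    finally show "c i0 = 0" using i0 I by simp
  qed
  then show "inj_on (\<lambda>i. complexify (w i)) I" "vec.independent ((\<lambda>i. complexify (w i)) ` I)" by blast+
qed

section \<open>Semicontinuous integer functions and lower limits\<close>

lemma in_closure_iff: "x \<in> closure S \<longleftrightarrow> (\<forall>T. open T \<longrightarrow> x \<in> T \<longrightarrow> T \<inter> S \<noteq> {})"
proof
  assume "x \<in> closure S"
  then show "\<forall>T. open T \<longrightarrow> x \<in> T \<longrightarrow> T \<inter> S \<noteq> {}" using open_Int_closure_eq_empty by blast
next
  assume "\<forall>T. open T \<longrightarrow> x \<in> T \<longrightarrow> T \<inter> S \<noteq> {}"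
  then show "x \<in> closure S" by (metis Compl_iff Int_commute Compl_disjoint closed_closure closure_subset disjoint_eq_subset_Compl open_Compl subset_trans)
qed

text \<open>Let \<open>v\<close> be the least value for which \<open>x\<close> is in the closure of
  the set where \<open>f\<close> is at most \<open>v\<close>. Removing the closure of the next lower
  sublevel set leaves an open set where \<open>f = v\<close>; its closure still contains
  \<open>x\<close>, which lies outside the removed closed set.\<close>

lemma usc_constant:
  fixes f :: "'a::topological_space \<Rightarrow> nat"
  assumes D: "x \<in> closure D" and f: "\<And>v. open {m \<in> D. f m \<le> v}" and b: "\<And>m. m \<in> D \<Longrightarrow> f m \<le> b"
  shows "\<exists>U v. open U \<and> U \<subseteq> D \<and> x \<in> closure U \<and> (\<forall>m\<in>U. f m = v)"
proof -
  define P where "P v \<longleftrightarrow> x \<in> closure {m \<in> D. f m \<le> v}" for v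
  define v where "v = (LEAST v. P v)"
  have "{m \<in> D. f m \<le> b} = D" using b by blast
  then have "P b" using D by (simp add: P_def)
  then have v: "P v" unfolding v_def by (rule LeastI)
  show ?thesis
  proof (cases v)
    case 0
    then show ?thesis using v f[of 0] unfolding P_def
      by (intro exI[of _ "{m \<in> D. f m \<le> 0}"] exI[of _ 0]) auto
  next
    case (Suc u)
    define C where "C = closure {m \<in> D. f m \<le> u}"
    have "\<not> P u" using not_less_Least[of u P] Suc by (simp add: v_def)
    then have xC: "x \<notin> C" by (simp add: P_def C_def)
    have cl: "x \<in> closure ({m \<in> D. f m \<le> v} - C)"
      unfolding in_closure_iff
    proof (intro allI impI)
      fix T assume T: "open T" "x \<in> T"
      have "open (T - C)" using T by (auto simp: C_def intro: open_Diff)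
      then have "(T - C) \<inter> {m \<in> D. f m \<le> v} \<noteq> {}" using v T xC unfolding P_def in_closure_iff by blast
      then show "T \<inter> ({m \<in> D. f m \<le> v} - C) \<noteq> {}" by blast
    qed
    have op: "open ({m \<in> D. f m \<le> v} - C)" using f[of v] by (auto simp: C_def intro: open_Diff)
    have eq: "f m = v" if "m \<in> {m \<in> D. f m \<le> v} - C" for m
    proof -
      have "m \<notin> {m \<in> D. f m \<le> u}" using that closure_subset[of "{m \<in> D. f m \<le> u}"] unfolding C_def by auto
      then show ?thesis using that Suc by auto
    qed
    have "{m \<in> D. f m \<le> v} - C \<subseteq> D" by blast
    then show ?thesis
      by (intro exI[of _ "{m \<in> D. f m \<le> v} - C"] exI[of _ v] conjI ballI op cl eq)
  qed
qed

text \<open>One \<open>q\<close> at a time: each step shrinks the previous open set and keeps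
  \<open>x\<close> in its closure.\<close>

lemma usc_family_constant:
  fixes f :: "nat \<Rightarrow> 'a::topological_space \<Rightarrow> nat"
  assumes D: "open D" "x \<in> closure D" and f: "\<And>q v. open {m \<in> D. f q m \<le> v}" and b: "\<And>q m. m \<in> D \<Longrightarrow> f q m \<le> b"
  shows "\<exists>U v. open U \<and> U \<subseteq> D \<and> x \<in> closure U \<and> (\<forall>q\<le>n. \<forall>m\<in>U. f q m = v q)"
proof (induction n)
  case 0
  have "\<exists>U v. open U \<and> U \<subseteq> D \<and> x \<in> closure U \<and> (\<forall>m\<in>U. f 0 m = v)"
    by (rule usc_constant[OF D(2), where b = b]) (fact f, fact b)
  then obtain U v where "open U" "U \<subseteq> D" "x \<in> closure U" "\<forall>m\<in>U. f 0 m = v"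
    by (elim exE conjE)
  then show ?case by (intro exI[of _ U] exI[of _ "\<lambda>_. v"]) simp
next
  case (Suc n)
  then obtain U v where U: "open U" "U \<subseteq> D" "x \<in> closure U" "\<forall>q\<le>n. \<forall>m\<in>U. f q m = v q"
    by (elim exE conjE)
  have "open {m \<in> U. f (Suc n) m \<le> w}" for w
  proof -
    have "{m \<in> U. f (Suc n) m \<le> w} = U \<inter> {m \<in> D. f (Suc n) m \<le> w}" using U(2) by blast
    then show ?thesis using U(1) f by (simp add: open_Int)
  qed
  from usc_constant[OF U(3) this, of b] obtain U' v' where U': "open U'" "U' \<subseteq> U" "x \<in> closure U'"
    "\<forall>m\<in>U'. f (Suc n) m = v'" using b U(2) by (metis (no_types, lifting) subsetD)
  then show ?case using U(2,4)
    by (intro exI[of _ U'] exI[of _ "v(Suc n := v')"]) (auto simp: le_Suc_eq)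
qed

text \<open>The values are half-integers, so a margin of 1/4 turns bounds on the lower limit into
  exact integer inequalities. In particular a finite lower limit \<open>N\<close> is attained
  arbitrarily close to \<open>x\<close>.\<close>

lemma half_integer_liminf:
  fixes s :: "'a::topological_space \<Rightarrow> nat"
  assumes lim: "ereal (real N) = Liminf (at x) (\<lambda>m. ereal ((real n + real (s m)) / 2))"
  shows "\<forall>\<^sub>F m in at x. 2 * N \<le> n + s m" "\<exists>\<^sub>F m in at x. n + s m \<le> 2 * N"
proof -
  have "ereal (real N - 1 / 4) < Liminf (at x) (\<lambda>m. ereal ((real n + real (s m)) / 2))"
    unfolding lim[symmetric] by simp
  from less_LiminfD[OF this] show "\<forall>\<^sub>F m in at x. 2 * N \<le> n + s m"
  proof eventually_elim
    case (elim m)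
    then have "4 * real N - 1 < 2 * (real n + real (s m))" by (simp add: field_simps)
    then have "real (4 * N) < real (2 * (n + s m) + 1)" by simp
    then have "4 * N < 2 * (n + s m) + 1" by (simp only: of_nat_less_iff)
    then show ?case by presburger
  qed
  show "\<exists>\<^sub>F m in at x. n + s m \<le> 2 * N"
  proof (rule ccontr)
    assume "\<not> ?thesis"
    then have "\<forall>\<^sub>F m in at x. \<not> n + s m \<le> 2 * N" by (simp add: not_frequently)
    then have "\<forall>\<^sub>F m in at x. ereal (real N + 1 / 4) \<le> ereal ((real n + real (s m)) / 2)"
    proof eventually_elim
      case (elim m)
      then have "2 * N + 1 \<le> n + s m" by simp
      then have "real (2 * N + 1) \<le> real (n + s m)" by (simp only: of_nat_le_iff)
      then show ?case by simp
    qed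
    then have "ereal (real N + 1 / 4) \<le> Liminf (at x) (\<lambda>m. ereal ((real n + real (s m)) / 2))"
      by (rule Liminf_bounded)
    then show False unfolding lim[symmetric] by simp
  qed
qed

section \<open>The pencils on the cotangent spaces and the chains of differentials\<close>

locale bihamiltonian_manifold =
  fixes \<rho> :: regularity
    and \<A> :: "('a::{t2_space,second_countable_topology}, 'k::ground_field, 'n::finite) chart set"
    and B\<^sub>1 B\<^sub>2 :: "('a, 'k) bracket"
  assumes bihamiltonian: "bihamiltonian \<rho> \<A> B\<^sub>1 B\<^sub>2"
begin

sublocale manifold \<rho> \<A>
  using bihamiltonian by unfold_locales (simp add: bihamiltonian_def)

sublocale P1: poisson_manifold \<rho> \<A> B\<^sub>1
  using bihamiltonian by unfold_locales (simp add: bihamiltonian_def)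

sublocale P2: poisson_manifold \<rho> \<A> B\<^sub>2
  using bihamiltonian by unfold_locales (simp add: bihamiltonian_def)

abbreviation "A1 \<equiv> cotangent_pairing \<A> B\<^sub>1"
abbreviation "A2 \<equiv> cotangent_pairing \<A> B\<^sub>2"

lemma skew_pencil_gram: "c \<in> \<A> \<Longrightarrow> m \<in> fst c \<Longrightarrow> skew_pencil (gram B\<^sub>1 c m) (gram B\<^sub>2 c m)"
  by unfold_locales (rule P1.pairing_gram_skew P2.pairing_gram_skew; assumption)+

lemma skew_pencil: "skew_pencil (A1 m) (A2 m)"
  unfolding cotangent_pairing_eq_gram by (rule skew_pencil_gram[OF chart_at])

text \<open>The chart chosen at \<open>m\<close> and the fixed chart \<open>c\<close> give pencils
  congruent by the same Jacobian for both brackets, so the dimensions agree.\<close>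

lemma finite_chains_dim_chart:
  assumes c: "c \<in> \<A>" "m \<in> fst c"
  shows "vec.dim (finite_chains (A1 m) (A2 m) UNIV q) = vec.dim (finite_chains (gram B\<^sub>1 c m) (gram B\<^sub>2 c m) UNIV q)"
  unfolding cotangent_pairing_eq_gram
  by (rule finite_chains_dim_congruence[OF P1.pairing_gram_change_chart[OF c chart_at] P2.pairing_gram_change_chart[OF c chart_at]
        change_chart_inverse[OF c chart_at] change_chart_inverse[OF chart_at c]])

lemma finite_chains_dim_usc_chart:
  assumes c: "c \<in> \<A>"
  shows "open {m \<in> fst c. vec.dim (finite_chains (A1 m) (A2 m) UNIV q) \<le> v}"
proof -
  have "{m \<in> fst c. vec.dim (finite_chains (A1 m) (A2 m) UNIV q) \<le> v} =
      {m \<in> fst c. vec.dim (finite_chains (gram B\<^sub>1 c m) (gram B\<^sub>2 c m) UNIV q) \<le> v}"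
    using finite_chains_dim_chart[OF c] by auto
  then show ?thesis
    using finite_chains_dim_usc[OF chart_open[OF c] P1.gram_continuous[OF c] P2.gram_continuous[OF c]] by simp
qed

lemma pairing_differential_axis:
  assumes V: "open V" "m \<in> V" and F: "F \<in> functions_on \<rho> \<A> V" and B: "poisson_manifold \<rho> \<A> B"
  shows "pairing (cotangent_pairing \<A> B m) (complexify (differential \<A> F m)) v =
      (\<Sum>j\<in>UNIV. v $ j * to_complex (B F (\<lambda>p. snd (chart_at \<A> m) p $ j) m))"
proof -
  interpret B: poisson_manifold \<rho> \<A> B by (rule B)
  have "pairing (cotangent_pairing \<A> B m) (complexify (differential \<A> F m)) v =
     (\<Sum>j\<in>UNIV. \<Sum>i\<in>UNIV. gram B (chart_at \<A> m) m $ i $ j * to_complex (partial (chart_at \<A> m) F m i) * v $ j)"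
    unfolding pairing_def cotangent_pairing_eq_gram by (subst sum.swap) (simp add: complexify_def differential_nth)
  also have "\<dots> = (\<Sum>j\<in>UNIV. v $ j * to_complex (B F (\<lambda>p. snd (chart_at \<A> m) p $ j) m))"
    unfolding B.bracket_with_coordinate[OF chart_at V(2,1) F] by (simp add: sum_distrib_left mult_ac)
  finally show ?thesis .
qed

text \<open>The Casimir condition and the recurrence are tested on coordinate functions, which exist
  only on a chart domain; this is where their validity on smaller open sets is used. The minus sign
  of the recurrence is the plus sign of the chain equation.\<close>

lemma chain_of_differentials:
  assumes V: "open V" "m \<in> V" and H: "\<And>i. H i \<in> functions_on \<rho> \<A> V"
    and cas: "casimir_on \<rho> \<A> B\<^sub>1 V (H 0)" and rec: "\<And>i. recurrence_on \<rho> \<A> B\<^sub>1 B\<^sub>2 V (H i) (H (Suc i))"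
  shows "chain (A1 m) (A2 m) UNIV (\<lambda>i. complexify (differential \<A> (H i) m))"
proof -
  define c where "c = chart_at \<A> m"
  have c: "c \<in> \<A>" "m \<in> fst c" unfolding c_def by (rule chart_at)+
  define W where "W = V \<inter> fst c"
  have W: "open W" "W \<subseteq> V" "m \<in> W" using V c chart_open[OF c(1)] by (auto simp: W_def)
  have x: "(\<lambda>p. snd c p $ j) \<in> functions_on \<rho> \<A> W" for j
    by (rule coordinate_in_functions_on[OF c(1)]) (simp add: W_def)
  have "B\<^sub>1 (H 0) (\<lambda>p. snd c p $ j) m = 0" for j
    using cas W x unfolding casimir_on_def by blast
  moreover have "B\<^sub>2 (H i) (\<lambda>p. snd c p $ j) m = - B\<^sub>1 (H (Suc i)) (\<lambda>p. snd c p $ j) m" for i j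
    using rec[of i] W x unfolding recurrence_on_def by blast
  ultimately show ?thesis
    unfolding chain_def
      pairing_differential_axis[OF V H P1.poisson_manifold_axioms] pairing_differential_axis[OF V H P2.poisson_manifold_axioms]
    by (simp add: c_def[symmetric] to_complex_minus sum.distrib[symmetric] sum_negf)
qed

end

lemma card_lenard_indices: "finite (lenard_indices r k) \<and> card (lenard_indices r k) = (\<Sum>t<r. k t + 1)"
proof -
  have "lenard_indices r k = (SIGMA t:{..<r}. {..k t})" by (auto simp: lenard_indices_def)
  then show ?thesis by (simp add: card_SigmaI)
qed

theorem theorem11p6:
  fixes \<rho> :: regularity
    and \<A> :: "('a::{t2_space,second_countable_topology}, 'k::ground_field, 'n::finite) chart set"
    and B\<^sub>1 B\<^sub>2 :: "('a, 'k) bracket"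
    and m\<^sub>0 :: 'a
  assumes "bihamiltonian \<rho> \<A> B\<^sub>1 B\<^sub>2"
    and "strictly_lenard_integrable_at \<rho> \<A> B\<^sub>1 B\<^sub>2 m\<^sub>0"
  shows "\<exists>U. open U \<and> m\<^sub>0 \<in> closure U \<and> homogeneous_on \<A> B\<^sub>1 B\<^sub>2 U"
proof -
  interpret bihamiltonian_manifold \<rho> \<A> B\<^sub>1 B\<^sub>2 by unfold_locales (fact assms(1))
  obtain V r k l H H' where data: "lenard_integrability_data \<rho> \<A> B\<^sub>1 B\<^sub>2 m\<^sub>0 V r k l H"
    and H': "\<forall>t<r. (\<forall>i\<le>l t. H' t i = H t i) \<and> (\<forall>i. H' t i \<in> functions_on \<rho> \<A> V \<and>
                    recurrence_on \<rho> \<A> B\<^sub>1 B\<^sub>2 V (H' t i) (H' t (Suc i)))"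
    using assms(2) unfolding strictly_lenard_integrable_at_def by (elim exE conjE)
  define N where "N = (\<Sum>t<r. k t + 1)"
  define s where "s m = number_of_kronecker_blocks (A1 m) (A2 m)" for m
  define dm where "dm q m = vec.dim (finite_chains (A1 m) (A2 m) UNIV q)" for q m
  define c where "c = chart_at \<A> m\<^sub>0"
  have c: "c \<in> \<A>" "m\<^sub>0 \<in> fst c" unfolding c_def by (rule chart_at)+
  have V: "open V" "m\<^sub>0 \<in> V" and scheme: "anchored_lenard_scheme \<rho> \<A> B\<^sub>1 B\<^sub>2 V r k l H"
    and lim: "ereal (real N) = Liminf (at m\<^sub>0) (\<lambda>m. ereal ((real CARD('n) + real (s m)) / 2))"
    using data unfolding lenard_integrability_data_def action_dim_def pair_action_dim_def N_def s_def by blast+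
  have kl: "\<And>t. t < r \<Longrightarrow> k t < l t" and cas: "\<And>t. t < r \<Longrightarrow> casimir_on \<rho> \<A> B\<^sub>1 V (H t 0)"
    and ind: "independent_on \<A> V (lenard_indices r k) (\<lambda>(t, i). H t i)"
    using scheme unfolding anchored_lenard_scheme_def maximal_casimirs_def by blast+
  have chains: "chain (A1 m) (A2 m) UNIV (\<lambda>i. complexify (differential \<A> (H' t i) m))" if "t < r" "m \<in> V" for t m
  proof (rule chain_of_differentials[OF V(1) that(2)])
    show "casimir_on \<rho> \<A> B\<^sub>1 V (H' t 0)" using cas[OF that(1)] H' that(1) by simp
  qed (use H' that(1) in blast)+
  obtain O' where O': "open O'" "m\<^sub>0 \<in> O'" "\<And>m. m \<in> O' \<Longrightarrow> m \<noteq> m\<^sub>0 \<Longrightarrow> 2 * N \<le> CARD('n) + s m"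
    using half_integer_liminf(1)[OF lim] unfolding eventually_at_topological by auto
  \<comment> \<open>The lower limit ranges over punctured neighbourhoods and does not control
    \<open>m\<^sub>0\<close> itself, so this point is removed. The rest stays open because points
    are closed.\<close>
  define V1 where "V1 = V \<inter> fst c \<inter> O' - {m\<^sub>0}"
  have V1: "open V1" using V(1) chart_open[OF c(1)] O'(1) by (auto simp: V1_def intro!: open_Diff)
  have dm_usc: "open {m \<in> fst c. dm q m \<le> v}" for q v
    unfolding dm_def by (rule finite_chains_dim_usc_chart[OF c(1)])
  define Q where "Q = {m \<in> V1. CARD('n) + s m \<le> 2 * N}"
  \<comment> \<open>The block count cannot increase on passing to nearby points, since it is
    governed by the upper semicontinuous dimension at \<open>q = CARD('n)\<close>.\<close>
  have Q: "open Q"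
  proof (subst open_subopen, intro ballI)
    fix m assume m: "m \<in> Q"
    have "s m' \<le> s m" if "dm CARD('n) m' \<le> dm CARD('n) m" for m'
      using number_of_kronecker_blocks_mono[OF skew_pencil skew_pencil] that unfolding s_def dm_def by blast
    then have "V1 \<inter> {m' \<in> fst c. dm CARD('n) m' \<le> dm CARD('n) m} \<subseteq> Q" using m by (fastforce simp: Q_def)
    then show "\<exists>T. open T \<and> m \<in> T \<and> T \<subseteq> Q"
      using m V1 dm_usc by (intro exI[of _ "V1 \<inter> {m' \<in> fst c. dm CARD('n) m' \<le> dm CARD('n) m}"])
        (auto simp: Q_def V1_def intro: open_Int)
  qed
  have Q_cl: "m\<^sub>0 \<in> closure Q"
    unfolding in_closure_iff
  proof (intro allI impI)
    fix T assume T: "open T" "m\<^sub>0 \<in> T"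
    have "\<forall>\<^sub>F m in at m\<^sub>0. m \<in> T \<inter> V1"
      unfolding eventually_at_topological
      using T V c O' chart_open[OF c(1)]
      by (intro exI[of _ "T \<inter> (V \<inter> fst c \<inter> O')"]) (auto simp: V1_def)
    from frequently_eventually_conj[OF half_integer_liminf(2)[OF lim] this]
    obtain m where "m \<in> T \<inter> V1" "CARD('n) + s m \<le> 2 * N" by (auto dest: frequently_ex)
    then show "T \<inter> Q \<noteq> {}" by (auto simp: Q_def)
  qed
  obtain G where G: "open G" "V \<subseteq> closure G"
    "\<And>m. m \<in> G \<Longrightarrow> inj_on (\<lambda>(t, i). differential \<A> (H t i) m) (lenard_indices r k) \<and>
            vec.independent ((\<lambda>(t, i). differential \<A> (H t i) m) ` lenard_indices r k)"
    using ind unfolding independent_on_def generically_on_def split_def by blast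
  define D where "D = Q \<inter> G"
  have D: "open D" unfolding D_def using Q G(1) by blast
  have D_cl: "m\<^sub>0 \<in> closure D"
    unfolding in_closure_iff
  proof (intro allI impI)
    fix T assume T: "open T" "m\<^sub>0 \<in> T"
    then obtain m where m: "m \<in> T \<inter> Q" using Q_cl in_closure_iff by blast
    then have "m \<in> closure G" using G(2) by (auto simp: Q_def V1_def)
    \<comment> \<open>\<open>G\<close> is dense in \<open>V\<close>; it is applied to the open set
      \<open>T \<inter> Q\<close>, which already contains a point of \<open>V\<close>.\<close>
    then have "(T \<inter> Q) \<inter> G \<noteq> {}" using m open_Int[OF T(1) Q] unfolding in_closure_iff by blast
    then show "T \<inter> D \<noteq> {}" by (auto simp: D_def)
  qed
  have kron: "\<exists>ks. kronecker_type (A1 m) (A2 m) ks" if m: "m \<in> D" for m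
  proof -
    interpret skew_pencil "A1 m" "A2 m" by (rule skew_pencil)
    define w where "w = (\<lambda>(t, i). differential \<A> (H t i) m)"
    have fin: "finite (lenard_indices r k)" and card: "card (lenard_indices r k) = N"
      using card_lenard_indices[of r k] by (simp_all add: N_def)
    have w: "inj_on w (lenard_indices r k)" "vec.independent (w ` lenard_indices r k)"
      using G(3)[of m] m unfolding D_def w_def by blast+
    note cw = complexify_independent[OF fin w]
    show ?thesis
    proof (rule kronecker_type_if_many_chains[where h = "\<lambda>t i. complexify (differential \<A> (H' t i) m)" and T = "{..<r}",
          OF _ _ cw(2)])
      show "chain (A1 m) (A2 m) UNIV (\<lambda>i. complexify (differential \<A> (H' t i) m))" if "t \<in> {..<r}" for t
        using chains that m by (simp add: D_def Q_def V1_def)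
      show "(\<lambda>i. complexify (w i)) ` lenard_indices r k \<subseteq> (\<Union>t\<in>{..<r}. range (\<lambda>i. complexify (differential \<A> (H' t i) m)))"
      proof (rule image_subsetI)
        fix z assume "z \<in> lenard_indices r k"
        then obtain t i where z: "z = (t, i)" "t < r" "i \<le> k t" by (auto simp: lenard_indices_def)
        \<comment> \<open>Since \<open>k t < l t\<close>, the infinite continuation contains all
          functions of the independent family, so their differentials are terms of complete
          chains.\<close>
        then have "H' t i = H t i" using H' kl[of t] by auto
        then have "complexify (w z) = complexify (differential \<A> (H' t i) m)" using z by (simp add: w_def)
        then show "complexify (w z) \<in> (\<Union>t\<in>{..<r}. range (\<lambda>i. complexify (differential \<A> (H' t i) m)))"
          using z(2) by blast
      qed
      show "CARD('n) + number_of_kronecker_blocks (A1 m) (A2 m) \<le> 2 * card ((\<lambda>i. complexify (w i)) ` lenard_indices r k)"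
        using m card by (simp add: card_image[OF cw(1)] D_def Q_def s_def)
    qed
  qed
  have "open {m \<in> D. dm q m \<le> v}" for q v
  proof -
    have "{m \<in> D. dm q m \<le> v} = D \<inter> {m \<in> fst c. dm q m \<le> v}" by (auto simp: D_def Q_def V1_def)
    then show ?thesis using D dm_usc by (simp add: open_Int)
  qed
  moreover have "dm q m \<le> CARD('n \<times> 'n)" for q m unfolding dm_def by (rule vec_dim_le_card)
  ultimately have "\<exists>U v. open U \<and> U \<subseteq> D \<and> m\<^sub>0 \<in> closure U \<and> (\<forall>q\<le>CARD('n). \<forall>m\<in>U. dm q m = v q)"
    by (intro usc_family_constant[OF D D_cl])
  then obtain U v where U: "open U" "U \<subseteq> D" "m\<^sub>0 \<in> closure U" "\<forall>q\<le>CARD('n). \<forall>m\<in>U. dm q m = v q"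
    by (elim exE conjE)
  have "U \<noteq> {}" using U(3) by auto
  then obtain m1 where m1: "m1 \<in> U" by blast
  \<comment> \<open>Homogeneity asks for one list valid at every point of \<open>U\<close>. It is
    taken from a single point and transferred to the others by equality of all dimensions.\<close>
  then obtain ks where ks: "kronecker_type (A1 m1) (A2 m1) ks" using kron U(2) by blast
  have "kronecker_type (A1 m) (A2 m) ks" if m: "m \<in> U" for m
  proof -
    obtain ks' where ks': "kronecker_type (A1 m) (A2 m) ks'" using kron U(2) m by blast
    show ?thesis
      using U(4) m m1 by (intro kronecker_type_transfer[OF skew_pencil skew_pencil ks ks']) (simp add: dm_def)
  qed
  then have "homogeneous_on \<A> B\<^sub>1 B\<^sub>2 U" unfolding homogeneous_on_def by blast
  then show ?thesis using U(1,3) by blast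
qed

end
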